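(* Let $\Psi$ be a doubling function. Assume that the volume doubling condition VD, the Poincaré inequality $\mathrm{PI}(\Psi)$ and the cutoff Sobolev inequality $\mathrm{CS}(\Psi)$ hold, and that $$\liminf_{\lambda\to+\infty}\ \liminf_{r\downarrow0}\ \frac{\lambda^p\,\Psi(r/\lambda)}{\Psi(r)}=0.$$ Then for any $f\in\mathcal{F}$ the measures $\Gamma(f)$ and $m$ are mutually singular, $\Gamma(f)\perp m$. In particular, if VD, $\mathrm{PI}(\beta_p)$ and $\mathrm{CS}(\beta_p)$ hold with some $\beta_p>p$, then $\Gamma(f)\perp m$ for any $f\in\mathcal{F}$.
   Context: **Space.** Throughout, $p\in(1,+\infty)$ is fixed. $(X,d)$ is a complete, locally compact, separable metric space all of whose metric balls $B(x,r)=\{y\in X:d(x,y)<r\}$ are relatively compact, and $m$ is a positive Radon measure on $X$ with full support. Write $V(x,r)=m(B(x,r))$, and $\delta B=B(x,\delta r)$ for a ball $B=B(x,r)$ and $\delta>0$; $u_A=\frac1{m(A)}\int_A u\,\mathrm{d}m$. $\mathrm{diam}(X)\in[0,+\infty]$ is the diameter. The following chain condition CC is always assumed: there is $C_{cc}>0$ such that for all $x,y\in X$ and all positive integers $n$ there are points $x_0=x,x_1,\dots,x_n=y$ in $X$ with $d(x_k,x_{k-1})\le C_{cc}\,d(x,y)/n$ for $k=1,\dots,n$. $\mathcal{B}(X)$ is the Borel $\sigma$-algebra, $C(X)$ (resp. $C_c(X)$) the continuous functions on $X$ (resp. those with compact support), and $\mathrm{supp}(f)$ is the support of the measure $|f|\,\mathrm{d}m$.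 **Doubling function.** A homeomorphism $\Psi:[0,+\infty)\to[0,+\infty)$ (hence strictly increasing, $\Psi(0)=0$) such that there is $C_\Psi>1$ with $\Psi(2r)\le C_\Psi\Psi(r)$ for all $r>0$. **$p$-energy.** $(\mathcal{E},\mathcal{F})$ is a fixed $p$-energy on $(X,d,m)$: $\mathcal{F}$ is a dense subspace of $L^p(X;m)$ and $\mathcal{E}:\mathcal{F}\to[0,+\infty)$ satisfies: (1) $\mathcal{E}^{1/p}$ is a semi-norm on $\mathcal{F}$; (2) $(\mathcal{F},\mathcal{E}(\cdot)^{1/p}+\|\cdot\|_{L^p(X;m)})$ is a Banach space; (3) (Markovian) if $\varphi\in C(\mathbb{R})$, $\varphi(0)=0$, $|\varphi(t)-\varphi(s)|\le|t-s|$ for all $t,s$, then for $f\in\mathcal{F}$ one has $\varphi(f)\in\mathcal{F}$ and $\mathcal{E}(\varphi(f))\le\mathcal{E}(f)$; (4) (Regular) $\mathcal{F}\cap C_c(X)$ is uniformly dense in $C_c(X)$ and dense in $\mathcal{F}$ for the norm in (2); (5) (Strongly local) if $f,g\in\mathcal{F}$ have compact support and $g$ is constant in an open neighborhood of $\mathrm{supp}(f)$, then $\mathcal{E}(f+g)=\mathcal{E}(f)+\mathcal{E}(g)$; (6) ($p$-Clarkson) for $f,g\in\mathcal{F}$, $\mathcal{E}(f+g)+\mathcal{E}(f-g)\ge2(\mathcal{E}(f)^{\frac1{p-1}}+\mathcal{E}(g)^{\frac1{p-1}})^{p-1}$ if $p\in(1,2]$, and the reverse inequality $\le$ if $p\in[2,+\infty)$;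 (7) (Algebra, always assumed) for $f,g\in\mathcal{F}\cap L^\infty(X;m)$, $fg\in\mathcal{F}$ and $\mathcal{E}(fg)^{1/p}\le\|f\|_{L^\infty}\mathcal{E}(g)^{1/p}+\|g\|_{L^\infty}\mathcal{E}(f)^{1/p}$. Write $\mathcal{E}_1(\cdot)=\mathcal{E}(\cdot)+\|\cdot\|_{L^p(X;m)}^p$. **$p$-energy measure.** $\Gamma:\mathcal{F}\times\mathcal{B}(X)\to[0,+\infty)$ is the (canonical) $p$-energy measure associated with $(\mathcal{E},\mathcal{F})$; it satisfies: (a) for $f\in\mathcal{F}$, $\Gamma(f)$ is a positive Radon measure with $\Gamma(f)(X)=\mathcal{E}(f)$; (b) for $A\in\mathcal{B}(X)$, $\Gamma(\cdot)(A)^{1/p}$ is a semi-norm on $\mathcal{F}$; (c) for $f,g\in\mathcal{F}\cap C_c(X)$ and $A\in\mathcal{B}(X)$, if $f-g$ is constant on $A$ then $\Gamma(f)(A)=\Gamma(g)(A)$; (d) the $p$-Clarkson inequality (6) holds with $\mathcal{E}(\cdot)$ replaced by $\Gamma(\cdot)(A)$, for every $A\in\mathcal{B}(X)$; (e) (chain rule) for $f,g\in\mathcal{F}\cap C_c(X)$ and piecewise $C^1$ functions $\varphi,\psi:\mathbb{R}\to\mathbb{R}$ with $\varphi(0)=\psi(0)=0$, $\mathrm{d}\Gamma(\varphi(f);\psi(g))=\mathrm{sgn}(\varphi'(f))|\varphi'(f)|^{p-1}\psi'(g)\,\mathrm{d}\Gamma(f;g)$, where $\Gamma(f;g)=\frac1p\frac{\mathrm{d}}{\mathrm{d}t}\Gamma(f+tg)|_{t=0}$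 is a signed measure; (f) (Leibniz rule) for $f,g,h\in\mathcal{F}\cap C_c(X)$, $\mathrm{d}\Gamma(f;gh)=g\,\mathrm{d}\Gamma(f;h)+h\,\mathrm{d}\Gamma(f;g)$. **Quasi-continuity.** For $U$ open, $\mathrm{cap}_1(U)=\inf\{\mathcal{E}_1(\varphi):\varphi\in\mathcal{F},\ \varphi\ge1\ m\text{-a.e. in }U\}$, and $\mathrm{cap}_1(A)=\inf\{\mathrm{cap}_1(U):U\supseteq A\text{ open}\}$. "q.e." means outside a set of zero $\mathrm{cap}_1$. $u$ is quasi-continuous if for every $\varepsilon>0$ there is an open $G$ with $\mathrm{cap}_1(G)<\varepsilon$ and $u|_{X\setminus G}$ continuous. Each $f\in\mathcal{F}$ has a quasi-continuous modification $\widetilde f$, unique q.e., and uniquely determined $\Gamma(\phi)$-a.e. for each $\phi\in\mathcal{F}$. **Conditions.** VD: there is $C_{VD}>0$ with $V(x,2r)\le C_{VD}V(x,r)$ for all $x\in X$, $r>0$. $\mathrm{PI}(\Psi)$: there are $C_{PI}>0$, $A_{PI}\ge1$ such that for every ball $B$ of radius $r\in(0,\mathrm{diam}(X)/A_{PI})$ and every $f\in\mathcal{F}$, $\int_B|f-f_B|^p\mathrm{d}m\le C_{PI}\Psi(r)\int_{A_{PI}B}\mathrm{d}\Gamma(f)$. Cutoff function: for open $U\subseteq\overline U\subseteq V$, $\phi\in\mathcal{F}$ is a cutoff function for $U\subseteq V$ if $0\le\phi\le1$ in $X$, $\phi=1$ in an open neighborhood of $\overline U$, and $\mathrm{supp}(\phi)\subseteq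 V$. $\mathrm{CS}(\Psi)$: there are $C_1,C_2>0$, $A_S>1$ such that for every ball $B(x,r)$ there is a cutoff function $\phi\in\mathcal{F}$ for $B(x,r)\subseteq B(x,A_Sr)$ such that for every $f\in\mathcal{F}$, $\int_{B(x,A_Sr)}|\widetilde f|^p\mathrm{d}\Gamma(\phi)\le C_1\int_{B(x,A_Sr)}\mathrm{d}\Gamma(f)+\frac{C_2}{\Psi(r)}\int_{B(x,A_Sr)}|f|^p\mathrm{d}m$. For $\beta_p>0$, $\mathrm{PI}(\beta_p)$ and $\mathrm{CS}(\beta_p)$ denote $\mathrm{PI}(\Psi)$ and $\mathrm{CS}(\Psi)$ with $\Psi(r)=r^{\beta_p}$. *)

theory Defs
  imports "HOL-Analysis.Analysis" "HOL-Probability.Essential_Supremum"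
begin

section \<open>Metric measure spaces\<close>

definition radon_measure :: "'a::topological_space measure \<Rightarrow> bool" where
  "radon_measure \<mu> \<longleftrightarrow>
     sets \<mu> = sets borel \<and>
     (\<forall>K. compact K \<longrightarrow> emeasure \<mu> K < \<infinity>) \<and>
     (\<forall>A\<in>sets borel. emeasure \<mu> A = (INF U\<in>{U. open U \<and> A \<subseteq> U}. emeasure \<mu> U)) \<and>
     (\<forall>U. open U \<longrightarrow> emeasure \<mu> U = (SUP K\<in>{K. compact K \<and> K \<subseteq> U}. emeasure \<mu> K))"

definition measure_support :: "'a::topological_space measure \<Rightarrow> 'a set" where
  "measure_support \<mu> = {x. \<forall>U. open U \<and> x \<in> U \<longrightarrow> 0 < emeasure \<mu> U}"

definition supp :: "'a::topological_space measure \<Rightarrow> ('a \<Rightarrow> real) \<Rightarrow> 'a set" where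
  "supp m f = measure_support (density m (\<lambda>x. ennreal \<bar>f x\<bar>))"

definition mutually_singular :: "'a measure \<Rightarrow> 'a measure \<Rightarrow> bool" where
  "mutually_singular \<mu> \<nu> \<longleftrightarrow>
     (\<exists>A\<in>sets \<mu> \<inter> sets \<nu>. emeasure \<mu> A = 0 \<and> emeasure \<nu> (space \<nu> - A) = 0)"

text \<open>The library's \<open>diameter\<close> is real-valued and meaningless for unbounded sets.\<close>

definition ediam :: "'a::metric_space set \<Rightarrow> ereal" where
  "ediam S = (SUP (x, y)\<in>S \<times> S. ereal (dist x y))"

definition chain_condition :: "'a::metric_space itself \<Rightarrow> bool" where
  "chain_condition _ \<longleftrightarrow>
     (\<exists>C>0. \<forall>(x::'a) y. \<forall>n\<ge>1. \<exists>z::nat \<Rightarrow> 'a. z 0 = x \<and> z n = y \<and>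
        (\<forall>k\<in>{1..n}. dist (z k) (z (k - 1)) \<le> C * dist x y / real n))"

definition volume_doubling :: "'a::metric_space measure \<Rightarrow> bool" where
  "volume_doubling m \<longleftrightarrow>
     (\<exists>C>0. \<forall>x. \<forall>r>0. measure m (ball x (2 * r)) \<le> C * measure m (ball x r))"

definition doubling_function :: "(real \<Rightarrow> real) \<Rightarrow> bool" where
  "doubling_function \<Psi> \<longleftrightarrow>
     (\<exists>\<Phi>. homeomorphism {0..} {0..} \<Psi> \<Phi>) \<and>
     (\<exists>C>1. \<forall>r>0. \<Psi> (2 * r) \<le> C * \<Psi> r)"

locale metric_measure_space =
  fixes m :: "'a::polish_space measure"
  assumes locally_compact: "locally compact (UNIV :: 'a set)"
    and relatively_compact_balls: "compact (closure (ball (x :: 'a) r))"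
    and radon: "radon_measure m"
    and full_support: "measure_support m = UNIV"
    and chain_condition: "chain_condition TYPE('a)"

section \<open>Function spaces\<close>

text \<open>
  Elements of \<open>L\<^sup>p\<close> are represented by Borel functions; spaces of classes become sets of functions
  closed under almost everywhere equality.
\<close>

definition Lp_space :: "real \<Rightarrow> 'a measure \<Rightarrow> ('a \<Rightarrow> real) set" where
  "Lp_space p m = {f\<in>borel_measurable m. integrable m (\<lambda>x. \<bar>f x\<bar> powr p)}"

definition Lp_norm :: "real \<Rightarrow> 'a measure \<Rightarrow> ('a \<Rightarrow> real) \<Rightarrow> real" where
  "Lp_norm p m f = (LINT x|m. \<bar>f x\<bar> powr p) powr (1 / p)"

definition Linf_space :: "'a measure \<Rightarrow> ('a \<Rightarrow> real) set" where
  "Linf_space m = {f\<in>borel_measurable m. esssup m (\<lambda>x. ereal \<bar>f x\<bar>) < \<infinity>}"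

definition Linf_norm :: "'a measure \<Rightarrow> ('a \<Rightarrow> real) \<Rightarrow> real" where
  "Linf_norm m f = real_of_ereal (esssup m (\<lambda>x. ereal \<bar>f x\<bar>))"

definition Cc :: "'a::topological_space measure \<Rightarrow> ('a \<Rightarrow> real) set" where
  "Cc m = {f. continuous_on UNIV f \<and> compact (supp m f)}"

definition set_average :: "'a measure \<Rightarrow> 'a set \<Rightarrow> ('a \<Rightarrow> real) \<Rightarrow> real" where
  "set_average m A f = (LINT x:A|m. f x) / measure m A"

definition seminorm_on :: "('a \<Rightarrow> real) set \<Rightarrow> (('a \<Rightarrow> real) \<Rightarrow> real) \<Rightarrow> bool" where
  "seminorm_on F N \<longleftrightarrow>
     (\<forall>f\<in>F. 0 \<le> N f) \<and>
     (\<forall>f\<in>F. \<forall>c. N (\<lambda>x. c * f x) = \<bar>c\<bar> * N f) \<and>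
     (\<forall>f\<in>F. \<forall>g\<in>F. N (\<lambda>x. f x + g x) \<le> N f + N g)"

definition p_clarkson :: "real \<Rightarrow> ('a \<Rightarrow> real) set \<Rightarrow> (('a \<Rightarrow> real) \<Rightarrow> real) \<Rightarrow> bool" where
  "p_clarkson p F Q \<longleftrightarrow>
     (\<forall>f\<in>F. \<forall>g\<in>F.
        (p \<le> 2 \<longrightarrow>
           Q (\<lambda>x. f x + g x) + Q (\<lambda>x. f x - g x)
             \<ge> 2 * (Q f powr (1 / (p - 1)) + Q g powr (1 / (p - 1))) powr (p - 1)) \<and>
        (2 \<le> p \<longrightarrow>
           Q (\<lambda>x. f x + g x) + Q (\<lambda>x. f x - g x)
             \<le> 2 * (Q f powr (1 / (p - 1)) + Q g powr (1 / (p - 1))) powr (p - 1)))"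

section \<open>\<open>p\<close>-energies\<close>

definition energy_norm ::
  "real \<Rightarrow> 'a measure \<Rightarrow> (('a \<Rightarrow> real) \<Rightarrow> real) \<Rightarrow> ('a \<Rightarrow> real) \<Rightarrow> real" where
  "energy_norm p m E f = E f powr (1 / p) + Lp_norm p m f"

definition energy_one ::
  "real \<Rightarrow> 'a measure \<Rightarrow> (('a \<Rightarrow> real) \<Rightarrow> real) \<Rightarrow> ('a \<Rightarrow> real) \<Rightarrow> real" where
  "energy_one p m E f = E f + (LINT x|m. \<bar>f x\<bar> powr p)"

locale p_energy = metric_measure_space m
  for m :: "'a::polish_space measure" +
  fixes p :: real
    and F :: "('a \<Rightarrow> real) set"
    and E :: "('a \<Rightarrow> real) \<Rightarrow> real"
  assumes p_gt_1: "1 < p"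
    and F_subset_Lp: "F \<subseteq> Lp_space p m"
    and AE_invariant:
      "\<lbrakk>f \<in> F; g \<in> borel_measurable m; AE x in m. g x = f x\<rbrakk> \<Longrightarrow> g \<in> F \<and> E g = E f"
    and F_zero: "(\<lambda>_. 0) \<in> F"
    and F_add: "\<lbrakk>f \<in> F; g \<in> F\<rbrakk> \<Longrightarrow> (\<lambda>x. f x + g x) \<in> F"
    and F_scale: "f \<in> F \<Longrightarrow> (\<lambda>x. c * f x) \<in> F"
    and F_dense: "\<lbrakk>f \<in> Lp_space p m; 0 < \<epsilon>\<rbrakk> \<Longrightarrow> \<exists>g\<in>F. Lp_norm p m (\<lambda>x. f x - g x) < \<epsilon>"
    and E_nonneg: "f \<in> F \<Longrightarrow> 0 \<le> E f"
    and E_seminorm: "seminorm_on F (\<lambda>f. E f powr (1 / p))"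
    and banach:
      "\<And>u :: nat \<Rightarrow> 'a \<Rightarrow> real.
        \<lbrakk>\<forall>n. u n \<in> F;
         \<forall>\<epsilon>>0. \<exists>N. \<forall>i\<ge>N. \<forall>j\<ge>N. energy_norm p m E (\<lambda>x. u i x - u j x) < \<epsilon>\<rbrakk>
        \<Longrightarrow> \<exists>f\<in>F. (\<lambda>n. energy_norm p m E (\<lambda>x. u n x - f x)) \<longlonglongrightarrow> 0"
    and markovian:
      "\<lbrakk>f \<in> F; continuous_on UNIV \<phi>; \<phi> 0 = 0; \<forall>s t. \<bar>\<phi> t - \<phi> s\<bar> \<le> \<bar>t - s\<bar>\<rbrakk>
        \<Longrightarrow> (\<lambda>x. \<phi> (f x)) \<in> F \<and> E (\<lambda>x. \<phi> (f x)) \<le> E f"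
    and regular_Cc:
      "\<lbrakk>f \<in> Cc m; 0 < \<epsilon>\<rbrakk> \<Longrightarrow> \<exists>g\<in>F \<inter> Cc m. \<forall>x. \<bar>f x - g x\<bar> < \<epsilon>"
    and regular_F:
      "\<lbrakk>f \<in> F; 0 < \<epsilon>\<rbrakk> \<Longrightarrow> \<exists>g\<in>F \<inter> Cc m. energy_norm p m E (\<lambda>x. f x - g x) < \<epsilon>"
    and strongly_local:
      "\<lbrakk>f \<in> F; g \<in> F; compact (supp m f); compact (supp m g);
        open U; supp m f \<subseteq> U; AE x in m. x \<in> U \<longrightarrow> g x = c\<rbrakk>
        \<Longrightarrow> E (\<lambda>x. f x + g x) = E f + E g"
    and E_clarkson: "p_clarkson p F E"
    and algebra:
      "\<lbrakk>f \<in> F \<inter> Linf_space m; g \<in> F \<inter> Linf_space m\<rbrakk>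
        \<Longrightarrow> (\<lambda>x. f x * g x) \<in> F \<and>
            E (\<lambda>x. f x * g x) powr (1 / p)
              \<le> Linf_norm m f * E g powr (1 / p) + Linf_norm m g * E f powr (1 / p)"

section \<open>\<open>p\<close>-energy measures\<close>

text \<open>
  A (finite) signed measure is a set function \<open>\<nu>\<close> on the Borel sets that is a difference of two
  finite measures, and integration against \<open>\<nu>\<close> is the difference of the two integrals, which does
  not depend on the choice of the decomposition.
\<close>

definition signed_decomposition ::
  "('a::topological_space set \<Rightarrow> real) \<Rightarrow> 'a measure \<Rightarrow> 'a measure \<Rightarrow> bool" where
  "signed_decomposition \<nu> P N \<longleftrightarrow>
     finite_measure P \<and> finite_measure N \<and> sets P = sets borel \<and> sets N = sets borel \<and>
     (\<forall>A\<in>sets borel. \<nu> A = measure P A - measure N A)"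

definition signed_measure :: "('a::topological_space set \<Rightarrow> real) \<Rightarrow> bool" where
  "signed_measure \<nu> \<longleftrightarrow> (\<exists>P N. signed_decomposition \<nu> P N)"

definition signed_integral ::
  "('a::topological_space set \<Rightarrow> real) \<Rightarrow> 'a set \<Rightarrow> ('a \<Rightarrow> real) \<Rightarrow> real" where
  "signed_integral \<nu> A h =
     (THE v. \<exists>P N. signed_decomposition \<nu> P N \<and> set_integrable P A h \<and> set_integrable N A h \<and>
        v = (LINT x:A|P. h x) - (LINT x:A|N. h x))"

text \<open>
  Piecewise \<open>C\<^sup>1\<close> includes finite one-sided limits of the derivative at the break points; the library
  predicate \<open>piecewise_C1_differentiable_on\<close> does not, and would admit \<open>\<lambda>t. sqrt \<bar>t\<bar>\<close>.
\<close>

definition piecewise_C1 :: "(real \<Rightarrow> real) \<Rightarrow> bool" where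
  "piecewise_C1 \<phi> \<longleftrightarrow>
     continuous_on UNIV \<phi> \<and>
     (\<exists>S. finite S \<and>
        (\<forall>t. t \<notin> S \<longrightarrow> \<phi> field_differentiable (at t)) \<and>
        continuous_on (- S) (deriv \<phi>) \<and>
        (\<forall>s\<in>S. (\<exists>l. (deriv \<phi> \<longlongrightarrow> l) (at_left s)) \<and> (\<exists>l. (deriv \<phi> \<longlongrightarrow> l) (at_right s))))"

definition mutual_energy ::
  "real \<Rightarrow> (('a \<Rightarrow> real) \<Rightarrow> 'a measure) \<Rightarrow> ('a \<Rightarrow> real) \<Rightarrow> ('a \<Rightarrow> real) \<Rightarrow> 'a set \<Rightarrow> real" where
  "mutual_energy p \<Gamma> f g A = (1 / p) * deriv (\<lambda>t. measure (\<Gamma> (\<lambda>x. f x + t * g x)) A) 0"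

text \<open>
  In \<open>chain_rule\<close> the value of \<open>deriv\<close> at a break point is immaterial: both sides vanish on subsets
  of level sets of \<open>f\<close> and of \<open>g\<close> by \<open>\<Gamma>_local\<close> and homogeneity.
\<close>

locale p_energy_measure = p_energy m p F E
  for m :: "'a::polish_space measure"
    and p :: real
    and F :: "('a \<Rightarrow> real) set"
    and E :: "('a \<Rightarrow> real) \<Rightarrow> real" +
  fixes \<Gamma> :: "('a \<Rightarrow> real) \<Rightarrow> 'a measure"
  assumes \<Gamma>_radon: "f \<in> F \<Longrightarrow> radon_measure (\<Gamma> f)"
    and \<Gamma>_total: "f \<in> F \<Longrightarrow> emeasure (\<Gamma> f) UNIV = ennreal (E f)"
    and \<Gamma>_seminorm: "A \<in> sets borel \<Longrightarrow> seminorm_on F (\<lambda>f. measure (\<Gamma> f) A powr (1 / p))"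
    and \<Gamma>_local:
      "\<lbrakk>f \<in> F \<inter> Cc m; g \<in> F \<inter> Cc m; A \<in> sets borel; \<forall>x\<in>A. f x - g x = c\<rbrakk>
        \<Longrightarrow> measure (\<Gamma> f) A = measure (\<Gamma> g) A"
    and \<Gamma>_clarkson: "A \<in> sets borel \<Longrightarrow> p_clarkson p F (\<lambda>f. measure (\<Gamma> f) A)"
    and \<Gamma>_differentiable:
      "\<lbrakk>f \<in> F \<inter> Cc m; g \<in> F \<inter> Cc m; A \<in> sets borel\<rbrakk>
        \<Longrightarrow> (\<lambda>t. measure (\<Gamma> (\<lambda>x. f x + t * g x)) A) field_differentiable (at 0)"
    and mutual_energy_signed_measure:
      "\<lbrakk>f \<in> F \<inter> Cc m; g \<in> F \<inter> Cc m\<rbrakk> \<Longrightarrow> signed_measure (mutual_energy p \<Gamma> f g)"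
    and chain_rule:
      "\<lbrakk>f \<in> F \<inter> Cc m; g \<in> F \<inter> Cc m; piecewise_C1 \<phi>; piecewise_C1 \<psi>; \<phi> 0 = 0; \<psi> 0 = 0;
        A \<in> sets borel\<rbrakk>
        \<Longrightarrow> mutual_energy p \<Gamma> (\<lambda>x. \<phi> (f x)) (\<lambda>x. \<psi> (g x)) A =
            signed_integral (mutual_energy p \<Gamma> f g) A
              (\<lambda>x. sgn (deriv \<phi> (f x)) * \<bar>deriv \<phi> (f x)\<bar> powr (p - 1) * deriv \<psi> (g x))"
    and leibniz_rule:
      "\<lbrakk>f \<in> F \<inter> Cc m; g \<in> F \<inter> Cc m; h \<in> F \<inter> Cc m; A \<in> sets borel\<rbrakk>
        \<Longrightarrow> mutual_energy p \<Gamma> f (\<lambda>x. g x * h x) A =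
            signed_integral (mutual_energy p \<Gamma> f h) A g +
            signed_integral (mutual_energy p \<Gamma> f g) A h"

section \<open>Quasi-continuity\<close>

text \<open>The capacity \<open>cap\<^sub>1\<close> of an open set; the infimum is infinite if no competitor exists.\<close>

definition cap1 ::
  "real \<Rightarrow> 'a::topological_space measure \<Rightarrow> ('a \<Rightarrow> real) set \<Rightarrow> (('a \<Rightarrow> real) \<Rightarrow> real)
    \<Rightarrow> 'a set \<Rightarrow> ennreal" where
  "cap1 p m F E U =
     (INF \<phi>\<in>{\<phi>\<in>F. AE x in m. x \<in> U \<longrightarrow> 1 \<le> \<phi> x}. ennreal (energy_one p m E \<phi>))"

definition quasi_continuous ::
  "real \<Rightarrow> 'a::topological_space measure \<Rightarrow> ('a \<Rightarrow> real) set \<Rightarrow> (('a \<Rightarrow> real) \<Rightarrow> real)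
    \<Rightarrow> ('a \<Rightarrow> real) \<Rightarrow> bool" where
  "quasi_continuous p m F E u \<longleftrightarrow>
     (\<forall>\<epsilon>>0. \<exists>G. open G \<and> cap1 p m F E G < ennreal \<epsilon> \<and> continuous_on (- G) u)"

text \<open>Modifications are taken Borel, so that they can be integrated against \<open>\<Gamma> \<phi>\<close>.\<close>

definition quasi_continuous_modification ::
  "real \<Rightarrow> 'a::topological_space measure \<Rightarrow> ('a \<Rightarrow> real) set \<Rightarrow> (('a \<Rightarrow> real) \<Rightarrow> real)
    \<Rightarrow> ('a \<Rightarrow> real) \<Rightarrow> ('a \<Rightarrow> real) \<Rightarrow> bool" where
  "quasi_continuous_modification p m F E f u \<longleftrightarrow>
     u \<in> borel_measurable borel \<and> quasi_continuous p m F E u \<and> (AE x in m. u x = f x)"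

section \<open>Functional inequalities\<close>

definition poincare_inequality ::
  "real \<Rightarrow> 'a::metric_space measure \<Rightarrow> ('a \<Rightarrow> real) set \<Rightarrow> (('a \<Rightarrow> real) \<Rightarrow> 'a measure)
    \<Rightarrow> (real \<Rightarrow> real) \<Rightarrow> bool" where
  "poincare_inequality p m F \<Gamma> \<Psi> \<longleftrightarrow>
     (\<exists>C>0. \<exists>A\<ge>1. \<forall>x. \<forall>r>0. ereal r < ediam (UNIV :: 'a set) / ereal A \<longrightarrow>
        (\<forall>f\<in>F. (LINT y:ball x r|m. \<bar>f y - set_average m (ball x r) f\<bar> powr p)
                  \<le> C * \<Psi> r * measure (\<Gamma> f) (ball x (A * r))))"

text \<open>
  Members of \<open>F\<close> are only determined almost everywhere, so the pointwise conditions on a cutoff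
  function are meant almost everywhere.
\<close>

definition cutoff_function ::
  "'a::topological_space measure \<Rightarrow> ('a \<Rightarrow> real) set \<Rightarrow> 'a set \<Rightarrow> 'a set \<Rightarrow> ('a \<Rightarrow> real) \<Rightarrow> bool" where
  "cutoff_function m F U V \<phi> \<longleftrightarrow>
     open U \<and> open V \<and> closure U \<subseteq> V \<and> \<phi> \<in> F \<and>
     (AE x in m. 0 \<le> \<phi> x \<and> \<phi> x \<le> 1) \<and>
     (\<exists>W. open W \<and> closure U \<subseteq> W \<and> (AE x in m. x \<in> W \<longrightarrow> \<phi> x = 1)) \<and>
     supp m \<phi> \<subseteq> V"

definition cutoff_sobolev ::
  "real \<Rightarrow> 'a::metric_space measure \<Rightarrow> ('a \<Rightarrow> real) set \<Rightarrow> (('a \<Rightarrow> real) \<Rightarrow> real)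
    \<Rightarrow> (('a \<Rightarrow> real) \<Rightarrow> 'a measure) \<Rightarrow> (real \<Rightarrow> real) \<Rightarrow> bool" where
  "cutoff_sobolev p m F E \<Gamma> \<Psi> \<longleftrightarrow>
     (\<exists>C\<^sub>1>0. \<exists>C\<^sub>2>0. \<exists>A>1. \<forall>x. \<forall>r>0. \<exists>\<phi>. cutoff_function m F (ball x r) (ball x (A * r)) \<phi> \<and>
        (\<forall>f\<in>F. \<forall>u. quasi_continuous_modification p m F E f u \<longrightarrow>
           (\<integral>\<^sup>+y\<in>ball x (A * r). ennreal (\<bar>u y\<bar> powr p) \<partial>\<Gamma> \<phi>)
             \<le> ennreal (C\<^sub>1 * measure (\<Gamma> f) (ball x (A * r))
                 + C\<^sub>2 / \<Psi> r * (LINT y:ball x (A * r)|m. \<bar>f y\<bar> powr p))))"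

end

theory Submission
  imports Defs
begin

text \<open>
  Suppose that \<open>\<Gamma> f\<close> is not singular to \<open>m\<close>. Then there is a compact set \<open>K\<close> of positive measure on
  which the two measures are comparable (\<open>comparable_on_compact\<close>), and at every small scale \<open>r\<close> there
  are disjoint balls \<open>B\<close> of radius comparable with \<open>r\<close> that \<open>K\<close> fills almost completely and that carry a
  fixed part of its measure (\<open>good_centres\<close>). In such a ball \<open>\<Gamma> f\<close> has bounded density not only at the
  scale \<open>r\<close> but also at the scale \<open>r / l\<close> for a fixed large \<open>l\<close>. The Poincare inequality at the smaller
  scale and chains of about \<open>l\<close> small balls then show that \<open>f\<close> differs from a constant \<open>c\<close> on \<open>B\<close>, in the
  \<open>p\<close>-th mean, by at most a multiple of \<open>l * \<Psi> (r / l) powr (1 / p)\<close> (\<open>poincare_oscillation\<close>). By the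
  hypothesis on \<open>\<Psi>\<close> this is much less than \<open>\<Psi> r powr (1 / p)\<close>, the size of an oscillation that energy of
  this density produces at the scale \<open>r\<close>. So on \<open>B\<close> the function \<open>f\<close> is too flat for its energy.

  To turn this into a contradiction, let \<open>\<phi>\<close> be a cutoff function of \<open>B\<close>. The cutoff Sobolev inequality
  for functions that are constant near \<open>B\<close> bounds its energy by a multiple of \<open>m B / \<Psi> r\<close>
  (\<open>core_cutoff\<close>). Let \<open>h = \<phi> * T (f - c)\<close>, where \<open>T\<close> truncates at the height
  \<open>t = \<delta> * \<Psi> r powr (1 / p)\<close>. By the Leibniz rule, the first variation of the energy of \<open>f\<close> in the
  direction \<open>h\<close> is the integral of \<open>\<phi>\<close> over \<open>{\<bar>f - c\<bar> < t}\<close> with respect to \<open>\<Gamma> f\<close>, up to the integral of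
  \<open>T (f - c)\<close> with respect to the mutual energy of \<open>f\<close> and \<open>\<phi>\<close>. The second integral is at most a
  multiple of \<open>\<delta> * m B\<close>. The first is at least a fixed multiple of \<open>m B\<close>, because \<open>\<bar>f - c\<bar> \<ge> t\<close> holds
  only on a small part of \<open>B\<close>.

  The sum of these \<open>h\<close> over the disjoint balls of one scale is a function whose first variation is bounded
  below by a positive constant independent of \<open>r\<close>, whose energy is bounded, and whose \<open>L\<^sup>p\<close> norm tends to
  zero with \<open>r\<close>. Such functions tend to zero weakly in the domain, while the first variation is a bounded
  linear functional of the direction (\<open>no_persistent_first_variation\<close>). In place of duality, the
  \<open>p\<close>-Clarkson inequality yields convex combinations that tend to zero in the energy norm
  (\<open>strong_approximation\<close>).

  All this applies to continuous \<open>f\<close> of compact support; since these are dense in the domain and \<open>\<Gamma>\<close> is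
  continuous, the null sets found for an approximating sequence can be combined into one for its limit
  (\<open>singular_of_core_singular\<close>).
\<close>

section \<open>Powers and homogeneous functionals\<close>

lemma powr_convex_combination_le:
  fixes a b s q :: real
  assumes "0 \<le> a" "0 \<le> b" "0 \<le> s" "s \<le> 1" "1 \<le> q"
  shows "((1 - s) * a + s * b) powr q \<le> (1 - s) * a powr q + s * b powr q"
proof -
  have small: "(t * c) powr q \<le> t * c powr q" if "0 \<le> t" "t \<le> 1" "0 \<le> c" for t c :: real
  proof -
    have "t powr q \<le> t powr 1" using that assms powr_mono'[of 1 q t] by (cases "t = 0") auto
    then have "t powr q \<le> t" using that by simp
    then show ?thesis using that by (simp add: powr_mult mult_right_mono)
  qed
  consider "a = 0" | "b = 0" | "0 < a" "0 < b" using assms by linarith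
  then show ?thesis
  proof cases
    case 1 then show ?thesis using small[of s b] assms by simp
  next
    case 2 then show ?thesis using small[of "1 - s" a] assms by simp
  next
    case 3
    show ?thesis
      using convex_onD[OF powr_convex[OF assms(5)], of s a b] 3 assms by simp
  qed
qed

lemma powr_add_le_two_powr:
  fixes a b q :: real
  assumes "0 \<le> a" "0 \<le> b" "0 \<le> q"
  shows "(a + b) powr q \<le> 2 powr q * (a powr q + b powr q)"
proof -
  have "(a + b) powr q \<le> (2 * max a b) powr q" using assms by (intro powr_mono2) auto
  also have "\<dots> = 2 powr q * (max a b) powr q" using assms by (simp add: powr_mult)
  also have "\<dots> \<le> 2 powr q * (a powr q + b powr q)"
    by (intro mult_left_mono) (auto simp: max_def)
  finally show ?thesis .
qed

lemma sum_disjoint_supports: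
  fixes h :: "'i \<Rightarrow> 'a \<Rightarrow> real"
  assumes "finite I" "disjoint_family_on V I" "i \<in> I" "x \<in> V i" "\<And>j y. j \<in> I \<Longrightarrow> y \<notin> V j \<Longrightarrow> h j y = 0"
  shows "(\<Sum>j\<in>I. h j x) = h i x"
proof -
  have "h j x = 0" if "j \<in> I - {i}" for j
    using assms that unfolding disjoint_family_on_def by (metis DiffE disjoint_iff singletonI)
  then show ?thesis
    using sum.remove[OF assms(1,3), of "\<lambda>j. h j x"] by simp
qed

text \<open>
  This covers the energy \<open>E\<close> and, for every Borel set \<open>A\<close>, the functional that maps \<open>f\<close> to the
  \<open>\<Gamma> f\<close>-measure of \<open>A\<close>.
\<close>

locale homogeneous_functional =
  fixes q :: real and G :: "('a \<Rightarrow> real) set" and Q :: "('a \<Rightarrow> real) \<Rightarrow> real"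
  assumes q_gt_1: "1 < q"
    and Q_nonneg: "f \<in> G \<Longrightarrow> 0 \<le> Q f"
    and seminorm: "seminorm_on G (\<lambda>f. Q f powr (1 / q))"
    and G_scale: "f \<in> G \<Longrightarrow> (\<lambda>x. c * f x) \<in> G"
    and G_add: "f \<in> G \<Longrightarrow> g \<in> G \<Longrightarrow> (\<lambda>x. f x + g x) \<in> G"
begin

lemma root_powr: "f \<in> G \<Longrightarrow> (Q f powr (1 / q)) powr q = Q f"
  using Q_nonneg q_gt_1 by (simp add: powr_powr)

lemma homogeneous: "f \<in> G \<Longrightarrow> Q (\<lambda>x. c * f x) = \<bar>c\<bar> powr q * Q f"
proof -
  assume f: "f \<in> G"
  have "Q (\<lambda>x. c * f x) powr (1 / q) = \<bar>c\<bar> * Q f powr (1 / q)"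
    using seminorm f unfolding seminorm_on_def by blast
  then have "(Q (\<lambda>x. c * f x) powr (1 / q)) powr q = \<bar>c\<bar> powr q * (Q f powr (1 / q)) powr q"
    by (simp add: powr_mult)
  then show ?thesis using f G_scale root_powr by simp
qed

lemma root_triangle:
  "f \<in> G \<Longrightarrow> g \<in> G \<Longrightarrow> Q (\<lambda>x. f x + g x) powr (1 / q) \<le> Q f powr (1 / q) + Q g powr (1 / q)"
  using seminorm unfolding seminorm_on_def by blast

lemma triangle_powr:
  assumes "f \<in> G" "g \<in> G"
  shows "Q (\<lambda>x. f x + g x) \<le> (Q f powr (1 / q) + Q g powr (1 / q)) powr q"
proof -
  have "(Q (\<lambda>x. f x + g x) powr (1 / q)) powr q \<le> (Q f powr (1 / q) + Q g powr (1 / q)) powr q"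
    using root_triangle[OF assms] q_gt_1 by (intro powr_mono2) auto
  then show ?thesis using root_powr[OF G_add[OF assms]] by simp
qed

lemma quasi_triangle:
  assumes "f \<in> G" "g \<in> G"
  shows "Q (\<lambda>x. f x + g x) \<le> 2 powr q * (Q f + Q g)"
  using triangle_powr[OF assms] powr_add_le_two_powr[of "Q f powr (1 / q)" "Q g powr (1 / q)" q]
    root_powr assms q_gt_1 by simp

lemma convex:
  assumes "f \<in> G" "g \<in> G" "0 \<le> s" "s \<le> 1"
  shows "Q (\<lambda>x. (1 - s) * f x + s * g x) \<le> (1 - s) * Q f + s * Q g"
proof -
  have "Q (\<lambda>x. (1 - s) * f x + s * g x)
      \<le> (Q (\<lambda>x. (1 - s) * f x) powr (1 / q) + Q (\<lambda>x. s * g x) powr (1 / q)) powr q"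
    using assms by (intro triangle_powr G_scale)
  also have "\<dots> = ((1 - s) * Q f powr (1 / q) + s * Q g powr (1 / q)) powr q"
    using seminorm assms unfolding seminorm_on_def by simp
  also have "\<dots> \<le> (1 - s) * (Q f powr (1 / q)) powr q + s * (Q g powr (1 / q)) powr q"
    using assms q_gt_1 by (intro powr_convex_combination_le) auto
  finally show ?thesis using root_powr assms by simp
qed

end

text \<open>
  Weighted lists of measures stand for nonnegative linear combinations of measures; an inequality
  between two such combinations on all sets passes to the integrals.
\<close>

lemma nn_integral_mono_combination:
  fixes Ms Ns :: "(ennreal \<times> 'a measure) list"
  assumes sets: "\<And>c M. (c, M) \<in> set (Ms @ Ns) \<Longrightarrow> sets M = sets S"
    and le: "\<And>A. A \<in> sets S \<Longrightarrow>
      (\<Sum>(c, M)\<leftarrow>Ms. c * emeasure M A) \<le> (\<Sum>(c, M)\<leftarrow>Ns. c * emeasure M A)"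
    and h: "h \<in> borel_measurable S"
  shows "(\<Sum>(c, M)\<leftarrow>Ms. c * (\<integral>\<^sup>+x. h x \<partial>M)) \<le> (\<Sum>(c, M)\<leftarrow>Ns. c * (\<integral>\<^sup>+x. h x \<partial>M))"
proof -
  define I where "I Ls u = (\<Sum>(c, M)\<leftarrow>Ls. c * (\<integral>\<^sup>+x. u x \<partial>M))" for Ls :: "(ennreal \<times> 'a measure) list" and u :: "'a \<Rightarrow> ennreal"
  define ok where "ok Ls \<longleftrightarrow> (\<forall>(c, M)\<in>set Ls. sets M = sets S)" for Ls :: "(ennreal \<times> 'a measure) list"
  have ok: "ok Ms" "ok Ns" using sets unfolding ok_def by auto
  have meas: "u \<in> borel_measurable M" if "u \<in> borel_measurable S" "sets M = sets S" for u :: "'a \<Rightarrow> ennreal" and M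
    using that by (simp cong: measurable_cong_sets)
  have I_cong: "I Ls u = I Ls v" if "ok Ls" "\<And>x. x \<in> space S \<Longrightarrow> u x = v x" for Ls u v
    using that unfolding I_def ok_def
    by (intro arg_cong[where f=sum_list] map_cong refl)
       (auto intro!: arg_cong2[where f="(*)"] nn_integral_cong dest!: sets_eq_imp_space_eq)
  have I_ind: "I Ls (indicator A) = (\<Sum>(c, M)\<leftarrow>Ls. c * emeasure M A)" if "ok Ls" "A \<in> sets S" for Ls A
    using that unfolding I_def ok_def
    by (intro arg_cong[where f=sum_list] map_cong refl) auto
  have I_mult: "I Ls (\<lambda>x. c * u x) = c * I Ls u" if "ok Ls" "u \<in> borel_measurable S" for Ls c u
    using that unfolding I_def ok_def
    by (induction Ls) (auto simp: nn_integral_cmult meas distrib_left mult.left_commute)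
  have I_add: "I Ls (\<lambda>x. u x + v x) = I Ls u + I Ls v"
    if "ok Ls" "u \<in> borel_measurable S" "v \<in> borel_measurable S" for Ls u v
    using that unfolding I_def ok_def
    by (induction Ls) (auto simp: nn_integral_add meas distrib_left ac_simps)
  have I_mono: "I Ls u \<le> I Ls v" if "u \<le> v" for Ls u v
    unfolding I_def using that
    by (intro sum_list_mono) (auto intro!: mult_left_mono nn_integral_mono simp: le_fun_def)
  have I_sup: "I Ls (SUP i. U i) = (SUP i. I Ls (U i))"
    if "ok Ls" "\<And>i. U i \<in> borel_measurable S" "incseq U" for Ls and U :: "nat \<Rightarrow> 'a \<Rightarrow> ennreal"
    using that(1)
  proof (induction Ls)
    case Nil then show ?case by (simp add: I_def)
  next
    case (Cons a Ls)
    obtain c M where a: "a = (c, M)" by (cases a)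
    have okL: "ok Ls" and M: "sets M = sets S" using Cons.prems a by (auto simp: ok_def)
    have step: "I (a # Ls) u = c * (\<integral>\<^sup>+x. u x \<partial>M) + I Ls u" for u by (simp add: I_def a)
    have "(\<integral>\<^sup>+x. (SUP i. U i) x \<partial>M) = (SUP i. \<integral>\<^sup>+x. U i x \<partial>M)"
      using nn_integral_monotone_convergence_SUP[OF that(3), of M] that(2) M
      by (simp add: meas SUP_apply[abs_def])
    then have "c * (\<integral>\<^sup>+x. (SUP i. U i) x \<partial>M) = (SUP i. c * (\<integral>\<^sup>+x. U i x \<partial>M))"
      by (simp add: SUP_mult_left_ennreal)
    then have "I (a # Ls) (SUP i. U i) = (SUP i. c * (\<integral>\<^sup>+x. U i x \<partial>M)) + (SUP i. I Ls (U i))"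
      by (simp only: step Cons.IH[OF okL])
    also have "\<dots> = (SUP i. c * (\<integral>\<^sup>+x. U i x \<partial>M) + I Ls (U i))"
      using \<open>incseq U\<close>
      by (intro ennreal_SUP_add[symmetric])
         (auto simp: incseq_def le_fun_def intro!: mult_left_mono nn_integral_mono I_mono)
    finally show ?case by (simp only: step)
  qed
  from h have "I Ms h \<le> I Ns h"
  proof (induction rule: borel_measurable_induct)
    case (cong f g) then show ?case using I_cong ok by metis
  next
    case (set A) then show ?case using I_ind ok le by simp
  next
    case (mult u c) then show ?case using I_mult ok by (simp add: mult_left_mono)
  next
    case (add u v) then show ?case using I_add ok by (simp add: add_mono)
  next
    case (seq U)
    show ?case
      unfolding I_sup[OF ok(1) seq(1) \<open>incseq U\<close>] I_sup[OF ok(2) seq(1) \<open>incseq U\<close>]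
      using seq.IH by (intro SUP_mono) auto
  qed
  then show ?thesis unfolding I_def .
qed

lemma integral_mono_combination:
  fixes Ms Ns :: "(real \<times> 'a measure) list" and u :: "'a \<Rightarrow> real"
  assumes ok: "\<And>c M. (c, M) \<in> set (Ms @ Ns) \<Longrightarrow> 0 \<le> c \<and> finite_measure M \<and> sets M = sets S"
    and le: "\<And>A. A \<in> sets S \<Longrightarrow>
      (\<Sum>(c, M)\<leftarrow>Ms. c * measure M A) \<le> (\<Sum>(c, M)\<leftarrow>Ns. c * measure M A)"
    and u: "u \<in> borel_measurable S" "\<And>x. 0 \<le> u x" "\<And>x. u x \<le> k"
  shows "(\<Sum>(c, M)\<leftarrow>Ms. c * (\<integral>x. u x \<partial>M)) \<le> (\<Sum>(c, M)\<leftarrow>Ns. c * (\<integral>x. u x \<partial>M))"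
proof -
  define E where "E = map (\<lambda>(c :: real, M :: 'a measure). (ennreal c, M))"
  define ok' where "ok' Ls \<longleftrightarrow> (\<forall>(c, M)\<in>set Ls. 0 \<le> c \<and> finite_measure M \<and> sets M = sets S)"
    for Ls :: "(real \<times> 'a measure) list"
  have ok': "ok' Ms" "ok' Ns" using ok unfolding ok'_def by auto
  have int: "integrable M u" if "finite_measure M" "sets M = sets S" for M
  proof -
    have "u \<in> borel_measurable M" using u(1) that(2) by (simp cong: measurable_cong_sets)
    moreover have "AE x in M. norm (u x) \<le> k" using u(2,3) by simp
    ultimately show ?thesis
      using finite_measure.integrable_const_bound[OF that(1)] by blast
  qed
  have nonneg: "0 \<le> (\<Sum>(c, M)\<leftarrow>Ls. c * measure M A)" "0 \<le> (\<Sum>(c, M)\<leftarrow>Ls. c * (\<integral>x. u x \<partial>M))"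
    if "ok' Ls" for Ls A
    using that u(2) unfolding ok'_def by (auto intro!: sum_list_nonneg mult_nonneg_nonneg integral_nonneg)
  have meas: "(\<Sum>(c, M)\<leftarrow>E Ls. c * emeasure M A) = ennreal (\<Sum>(c, M)\<leftarrow>Ls. c * measure M A)"
    if "ok' Ls" for Ls A
    using that
  proof (induction Ls)
    case (Cons a Ls)
    then have "ok' Ls" by (simp add: ok'_def)
    with Cons nonneg(1)[OF this, of A] show ?case
      by (auto simp: E_def ok'_def finite_measure.emeasure_eq_measure ennreal_mult'' ennreal_plus
          split: prod.splits)
  qed (simp add: E_def)
  have integ: "(\<Sum>(c, M)\<leftarrow>E Ls. c * (\<integral>\<^sup>+x. ennreal (u x) \<partial>M)) = ennreal (\<Sum>(c, M)\<leftarrow>Ls. c * (\<integral>x. u x \<partial>M))"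
    if "ok' Ls" for Ls
    using that
  proof (induction Ls)
    case (Cons a Ls)
    then have "ok' Ls" by (simp add: ok'_def)
    with Cons nonneg(2)[OF this] u(2) show ?case
      by (auto simp: E_def ok'_def nn_integral_eq_integral int ennreal_mult'' ennreal_plus integral_nonneg
          split: prod.splits)
  qed (simp add: E_def)
  have "(\<Sum>(c, M)\<leftarrow>E Ms. c * (\<integral>\<^sup>+x. ennreal (u x) \<partial>M)) \<le> (\<Sum>(c, M)\<leftarrow>E Ns. c * (\<integral>\<^sup>+x. ennreal (u x) \<partial>M))"
  proof (rule nn_integral_mono_combination[where S=S])
    show "sets M = sets S" if "(c, M) \<in> set (E Ms @ E Ns)" for c M
      using that ok' unfolding E_def ok'_def by auto
    show "(\<Sum>(c, M)\<leftarrow>E Ms. c * emeasure M A) \<le> (\<Sum>(c, M)\<leftarrow>E Ns. c * emeasure M A)" if "A \<in> sets S" for A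
      unfolding meas[OF ok'(1)] meas[OF ok'(2)] using le[OF that] by (rule ennreal_leI)
    show "(\<lambda>x. ennreal (u x)) \<in> borel_measurable S" using u(1) by simp
  qed
  then show ?thesis
    unfolding integ[OF ok'(1)] integ[OF ok'(2)] using nonneg(2)[OF ok'(2)] by simp
qed

lemma density_indicator:
  fixes M :: "'a::topological_space measure"
  assumes M: "sets M = sets borel" and S: "S \<in> sets borel" "emeasure M S < \<infinity>"
  shows "finite_measure (density M (indicator S))"
    and "B \<in> sets borel \<Longrightarrow> emeasure (density M (indicator S)) B = emeasure M (S \<inter> B)"
    and "u \<in> borel_measurable borel \<Longrightarrow> (\<integral>x. u x \<partial>density M (indicator S)) = (LINT x:S|M. (u x :: real))"
proof -
  have em: "emeasure (density M (indicator S)) B = emeasure M (S \<inter> B)" if "B \<in> sets borel" for B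
  proof -
    have "emeasure (density M (indicator S)) B = (\<integral>\<^sup>+x. indicator S x * indicator B x \<partial>M)"
      using M S that by (intro emeasure_density) (auto cong: measurable_cong_sets)
    also have "\<dots> = (\<integral>\<^sup>+x. indicator (S \<inter> B) x \<partial>M)"
      by (intro nn_integral_cong) (auto simp: indicator_def)
    finally show ?thesis using M S that by simp
  qed
  then show "B \<in> sets borel \<Longrightarrow> emeasure (density M (indicator S)) B = emeasure M (S \<inter> B)" .
  have "space M = UNIV" using sets_eq_imp_space_eq[OF M] by simp
  then show "finite_measure (density M (indicator S))"
    using em[of UNIV] S(2) by (intro finite_measureI) simp
  assume u: "u \<in> borel_measurable borel"
  have "(\<integral>x. u x \<partial>density M (indicator S)) = (\<integral>x. u x \<partial>density M (\<lambda>x. ennreal (indicator S x)))"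
    by (simp add: ennreal_indicator)
  also have "\<dots> = (\<integral>x. indicator S x *\<^sub>R u x \<partial>M)"
    using u S M by (intro integral_density) (auto cong: measurable_cong_sets)
  finally show "(\<integral>x. u x \<partial>density M (indicator S)) = (LINT x:S|M. u x)"
    by (simp add: set_lebesgue_integral_def)
qed

section \<open>Integration against signed measures\<close>

lemma set_integrable_bounded:
  fixes h :: "'a::topological_space \<Rightarrow> real"
  assumes "finite_measure P" "sets P = sets borel" "A \<in> sets borel" "h \<in> borel_measurable borel"
    "\<And>x. x \<in> A \<Longrightarrow> \<bar>h x\<bar> \<le> k"
  shows "set_integrable P A h"
proof -
  have "(\<lambda>x. indicator A x * h x) \<in> borel_measurable P"
    using assms(2-4) by (simp cong: measurable_cong_sets)
  moreover have "AE x in P. norm (indicator A x * h x) \<le> \<bar>k\<bar>"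
  proof (rule AE_I2)
    show "norm (indicator A x * h x) \<le> \<bar>k\<bar>" for x using assms(5)[of x] by (cases "x \<in> A") auto
  qed
  ultimately have "integrable P (\<lambda>x. indicator A x * h x)"
    by (rule finite_measure.integrable_const_bound[OF assms(1), rotated])
  then show ?thesis by (simp add: set_integrable_def)
qed

lemma set_integral_split_sign:
  fixes h :: "'a::topological_space \<Rightarrow> real"
  assumes "finite_measure P" "sets P = sets borel" "A \<in> sets borel" "h \<in> borel_measurable borel"
    "\<And>x. x \<in> A \<Longrightarrow> \<bar>h x\<bar> \<le> k"
  shows "(LINT x:A|P. h x) =
    (\<integral>x. indicator A x * max 0 (h x) \<partial>P) - (\<integral>x. indicator A x * max 0 (- h x) \<partial>P)"
proof -
  have "set_integrable P A (\<lambda>x. max 0 (h x))" "set_integrable P A (\<lambda>x. max 0 (- h x))"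
    by (rule set_integrable_bounded[where k=k];
        use assms in \<open>force intro!: borel_measurable_max simp: max_def\<close>)+
  then have "(\<integral>x. indicator A x * max 0 (h x) \<partial>P) - (\<integral>x. indicator A x * max 0 (- h x) \<partial>P)
     = (\<integral>x. indicator A x * max 0 (h x) - indicator A x * max 0 (- h x) \<partial>P)"
    by (simp add: set_integrable_def)
  also have "\<dots> = (LINT x:A|P. h x)"
    unfolding set_lebesgue_integral_def
    by (intro Bochner_Integration.integral_cong) (auto simp: indicator_def max_def)
  finally show ?thesis by simp
qed

text \<open>
  Two decompositions \<open>P - N = P' - N'\<close> give the identity \<open>P + N' = P' + N\<close> of positive measures, hence the
  same integrals. So the definite description denotes the value computed from any decomposition.
\<close>

lemma signed_integral_eq:
  fixes \<nu> :: "'a::topological_space set \<Rightarrow> real"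
  assumes D: "signed_decomposition \<nu> P N" and A: "A \<in> sets borel" and h: "h \<in> borel_measurable borel"
    and k: "\<And>x. x \<in> A \<Longrightarrow> \<bar>h x\<bar> \<le> k"
  shows "signed_integral \<nu> A h = (LINT x:A|P. h x) - (LINT x:A|N. h x)"
  unfolding signed_integral_def
proof (rule the_equality)
  show "\<exists>P' N'. signed_decomposition \<nu> P' N' \<and> set_integrable P' A h \<and> set_integrable N' A h \<and>
      (LINT x:A|P. h x) - (LINT x:A|N. h x) = (LINT x:A|P'. h x) - (LINT x:A|N'. h x)"
    using D set_integrable_bounded[OF _ _ A h k] unfolding signed_decomposition_def by blast
next
  fix v assume "\<exists>P' N'. signed_decomposition \<nu> P' N' \<and> set_integrable P' A h \<and> set_integrable N' A h \<and>
      v = (LINT x:A|P'. h x) - (LINT x:A|N'. h x)"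
  then obtain P' N' where D': "signed_decomposition \<nu> P' N'"
    and v: "v = (LINT x:A|P'. h x) - (LINT x:A|N'. h x)" by blast
  have fin: "finite_measure P" "finite_measure N" "finite_measure P'" "finite_measure N'"
    and sets: "sets P = sets borel" "sets N = sets borel" "sets P' = sets borel" "sets N' = sets borel"
    using D D' unfolding signed_decomposition_def by auto
  have eq: "measure P B + measure N' B = measure P' B + measure N B" if "B \<in> sets borel" for B
    using D D' that unfolding signed_decomposition_def by auto
  have "(\<integral>x. u x \<partial>P) + (\<integral>x. u x \<partial>N') = (\<integral>x. u x \<partial>P') + (\<integral>x. u x \<partial>N)"
    if u: "u \<in> borel_measurable borel" "\<And>x. 0 \<le> u x" "\<And>x. u x \<le> \<bar>k\<bar>" for u :: "'a \<Rightarrow> real"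
    using integral_mono_combination[of "[(1, P), (1, N')]" "[(1, P'), (1, N)]" borel u "\<bar>k\<bar>"]
      integral_mono_combination[of "[(1, P'), (1, N)]" "[(1, P), (1, N')]" borel u "\<bar>k\<bar>"] u fin sets eq
    by force
  note u = this
  have "(\<integral>x. indicator A x * max 0 (h x) \<partial>P) + (\<integral>x. indicator A x * max 0 (h x) \<partial>N')
      = (\<integral>x. indicator A x * max 0 (h x) \<partial>P') + (\<integral>x. indicator A x * max 0 (h x) \<partial>N)"
    by (rule u) (use A h k in \<open>auto simp: indicator_def intro: order_trans[OF _ abs_ge_self] dest: abs_le_D1\<close>)
  moreover have "(\<integral>x. indicator A x * max 0 (- h x) \<partial>P) + (\<integral>x. indicator A x * max 0 (- h x) \<partial>N')
      = (\<integral>x. indicator A x * max 0 (- h x) \<partial>P') + (\<integral>x. indicator A x * max 0 (- h x) \<partial>N)"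
    by (rule u) (use A h k in \<open>auto simp: indicator_def intro: order_trans[OF _ abs_ge_self] dest: abs_le_D2\<close>)
  ultimately show "v = (LINT x:A|P. h x) - (LINT x:A|N. h x)"
    unfolding v using set_integral_split_sign[OF _ _ A h k] fin sets by simp
qed

text \<open>
  A signed measure dominated setwise by \<open>c G + d H\<close> has its total variation dominated by it. The bound
  is obtained by comparing \<open>P\<close> with \<open>N + c G + d H\<close>, and \<open>N\<close> with \<open>P + c G + d H\<close>, on the positive and the
  negative part of the integrand.
\<close>

lemma abs_signed_integral_le:
  fixes \<nu> :: "'a::topological_space set \<Rightarrow> real"
  assumes sm: "signed_measure \<nu>" and A: "A \<in> sets borel" and h: "h \<in> borel_measurable borel"
    and k: "\<And>x. x \<in> A \<Longrightarrow> \<bar>h x\<bar> \<le> k"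
    and fin: "finite_measure G" "finite_measure H" "sets G = sets borel" "sets H = sets borel"
    and cd: "0 \<le> c" "0 \<le> d"
    and le: "\<And>B. B \<in> sets borel \<Longrightarrow> \<bar>\<nu> B\<bar> \<le> c * measure G B + d * measure H B"
  shows "\<bar>signed_integral \<nu> A h\<bar> \<le> k * (c * measure G A + d * measure H A)"
proof (cases "A = {}")
  case True
  obtain P N where D: "signed_decomposition \<nu> P N" using sm unfolding signed_measure_def by blast
  show ?thesis
    using signed_integral_eq[OF D A h k] True by (simp add: set_lebesgue_integral_def)
next
  case False
  then have k0: "0 \<le> k" using k abs_ge_zero order_trans by blast
  obtain P N where D: "signed_decomposition \<nu> P N" using sm unfolding signed_measure_def by blast
  have finD: "finite_measure P" "finite_measure N"
    and sets: "sets P = sets borel" "sets N = sets borel"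
    using D unfolding signed_decomposition_def by auto
  have \<nu>: "\<nu> B = measure P B - measure N B" if "B \<in> sets borel" for B
    using D that unfolding signed_decomposition_def by auto
  have le': "measure P B \<le> measure N B + (c * measure G B + d * measure H B)"
    "measure N B \<le> measure P B + (c * measure G B + d * measure H B)" if "B \<in> sets borel" for B
    using le[OF that] \<nu>[OF that] by linarith+
  define up where "up x = indicator A x * max 0 (h x)" for x
  define um where "um x = indicator A x * max 0 (- h x)" for x
  define R where "R u = c * (\<integral>x. u x \<partial>G) + d * (\<integral>x. u x \<partial>H)" for u :: "'a \<Rightarrow> real"
  have up: "up \<in> borel_measurable borel" "\<And>x. 0 \<le> up x" "\<And>x. up x \<le> k"
    and um: "um \<in> borel_measurable borel" "\<And>x. 0 \<le> um x" "\<And>x. um x \<le> k"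
    using A h k k0 by (auto simp: up_def[abs_def] um_def[abs_def] indicator_def abs_le_iff)
  have *: "(\<integral>x. u x \<partial>P) \<le> (\<integral>x. u x \<partial>N) + R u \<and> (\<integral>x. u x \<partial>N) \<le> (\<integral>x. u x \<partial>P) + R u"
    if u: "u \<in> borel_measurable borel" "\<And>x. 0 \<le> u x" "\<And>x. u x \<le> k" for u :: "'a \<Rightarrow> real"
  proof -
    have "(\<Sum>(a, M)\<leftarrow>[(1, P)]. a * (\<integral>x. u x \<partial>M)) \<le> (\<Sum>(a, M)\<leftarrow>[(1, N), (c, G), (d, H)]. a * (\<integral>x. u x \<partial>M))"
      by (rule integral_mono_combination[where S=borel and k=k]) (use u fin cd finD sets le'(1) in auto)
    moreover have "(\<Sum>(a, M)\<leftarrow>[(1, N)]. a * (\<integral>x. u x \<partial>M)) \<le> (\<Sum>(a, M)\<leftarrow>[(1, P), (c, G), (d, H)]. a * (\<integral>x. u x \<partial>M))"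
      by (rule integral_mono_combination[where S=borel and k=k]) (use u fin cd finD sets le'(2) in auto)
    ultimately show ?thesis unfolding R_def by simp
  qed
  have int: "integrable M u" if "finite_measure M" "sets M = sets borel"
    "u \<in> borel_measurable borel" "\<And>x. 0 \<le> u x" "\<And>x. u x \<le> k" for M and u :: "'a \<Rightarrow> real"
    using finite_measure.integrable_const_bound[OF that(1), of u k] that by (simp cong: measurable_cong_sets)
  have pm: "(\<integral>x. up x \<partial>M) + (\<integral>x. um x \<partial>M) \<le> k * measure M A" if M: "finite_measure M" "sets M = sets borel" for M
  proof -
    have "(\<integral>x. up x \<partial>M) + (\<integral>x. um x \<partial>M) = (\<integral>x. up x + um x \<partial>M)"
      using int[OF M up] int[OF M um] by simp
    also have "\<dots> \<le> (\<integral>x. k * indicator A x \<partial>M)"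
    proof (rule integral_mono)
      show "integrable M (\<lambda>x. up x + um x)" using int[OF M up] int[OF M um] by simp
      show "integrable M (\<lambda>x. k * indicator A x)"
        using A M k0 by (intro int) (auto simp: indicator_def)
      show "up x + um x \<le> k * indicator A x" for x
        using k[of x] by (auto simp: up_def um_def indicator_def max_def)
    qed
    also have "\<dots> = k * measure M A" using A M by simp
    finally show ?thesis .
  qed
  have "\<bar>signed_integral \<nu> A h\<bar> = \<bar>((\<integral>x. up x \<partial>P) - (\<integral>x. um x \<partial>P)) - ((\<integral>x. up x \<partial>N) - (\<integral>x. um x \<partial>N))\<bar>"
    using signed_integral_eq[OF D A h k] set_integral_split_sign[OF _ _ A h k] finD sets
    by (simp add: up_def um_def)
  also have "\<dots> \<le> R up + R um" using *[OF up] *[OF um] by linarith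
  also have "\<dots> = c * ((\<integral>x. up x \<partial>G) + (\<integral>x. um x \<partial>G)) + d * ((\<integral>x. up x \<partial>H) + (\<integral>x. um x \<partial>H))"
    by (simp add: R_def algebra_simps)
  also have "\<dots> \<le> c * (k * measure G A) + d * (k * measure H A)"
    using pm[OF fin(1,3)] pm[OF fin(2,4)] cd by (intro add_mono mult_left_mono) auto
  finally show ?thesis by (simp add: algebra_simps)
qed

section \<open>Continuous functions with compact support\<close>

context metric_measure_space
begin

lemma sets_m [measurable_cong, simp]: "sets m = sets borel"
  using radon unfolding radon_measure_def by blast

lemma space_m [simp]: "space m = UNIV"
  using sets_eq_imp_space_eq[OF sets_m] by simp

lemma borel_measurable_m: "borel_measurable m = borel_measurable borel"
  by (rule measurable_cong_sets) auto

lemma emeasure_compact_finite: "compact K \<Longrightarrow> emeasure m K < \<infinity>"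
  using radon unfolding radon_measure_def by blast

lemma emeasure_bounded_finite: "bounded A \<Longrightarrow> emeasure m A < \<infinity>"
proof (cases "A = {}")
  case False
  assume "bounded A"
  then obtain x r where "A \<subseteq> ball x r" using bounded_subset_ballD by blast
  then have "A \<subseteq> closure (ball x r)" using closure_subset by blast
  then have "emeasure m A \<le> emeasure m (closure (ball x r))"
    by (intro emeasure_mono) auto
  then show ?thesis using emeasure_compact_finite[OF relatively_compact_balls] le_less_trans by blast
qed simp

lemma emeasure_bounded_eq: "bounded A \<Longrightarrow> emeasure m A = ennreal (measure m A)"
  using emeasure_bounded_finite by (intro emeasure_eq_ennreal_measure) (auto simp: less_top[symmetric])

lemma open_emeasure_pos: "open U \<Longrightarrow> U \<noteq> {} \<Longrightarrow> 0 < emeasure m U"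
  using full_support unfolding measure_support_def by blast

lemma measure_ball_pos: "0 < r \<Longrightarrow> 0 < measure m (ball x r)"
  using open_emeasure_pos[of "ball x r"] emeasure_bounded_eq[OF bounded_ball, of x r]
  by (auto simp: zero_less_measure_iff)

abbreviation vol :: "'a \<Rightarrow> real \<Rightarrow> real" where
  "vol x r \<equiv> measure m (ball x r)"

lemma measure_mono_bounded:
  "A \<subseteq> B \<Longrightarrow> A \<in> sets borel \<Longrightarrow> B \<in> sets borel \<Longrightarrow> bounded B \<Longrightarrow> measure m A \<le> measure m B"
  using emeasure_bounded_finite[of B] by (intro measure_mono_fmeasurable) (auto simp: fmeasurable_def)

lemma closed_bounded_compact:
  assumes "closed K" "bounded (K :: 'a set)" shows "compact K"
proof (cases "K = {}")
  case False
  then obtain x r where "K \<subseteq> ball x r" using assms bounded_subset_ballD by blast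
  then have "K \<subseteq> closure (ball x r)" using closure_subset by blast
  then have "closure (ball x r) \<inter> K = K" by blast
  then show ?thesis
    using compact_Int_closed[OF relatively_compact_balls[of x r] assms(1)] by simp
qed simp

text \<open>
  Where a continuous function does not vanish, the density gives positive mass to all neighbourhoods,
  because \<open>m\<close> has full support.
\<close>

lemma supp_continuous:
  assumes f: "continuous_on UNIV f"
  shows "supp m f = closure {x. f x \<noteq> 0}"
proof -
  have fm: "f \<in> borel_measurable borel" using f by (rule borel_measurable_continuous_onI)
  have em: "emeasure (density m (\<lambda>x. ennreal \<bar>f x\<bar>)) U = (\<integral>\<^sup>+x. ennreal \<bar>f x\<bar> * indicator U x \<partial>m)" if "open U" for U
    using that fm by (intro emeasure_density) auto
  have "(\<forall>U. open U \<and> x \<in> U \<longrightarrow> 0 < emeasure (density m (\<lambda>x. ennreal \<bar>f x\<bar>)) U) \<longleftrightarrow> x \<in> closure {x. f x \<noteq> 0}" for x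
  proof
    assume *: "\<forall>U. open U \<and> x \<in> U \<longrightarrow> 0 < emeasure (density m (\<lambda>x. ennreal \<bar>f x\<bar>)) U"
    show "x \<in> closure {x. f x \<noteq> 0}"
    proof (rule ccontr)
      assume x: "x \<notin> closure {x. f x \<noteq> 0}"
      define C where "C = closure {x. f x \<noteq> 0}"
      have C: "open (- C)" "x \<in> - C" using x by (auto simp: C_def)
      have "f y = 0" if "y \<notin> C" for y
        using that closure_subset[of "{x. f x \<noteq> 0}"] unfolding C_def by auto
      then have "(\<integral>\<^sup>+x. ennreal \<bar>f x\<bar> * indicator (- C) x \<partial>m) = (\<integral>\<^sup>+x. 0 \<partial>m)"
        by (intro nn_integral_cong) (auto simp: indicator_def)
      then show False using *[rule_format, of "- C"] C em[of "- C"] by simp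
    qed
  next
    assume x: "x \<in> closure {x. f x \<noteq> 0}"
    show "\<forall>U. open U \<and> x \<in> U \<longrightarrow> 0 < emeasure (density m (\<lambda>x. ennreal \<bar>f x\<bar>)) U"
    proof safe
      fix U assume U: "open U" "x \<in> U"
      define W where "W = U \<inter> {x. f x \<noteq> 0}"
      have "open {x. f x \<noteq> 0}" using f by (intro open_Collect_neq) auto
      then have W: "open W" "W \<noteq> {}"
        using U x open_Int_closure_eq_empty[of U "{x. f x \<noteq> 0}"] unfolding W_def by blast+
      show "0 < emeasure (density m (\<lambda>x. ennreal \<bar>f x\<bar>)) U"
      proof (rule ccontr)
        assume "\<not> ?thesis"
        then have "(\<integral>\<^sup>+x. ennreal \<bar>f x\<bar> * indicator U x \<partial>m) = 0" using em[OF U(1)] by simp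
        then have "AE x in m. ennreal \<bar>f x\<bar> * indicator U x = 0"
          using fm U(1) by (subst (asm) nn_integral_0_iff_AE) (simp_all add: borel_measurable_m)
        then have "AE x in m. x \<notin> W" by eventually_elim (auto simp: W_def indicator_def)
        then have "emeasure m W = 0"
          using W by (subst (asm) AE_iff_measurable[OF _ refl]) auto
        then show False using open_emeasure_pos[OF W] by simp
      qed
    qed
  qed
  then show ?thesis unfolding supp_def measure_support_def by blast
qed

lemma Cc_iff: "f \<in> Cc m \<longleftrightarrow> continuous_on UNIV f \<and> (\<exists>K. compact K \<and> (\<forall>x. x \<notin> K \<longrightarrow> f x = 0))"
proof
  assume f: "f \<in> Cc m"
  then have "\<forall>x. x \<notin> supp m f \<longrightarrow> f x = 0"
    using supp_continuous closure_subset[of "{x. f x \<noteq> 0}"] unfolding Cc_def by auto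
  then show "continuous_on UNIV f \<and> (\<exists>K. compact K \<and> (\<forall>x. x \<notin> K \<longrightarrow> f x = 0))"
    using f unfolding Cc_def by blast
next
  assume "continuous_on UNIV f \<and> (\<exists>K. compact K \<and> (\<forall>x. x \<notin> K \<longrightarrow> f x = 0))"
  then obtain K where f: "continuous_on UNIV f" and K: "compact K" "\<forall>x. x \<notin> K \<longrightarrow> f x = 0" by blast
  then have "closure {x. f x \<noteq> 0} \<subseteq> K" by (intro closure_minimal compact_imp_closed) auto
  then have "closure {x. f x \<noteq> 0} = K \<inter> closure {x. f x \<noteq> 0}" by blast
  then show "f \<in> Cc m"
    unfolding Cc_def using supp_continuous[OF f] compact_Int_closed[OF K(1), of "closure {x. f x \<noteq> 0}"] f by simp
qed

lemma CcI: "continuous_on UNIV f \<Longrightarrow> compact K \<Longrightarrow> (\<And>x. x \<notin> K \<Longrightarrow> f x = 0) \<Longrightarrow> f \<in> Cc m"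
  unfolding Cc_iff by blast

lemma CcE:
  assumes "f \<in> Cc m"
  obtains K where "continuous_on UNIV f" "compact K" "\<And>x. x \<notin> K \<Longrightarrow> f x = 0"
  using assms unfolding Cc_iff by blast

lemma closed_measure_support: "closed (measure_support (\<mu> :: 'a measure))"
proof -
  have "- measure_support \<mu> = \<Union>{U. open U \<and> \<not> 0 < emeasure \<mu> U}"
    unfolding measure_support_def by blast
  then have "open (- measure_support \<mu>)" by (auto intro!: open_Union)
  then show ?thesis by (simp add: closed_def)
qed

lemma AE_zero_outside_supp:
  assumes f: "f \<in> borel_measurable borel"
  shows "AE x in m. x \<notin> supp m f \<longrightarrow> f x = 0"
proof -
  define \<mu> where "\<mu> = density m (\<lambda>x. ennreal \<bar>f x\<bar>)"
  define \<U> where "\<U> = {U. open U \<and> \<not> 0 < emeasure \<mu> U}"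
  have co: "- supp m f = \<Union>\<U>"
    unfolding supp_def measure_support_def \<mu>_def \<U>_def by blast
  obtain \<U>' where \<U>': "\<U>' \<subseteq> \<U>" "countable \<U>'" "\<Union>\<U>' = \<Union>\<U>"
    by (rule Lindelof[of \<U>]) (auto simp: \<U>_def)
  have "U \<in> null_sets \<mu>" if "U \<in> \<U>'" for U
    using that \<U>'(1) unfolding \<U>_def \<mu>_def by (auto simp: null_sets_def)
  then have "(\<Union>U\<in>\<U>'. U) \<in> null_sets \<mu>" using \<U>'(2) by (intro null_sets_UN') auto
  then have "- supp m f \<in> null_sets \<mu>" using co \<U>'(3) by simp
  then have "AE x in m. x \<in> - supp m f \<longrightarrow> ennreal \<bar>f x\<bar> = 0"
    unfolding \<mu>_def using f by (subst (asm) null_sets_density_iff) auto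
  then show ?thesis by eventually_elim auto
qed

lemma Linf_norm_le:
  assumes f: "f \<in> borel_measurable borel" and c: "0 \<le> c" "\<And>x. \<bar>f x\<bar> \<le> c"
  shows "f \<in> Linf_space m \<and> Linf_norm m f \<le> c"
proof -
  have "esssup m (\<lambda>x. ereal \<bar>f x\<bar>) \<le> ereal c"
    using f c by (intro esssup_I) auto
  moreover from this have "real_of_ereal (esssup m (\<lambda>x. ereal \<bar>f x\<bar>)) \<le> c"
    using c(1) by (cases "esssup m (\<lambda>x. ereal \<bar>f x\<bar>)") auto
  moreover have "esssup m (\<lambda>x. ereal \<bar>f x\<bar>) < \<infinity>"
    using calculation(1) by (auto intro: le_less_trans)
  ultimately show ?thesis using f unfolding Linf_space_def Linf_norm_def by auto
qed

lemma Cc_measurable: "f \<in> Cc m \<Longrightarrow> f \<in> borel_measurable borel"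
  unfolding Cc_def by (auto intro: borel_measurable_continuous_onI)

lemma Cc_bounded:
  assumes "f \<in> Cc m"
  obtains c where "0 \<le> c" "\<And>x. \<bar>f x\<bar> \<le> c"
proof -
  obtain K where f: "continuous_on UNIV f" and K: "compact K" "\<forall>x. x \<notin> K \<longrightarrow> f x = 0"
    using assms Cc_iff by blast
  have "bounded (f ` K)"
    using f K(1) by (intro compact_imp_bounded compact_continuous_image) (auto intro: continuous_on_subset)
  then obtain c where c: "\<And>x. x \<in> K \<Longrightarrow> \<bar>f x\<bar> \<le> c" unfolding bounded_iff by auto
  have "\<bar>f x\<bar> \<le> max 0 c" for x using c[of x] K(2) by (cases "x \<in> K") auto
  then show ?thesis using that[of "max 0 c"] by auto
qed

end

section \<open>The core of continuous functions in the domain\<close>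

context p_energy
begin

abbreviation core :: "('a \<Rightarrow> real) set" where
  "core \<equiv> F \<inter> Cc m"

lemma p_pos: "0 < p" using p_gt_1 by simp

lemma F_measurable: "f \<in> F \<Longrightarrow> f \<in> borel_measurable borel"
  using F_subset_Lp unfolding Lp_space_def borel_measurable_m by blast

lemma F_integrable: "f \<in> F \<Longrightarrow> integrable m (\<lambda>x. \<bar>f x\<bar> powr p)"
  using F_subset_Lp unfolding Lp_space_def by blast

lemma F_diff: "f \<in> F \<Longrightarrow> g \<in> F \<Longrightarrow> (\<lambda>x. f x - g x) \<in> F"
  using F_add[OF _ F_scale[of g "-1"], of f] by simp

sublocale E: homogeneous_functional p F E
  by unfold_locales (use p_gt_1 E_nonneg E_seminorm F_scale F_add in auto)

lemma E_zero: "E (\<lambda>_. 0) = 0"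
  using E.homogeneous[OF F_zero, of 0] p_pos by simp

lemma core_add:
  assumes "f \<in> core" "g \<in> core"
  shows "(\<lambda>x. f x + g x) \<in> core"
proof -
  obtain K where K: "continuous_on UNIV f" "compact K" "\<And>x. x \<notin> K \<Longrightarrow> f x = 0" using assms CcE by blast
  obtain L where L: "continuous_on UNIV g" "compact L" "\<And>x. x \<notin> L \<Longrightarrow> g x = 0" using assms CcE by blast
  have "(\<lambda>x. f x + g x) \<in> Cc m"
    by (rule CcI[of _ "K \<union> L"]) (use K L in \<open>auto intro!: continuous_intros\<close>)
  then show ?thesis using F_add assms by auto
qed

lemma core_scale:
  assumes "f \<in> core"
  shows "(\<lambda>x. c * f x) \<in> core"
proof -
  obtain K where K: "continuous_on UNIV f" "compact K" "\<And>x. x \<notin> K \<Longrightarrow> f x = 0" using assms CcE by blast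
  have "(\<lambda>x. c * f x) \<in> Cc m"
    by (rule CcI[of _ K]) (use K in \<open>auto intro!: continuous_intros\<close>)
  then show ?thesis using F_scale assms by auto
qed

lemma core_zero: "(\<lambda>_. 0) \<in> core"
  using F_zero CcI[of "\<lambda>_. 0" "{}"] by simp

lemma core_sum:
  "finite I \<Longrightarrow> (\<And>i. i \<in> I \<Longrightarrow> h i \<in> core) \<Longrightarrow> (\<lambda>x. \<Sum>i\<in>I. h i x) \<in> core"
proof (induction rule: finite_induct)
  case empty then show ?case using core_zero by simp
next
  case (insert i I)
  then show ?case using core_add[of "h i" "\<lambda>x. \<Sum>i\<in>I. h i x"] by auto
qed

lemma core_compose:
  assumes "f \<in> core" "\<phi> 0 = 0" "\<And>s t :: real. \<bar>\<phi> t - \<phi> s\<bar> \<le> \<bar>t - s\<bar>"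
  shows "(\<lambda>x. \<phi> (f x)) \<in> core" "E (\<lambda>x. \<phi> (f x)) \<le> E f"
proof -
  have \<phi>: "continuous_on UNIV \<phi>"
    unfolding continuous_on_iff dist_real_def using assms(3) by (meson UNIV_I le_less_trans)
  have "(\<lambda>x. \<phi> (f x)) \<in> F \<and> E (\<lambda>x. \<phi> (f x)) \<le> E f"
    using markovian[of f \<phi>] assms \<phi> by auto
  moreover obtain K where K: "continuous_on UNIV f" "compact K" "\<And>x. x \<notin> K \<Longrightarrow> f x = 0" using assms CcE by blast
  have "(\<lambda>x. \<phi> (f x)) \<in> Cc m"
    by (rule CcI[of _ K]) (use K assms(2) in \<open>auto intro: continuous_on_compose2[OF \<phi>]\<close>)
  ultimately show "(\<lambda>x. \<phi> (f x)) \<in> core" "E (\<lambda>x. \<phi> (f x)) \<le> E f" by auto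
qed

lemma core_mult:
  assumes f: "f \<in> core" and g: "g \<in> core"
  shows "(\<lambda>x. f x * g x) \<in> core"
    and "\<lbrakk>\<And>x. \<bar>f x\<bar> \<le> 1; \<And>x. \<bar>g x\<bar> \<le> 1\<rbrakk>
      \<Longrightarrow> E (\<lambda>x. f x * g x) powr (1 / p) \<le> E f powr (1 / p) + E g powr (1 / p)"
proof -
  have mf: "f \<in> borel_measurable borel" and mg: "g \<in> borel_measurable borel"
    using f g Cc_measurable by auto
  obtain c d where c: "0 \<le> c" "\<And>x. \<bar>f x\<bar> \<le> c" and d: "0 \<le> d" "\<And>x. \<bar>g x\<bar> \<le> d"
    using f g Cc_bounded by (metis IntE)
  have Li: "f \<in> F \<inter> Linf_space m" "g \<in> F \<inter> Linf_space m"
    using Linf_norm_le[OF mf c] Linf_norm_le[OF mg d] f g by auto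
  obtain K where K: "continuous_on UNIV f" "compact K" "\<And>x. x \<notin> K \<Longrightarrow> f x = 0" using f CcE by blast
  have "continuous_on UNIV g" using g by (auto elim: CcE)
  then have "(\<lambda>x. f x * g x) \<in> Cc m"
    by (intro CcI[of _ K]) (use K in \<open>auto intro!: continuous_intros\<close>)
  then show "(\<lambda>x. f x * g x) \<in> core" using algebra[OF Li] by auto
  assume 1: "\<And>x. \<bar>f x\<bar> \<le> 1" "\<And>x. \<bar>g x\<bar> \<le> 1"
  have "E (\<lambda>x. f x * g x) powr (1 / p) \<le> Linf_norm m f * E g powr (1 / p) + Linf_norm m g * E f powr (1 / p)"
    using algebra[OF Li] by simp
  also have "\<dots> \<le> 1 * E g powr (1 / p) + 1 * E f powr (1 / p)"
    using Linf_norm_le[OF mf _ 1(1)] Linf_norm_le[OF mg _ 1(2)] by (intro add_mono mult_right_mono) auto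
  finally show "E (\<lambda>x. f x * g x) powr (1 / p) \<le> E f powr (1 / p) + E g powr (1 / p)" by simp
qed

text \<open>
  Regularity provides some element of the core within distance \<open>1\<close> of a continuous function that is \<open>3\<close> on
  \<open>K\<close> and \<open>0\<close> off \<open>V\<close>. It exceeds \<open>2\<close> on \<open>K\<close> and is below \<open>1\<close> off \<open>V\<close>, so cutting it at the levels \<open>1\<close> and \<open>2\<close>
  produces exact values.
\<close>

lemma bump_function:
  assumes K: "compact K" and V: "open V" "K \<subseteq> V" "bounded V"
  shows "\<exists>\<zeta>\<in>core. (\<forall>x. 0 \<le> \<zeta> x \<and> \<zeta> x \<le> 1) \<and> (\<forall>x\<in>K. \<zeta> x = 1) \<and> (\<forall>x. x \<notin> V \<longrightarrow> \<zeta> x = 0)"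
proof (cases "K = {}")
  case True then show ?thesis using core_zero by (intro bexI[of _ "\<lambda>_. 0"]) auto
next
  case False
  obtain e where e: "0 < e" "(\<Union>x\<in>K. ball x e) \<subseteq> V"
    using compact_subset_open_imp_ball_epsilon_subset[OF K V(1,2)] by blast
  define \<kappa> where "\<kappa> x = max 0 (3 - 3 / e * infdist x K)" for x
  have \<kappa>0: "\<kappa> x = 0" if "x \<notin> V" for x
  proof -
    have "e \<le> dist x y" if "y \<in> K" for y
    proof (rule ccontr)
      assume "\<not> e \<le> dist x y"
      then have "x \<in> ball y e" by (simp add: dist_commute)
      then show False using that e(2) \<open>x \<notin> V\<close> by blast
    qed
    then have "e \<le> infdist x K" using False by (auto simp: infdist_notempty intro: cINF_greatest)
    then have "3 \<le> 3 / e * infdist x K" using e(1) by (simp add: field_simps)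
    then show ?thesis by (simp add: \<kappa>_def)
  qed
  have "compact (closure V)" using V by (intro closed_bounded_compact) auto
  moreover have "\<forall>x. x \<notin> closure V \<longrightarrow> \<kappa> x = 0" using \<kappa>0 closure_subset[of V] by auto
  ultimately have "\<kappa> \<in> Cc m"
    using e(1) by (intro CcI[of _ "closure V"]) (auto simp: \<kappa>_def[abs_def] intro!: continuous_intros)
  then obtain g where g: "g \<in> core" "\<forall>x. \<bar>\<kappa> x - g x\<bar> < 1"
    using regular_Cc[of \<kappa> 1] by auto
  define \<zeta> where "\<zeta> x = max 0 (min 1 (g x - 1))" for x
  have "\<zeta> \<in> core"
    unfolding \<zeta>_def using g(1) by (intro core_compose(1)[where \<phi>="\<lambda>t. max 0 (min 1 (t - 1))"]) (auto simp: max_def min_def)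
  moreover have "\<zeta> x = 1" if "x \<in> K" for x
  proof -
    have "\<kappa> x = 3" using that by (simp add: \<kappa>_def)
    then show ?thesis using g(2)[rule_format, of x] by (auto simp: \<zeta>_def max_def min_def abs_if split: if_splits)
  qed
  moreover have "\<zeta> x = 0" if "x \<notin> V" for x
    using g(2)[rule_format, of x] \<kappa>0[OF that] by (auto simp: \<zeta>_def max_def min_def)
  ultimately show ?thesis by (intro bexI[of _ \<zeta>]) (auto simp: \<zeta>_def)
qed

end

section \<open>Strong approximation by convex sets\<close>

context p_energy
begin

definition Lp_energy :: "('a \<Rightarrow> real) \<Rightarrow> real" where
  "Lp_energy f = (LINT x|m. \<bar>f x\<bar> powr p)"

lemma Lp_energy_nonneg: "0 \<le> Lp_energy f"
  unfolding Lp_energy_def by simp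

lemma energy_norm_eq: "energy_norm p m E f = E f powr (1 / p) + Lp_energy f powr (1 / p)"
  unfolding energy_norm_def Lp_norm_def Lp_energy_def ..

lemma energy_norm_less_imp:
  assumes f: "f \<in> F" and e: "energy_norm p m E f < e"
  shows "E f < e powr p" "Lp_energy f < e powr p"
proof -
  have *: "t < e powr p" if "0 \<le> t" "t powr (1 / p) < e" for t
  proof -
    have "t = (t powr (1 / p)) powr p" using that p_pos by (simp add: powr_powr)
    also have "\<dots> < e powr p" using that p_pos by (intro powr_less_mono2) auto
    finally show ?thesis .
  qed
  have "0 \<le> E f powr (1 / p)" "0 \<le> Lp_energy f powr (1 / p)" by auto
  with e have "E f powr (1 / p) < e" "Lp_energy f powr (1 / p) < e"
    unfolding energy_norm_eq by linarith+
  then show "E f < e powr p" "Lp_energy f < e powr p"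
    using E_nonneg[OF f] Lp_energy_nonneg[of f] by (auto intro!: *)
qed

lemma energy_norm_lessI:
  assumes "f \<in> F" "0 < e" "E f < (e / 2) powr p" "Lp_energy f < (e / 2) powr p"
  shows "energy_norm p m E f < e"
proof -
  have *: "t powr (1 / p) < e / 2" if "0 \<le> t" "t < (e / 2) powr p" for t
  proof -
    have "t powr (1 / p) < ((e / 2) powr p) powr (1 / p)" using that p_pos by (intro powr_less_mono2) auto
    also have "\<dots> = e / 2" using p_pos assms(2) by (simp add: powr_powr)
    finally show ?thesis .
  qed
  show ?thesis
    unfolding energy_norm_eq
    using *[OF E_nonneg[OF assms(1)] assms(3)] *[OF Lp_energy_nonneg assms(4)] by linarith
qed

lemma Lp_energy_convex:
  assumes "f \<in> F" "g \<in> F" "0 \<le> s" "s \<le> 1"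
  shows "Lp_energy (\<lambda>x. (1 - s) * f x + s * g x) \<le> (1 - s) * Lp_energy f + s * Lp_energy g"
proof -
  have "Lp_energy (\<lambda>x. (1 - s) * f x + s * g x) \<le> (LINT x|m. (1 - s) * \<bar>f x\<bar> powr p + s * \<bar>g x\<bar> powr p)"
    unfolding Lp_energy_def
  proof (rule integral_mono)
    show "integrable m (\<lambda>x. \<bar>(1 - s) * f x + s * g x\<bar> powr p)"
      using assms by (intro F_integrable F_add F_scale)
    show "integrable m (\<lambda>x. (1 - s) * \<bar>f x\<bar> powr p + s * \<bar>g x\<bar> powr p)"
      using assms F_integrable by auto
    fix x
    have "\<bar>(1 - s) * f x + s * g x\<bar> powr p \<le> ((1 - s) * \<bar>f x\<bar> + s * \<bar>g x\<bar>) powr p"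
      using assms p_pos abs_triangle_ineq[of "(1 - s) * f x" "s * g x"]
      by (intro powr_mono2) (auto simp: abs_mult)
    also have "\<dots> \<le> (1 - s) * \<bar>f x\<bar> powr p + s * \<bar>g x\<bar> powr p"
      using assms p_gt_1 by (intro powr_convex_combination_le) auto
    finally show "\<bar>(1 - s) * f x + s * g x\<bar> powr p \<le> (1 - s) * \<bar>f x\<bar> powr p + s * \<bar>g x\<bar> powr p" .
  qed
  also have "\<dots> = (1 - s) * Lp_energy f + s * Lp_energy g"
    unfolding Lp_energy_def using assms F_integrable by simp
  finally show ?thesis .
qed

lemma Lp_energy_scale: "Lp_energy (\<lambda>x. c * f x) = \<bar>c\<bar> powr p * Lp_energy f"
  unfolding Lp_energy_def by (simp add: abs_mult powr_mult)

lemma Lp_energy_triangle: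
  assumes "f \<in> F" "g \<in> F"
  shows "Lp_energy (\<lambda>x. f x + g x) \<le> 2 powr p * (Lp_energy f + Lp_energy g)"
proof -
  have "Lp_energy (\<lambda>x. f x + g x) = Lp_energy (\<lambda>x. 2 * ((1 - 1/2) * f x + 1/2 * g x))"
    by (simp add: algebra_simps)
  also have "\<dots> \<le> 2 powr p * ((1 - 1/2) * Lp_energy f + 1/2 * Lp_energy g)"
    unfolding Lp_energy_scale using Lp_energy_convex[OF assms, of "1/2"] by simp
  also have "\<dots> \<le> 2 powr p * (Lp_energy f + Lp_energy g)"
    using Lp_energy_nonneg[of f] Lp_energy_nonneg[of g] by (intro mult_left_mono) auto
  finally show ?thesis .
qed

text \<open>
  If two functions have energy at most \<open>b\<close> and their midpoint has energy at least \<open>a\<close>, the Clarkson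
  inequality bounds the energy of half of their difference by this quantity, which is small when \<open>a\<close> and \<open>b\<close>
  are close.
\<close>

definition clarkson_modulus :: "real \<Rightarrow> real \<Rightarrow> real" where
  "clarkson_modulus a b =
     (if p \<le> 2 then (b powr (1 / (p - 1)) - a powr (1 / (p - 1))) powr (p - 1) else b - a)"

lemma clarkson_modulus_bound:
  assumes f: "f \<in> F" and g: "g \<in> F" and b: "E f \<le> b" "E g \<le> b"
    and a: "0 \<le> a" "a \<le> E (\<lambda>x. 1/2 * f x + 1/2 * g x)"
  shows "E (\<lambda>x. f x - g x) \<le> 2 powr p * clarkson_modulus a b"
proof -
  define u where "u = (\<lambda>x. 1/2 * f x + 1/2 * g x)"
  define v where "v = (\<lambda>x. 1/2 * f x + (-1/2) * g x)"
  have uF: "u \<in> F" and vF: "v \<in> F" unfolding u_def v_def using f g F_add F_scale by blast+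
  have uv: "(\<lambda>x. u x + v x) = f" "(\<lambda>x. u x - v x) = g" by (auto simp: u_def v_def)
  have "E (\<lambda>x. f x - g x) = E (\<lambda>x. 2 * v x)" by (simp add: v_def algebra_simps)
  also have "\<dots> = 2 powr p * E v" using E.homogeneous[OF vF, of 2] by simp
  finally have 2: "E (\<lambda>x. f x - g x) = 2 powr p * E v" .
  have "E v \<le> clarkson_modulus a b"
  proof (cases "p \<le> 2")
    case True
    define r where "r = 1 / (p - 1)"
    have r: "0 < r" "1 / r = p - 1" "(p - 1) * r = 1" "r * (p - 1) = 1" using p_gt_1 by (auto simp: r_def)
    have "2 * (E u powr (1 / (p - 1)) + E v powr (1 / (p - 1))) powr (p - 1)
        \<le> E (\<lambda>x. u x + v x) + E (\<lambda>x. u x - v x)"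
      using E_clarkson uF vF True unfolding p_clarkson_def by blast
    then have "2 * (E u powr r + E v powr r) powr (p - 1) \<le> E f + E g"
      unfolding uv r_def .
    then have "(E u powr r + E v powr r) powr (1 / r) \<le> b" using b r by simp
    then have "((E u powr r + E v powr r) powr (1 / r)) powr r \<le> b powr r"
      using r by (intro powr_mono2) auto
    then have "E u powr r + E v powr r \<le> b powr r" using r by (simp add: powr_powr)
    moreover have "a powr r \<le> E u powr r" using a r unfolding u_def by (intro powr_mono2) auto
    ultimately have "E v powr r \<le> b powr r - a powr r" by simp
    then have "(E v powr r) powr (1 / r) \<le> (b powr r - a powr r) powr (1 / r)"
      using r p_gt_1 by (intro powr_mono2) auto
    then show ?thesis
      using r True E_nonneg[OF vF] p_gt_1 by (simp add: powr_powr clarkson_modulus_def r_def)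
  next
    case False
    define r where "r = 1 / (p - 1)"
    have r: "0 < r" "1 / r = p - 1" using p_gt_1 by (auto simp: r_def)
    define f' where "f' = (\<lambda>x. 1/2 * f x)"
    define g' where "g' = (\<lambda>x. 1/2 * g x)"
    have F': "f' \<in> F" "g' \<in> F" unfolding f'_def g'_def using f g F_scale by blast+
    have fg': "(\<lambda>x. f' x + g' x) = u" "(\<lambda>x. f' x - g' x) = v" by (auto simp: f'_def g'_def u_def v_def)
    have half: "E f' \<le> (1/2) powr p * b" "E g' \<le> (1/2) powr p * b"
      using E.homogeneous[OF f, of "1/2"] E.homogeneous[OF g, of "1/2"] b
      by (auto simp: f'_def g'_def mult_left_mono)
    have b0: "0 \<le> b" using E_nonneg[OF f] b by simp
    have "2 \<le> p" using False by simp
    then have "E (\<lambda>x. f' x + g' x) + E (\<lambda>x. f' x - g' x)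
        \<le> 2 * (E f' powr (1 / (p - 1)) + E g' powr (1 / (p - 1))) powr (p - 1)"
      using E_clarkson F' unfolding p_clarkson_def by blast
    then have "E u + E v \<le> 2 * (E f' powr r + E g' powr r) powr (p - 1)"
      unfolding fg' r_def .
    also have "\<dots> \<le> 2 * (2 * ((1/2) powr p * b) powr r) powr (p - 1)"
    proof -
      have "E f' powr r + E g' powr r \<le> 2 * ((1/2) powr p * b) powr r"
        using powr_mono2[OF _ E_nonneg[OF F'(1)] half(1), of r] powr_mono2[OF _ E_nonneg[OF F'(2)] half(2), of r] r
        by simp
      then show ?thesis using p_gt_1 by (intro mult_left_mono powr_mono2) auto
    qed
    also have "\<dots> = 2 * (2 powr (p - 1) * ((1/2) powr p * b))"
    proof -
      have "(((1/2) powr p * b) powr r) powr (p - 1) = (1/2) powr p * b"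
        using r(2)[symmetric] r(1) b0 by (simp only: powr_powr) simp
      then show ?thesis by (simp only: powr_mult)
    qed
    also have "\<dots> = b"
    proof -
      have "2 * 2 powr (p - 1) * (1/2) powr p = (1 :: real)"
        by (simp add: powr_diff powr_divide)
      then have "2 * 2 powr (p - 1) * (1/2) powr p * b = 1 * b" by (simp only:)
      then show ?thesis by (simp only: mult.assoc mult_1)
    qed
    finally have "E u + E v \<le> b" .
    then show ?thesis using a False by (simp add: clarkson_modulus_def u_def)
  qed
  then show ?thesis unfolding 2 by (intro mult_left_mono) auto
qed

lemma clarkson_modulus_tendsto_zero:
  assumes "a \<longlonglongrightarrow> L" "b \<longlonglongrightarrow> L" "\<And>n. 0 \<le> a n" "\<And>n. a n \<le> b n"
  shows "(\<lambda>n. clarkson_modulus (a n) (b n)) \<longlonglongrightarrow> 0"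
proof (cases "p \<le> 2")
  case True
  define r where "r = 1 / (p - 1)"
  have r: "0 < r" using p_gt_1 by (auto simp: r_def)
  have "(\<lambda>n. b n powr r - a n powr r) \<longlonglongrightarrow> L powr r - L powr r"
    using assms r by (intro tendsto_diff tendsto_powr2 tendsto_const always_eventually) (auto intro: order_trans)
  then have "(\<lambda>n. (b n powr r - a n powr r) powr (p - 1)) \<longlonglongrightarrow> 0 powr (p - 1)"
    using assms r p_gt_1 by (intro tendsto_powr2 tendsto_const always_eventually) (auto intro!: powr_mono2)
  then show ?thesis using True by (simp add: clarkson_modulus_def r_def)
next
  case False
  then show ?thesis using tendsto_diff[OF assms(2,1)] by (simp add: clarkson_modulus_def)
qed

text \<open>
  Mazur's lemma, in a form that passes from \<open>L\<^sup>p\<close> approximations of bounded energy to approximations in the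
  energy norm. Elements of almost minimal energy among those members of \<open>S\<close> that are close to \<open>h\<close> in \<open>L\<^sup>p\<close> form a Cauchy sequence by the
  Clarkson inequality, and its limit can only be \<open>h\<close>.
\<close>

lemma strong_approximation:
  assumes S: "S \<subseteq> F" and mid: "\<And>f g. f \<in> S \<Longrightarrow> g \<in> S \<Longrightarrow> (\<lambda>x. 1/2 * f x + 1/2 * g x) \<in> S"
    and h: "h \<in> F"
    and approx: "\<And>\<epsilon>. 0 < \<epsilon> \<Longrightarrow> \<exists>g\<in>S. E g \<le> M \<and> Lp_energy (\<lambda>x. g x - h x) < \<epsilon>"
    and "0 < \<epsilon>"
  shows "\<exists>g\<in>S. energy_norm p m E (\<lambda>x. g x - h x) < \<epsilon>"
proof -
  (* Minimal energies d n over the members of S that are close to h in the p-th mean increase to a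
     limit L, so almost minimal elements have almost minimal midpoints. *)
  define T where "T n = {g\<in>S. Lp_energy (\<lambda>x. g x - h x) \<le> 1 / real (Suc n)}" for n
  define d where "d n = Inf (E ` T n)" for n
  have TF: "T n \<subseteq> F" for n using S unfolding T_def by blast
  have T_mono: "T k \<subseteq> T n" if "n \<le> k" for n k
  proof -
    have "1 / real (Suc k) \<le> 1 / real (Suc n)" using that by (intro divide_left_mono) auto
    then show ?thesis unfolding T_def by auto
  qed
  have T_mid: "(\<lambda>x. 1/2 * f x + 1/2 * g x) \<in> T n" if "f \<in> T n" "g \<in> T n" for f g n
  proof -
    have "Lp_energy (\<lambda>x. (1 - 1/2) * (f x - h x) + 1/2 * (g x - h x))
        \<le> (1 - 1/2) * Lp_energy (\<lambda>x. f x - h x) + 1/2 * Lp_energy (\<lambda>x. g x - h x)"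
      using that TF[of n] h by (intro Lp_energy_convex F_diff) auto
    also have "\<dots> \<le> 1 / real (Suc n)" using that unfolding T_def by simp
    also have "(\<lambda>x. (1 - 1/2) * (f x - h x) + 1/2 * (g x - h x)) = (\<lambda>x. (1/2 * f x + 1/2 * g x) - h x)"
      by (rule ext) (simp add: field_simps)
    finally show ?thesis using mid that unfolding T_def by simp
  qed
  have bdd: "bdd_below (E ` T n)" for n using E_nonneg TF by (intro bdd_belowI[of _ 0]) auto
  have ex: "\<exists>g\<in>T n. E g \<le> M" for n
    using approx[of "1 / real (Suc n)"] unfolding T_def by (force intro: less_imp_le)
  have ne: "E ` T n \<noteq> {}" for n using ex by blast
  have d_le: "d n \<le> E g" if "g \<in> T n" for n g
    unfolding d_def using that bdd by (intro cInf_lower) auto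
  have d_nonneg: "0 \<le> d n" for n unfolding d_def using ne E_nonneg TF by (intro cInf_greatest) auto
  have d_M: "d n \<le> M" for n using ex d_le order_trans by blast
  have d_mono: "d n \<le> d k" if "n \<le> k" for n k
    unfolding d_def[of k] using ne T_mono[OF that] d_le by (intro cInf_greatest) auto
  obtain L where L: "d \<longlonglongrightarrow> L" "\<And>n. d n \<le> L"
    using incseq_convergent[of d M] d_mono d_M by (auto simp: incseq_def)
  define b where "b n = L + 1 / real (Suc n)" for n
  have "\<exists>g\<in>T n. E g < d n + 1 / real (Suc n)" for n
    using cInf_lessD[OF ne[of n], of "d n + 1 / real (Suc n)"] unfolding d_def by auto
  then obtain g where g: "\<And>n. g n \<in> T n" "\<And>n. E (g n) < d n + 1 / real (Suc n)" by metis
  have gF: "g n \<in> F" for n using g TF by blast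
  have g_b: "E (g k) \<le> b n" if "n \<le> k" for n k
  proof -
    have "1 / real (Suc k) \<le> 1 / real (Suc n)" using that by (intro divide_left_mono) auto
    then show ?thesis using g(2)[of k] L(2)[of k] unfolding b_def by simp
  qed
  have b_L: "b \<longlonglongrightarrow> L" unfolding b_def
    using tendsto_add[OF tendsto_const LIMSEQ_inverse_real_of_nat, of L] by (simp add: inverse_eq_divide)
  have db: "d n \<le> b n" for n using L(2)[of n] by (simp add: b_def add_increasing2)
  have cauchy_E: "E (\<lambda>x. g i x - g j x) \<le> 2 powr p * clarkson_modulus (d n) (b n)" if "n \<le> i" "n \<le> j" for i j n
    using that T_mono[OF that(1)] T_mono[OF that(2)] g(1)
    by (intro clarkson_modulus_bound gF g_b d_nonneg d_le T_mid) auto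
  have cauchy_L: "Lp_energy (\<lambda>x. g i x - g j x) \<le> 2 powr p * (2 / real (Suc n))" if "n \<le> i" "n \<le> j" for i j n
  proof -
    have gi: "Lp_energy (\<lambda>x. g i x - h x) \<le> 1 / real (Suc n)" "Lp_energy (\<lambda>x. g j x - h x) \<le> 1 / real (Suc n)"
      using T_mono[OF that(1)] T_mono[OF that(2)] g(1) unfolding T_def by auto
    have "Lp_energy (\<lambda>x. g i x - g j x) = Lp_energy (\<lambda>x. (g i x - h x) + (-1) * (g j x - h x))" by simp
    also have "\<dots> \<le> 2 powr p * (Lp_energy (\<lambda>x. g i x - h x) + Lp_energy (\<lambda>x. (-1) * (g j x - h x)))"
      using gF h by (intro Lp_energy_triangle F_scale F_diff)
    also have "\<dots> \<le> 2 powr p * (2 / real (Suc n))"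
      unfolding Lp_energy_scale using gi by (intro mult_left_mono) auto
    finally show ?thesis .
  qed
  have "\<forall>e>0. \<exists>N. \<forall>i\<ge>N. \<forall>j\<ge>N. energy_norm p m E (\<lambda>x. g i x - g j x) < e"
  proof safe
    fix e :: real assume e: "0 < e"
    have "(\<lambda>n. 2 powr p * clarkson_modulus (d n) (b n)) \<longlonglongrightarrow> 2 powr p * 0"
      using L(1) b_L d_nonneg db by (intro tendsto_mult tendsto_const clarkson_modulus_tendsto_zero) auto
    then have "(\<lambda>n. 2 powr p * clarkson_modulus (d n) (b n)) \<longlonglongrightarrow> 0" by (simp only: mult_zero_right)
    then have 1: "\<forall>\<^sub>F n in sequentially. 2 powr p * clarkson_modulus (d n) (b n) < (e / 2) powr p"
      by (rule order_tendstoD(2)) (use e in simp)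
    have "(\<lambda>n. 2 powr p * (2 * inverse (real (Suc n)))) \<longlonglongrightarrow> 2 powr p * (2 * 0)"
      by (intro tendsto_mult tendsto_const LIMSEQ_inverse_real_of_nat)
    then have "(\<lambda>n. 2 powr p * (2 * inverse (real (Suc n)))) \<longlonglongrightarrow> 0" by (simp only: mult_zero_right)
    then have 2: "\<forall>\<^sub>F n in sequentially. 2 powr p * (2 * inverse (real (Suc n))) < (e / 2) powr p"
      by (rule order_tendstoD(2)) (use e in simp)
    obtain N where N: "2 powr p * clarkson_modulus (d N) (b N) < (e / 2) powr p"
      "2 powr p * (2 * inverse (real (Suc N))) < (e / 2) powr p"
      using eventually_happens[OF eventually_conj[OF 1 2]] by auto
    show "\<exists>N. \<forall>i\<ge>N. \<forall>j\<ge>N. energy_norm p m E (\<lambda>x. g i x - g j x) < e"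
    proof (intro exI allI impI)
      fix i j assume ij: "N \<le> i" "N \<le> j"
      have "E (\<lambda>x. g i x - g j x) < (e / 2) powr p"
        using cauchy_E[OF ij] N(1) by linarith
      moreover have "Lp_energy (\<lambda>x. g i x - g j x) < (e / 2) powr p"
        using cauchy_L[OF ij] N(2) unfolding divide_inverse by linarith
      ultimately show "energy_norm p m E (\<lambda>x. g i x - g j x) < e"
        by (rule energy_norm_lessI[OF F_diff[OF gF gF] e])
    qed
  qed
  then obtain f where f: "f \<in> F" "(\<lambda>n. energy_norm p m E (\<lambda>x. g n x - f x)) \<longlonglongrightarrow> 0"
    using banach[of g] gF by blast
  have close: "\<exists>n\<ge>n0. energy_norm p m E (\<lambda>x. g n x - f x) < e" if "0 < e" for e n0
    using eventually_happens[OF eventually_conj[OF order_tendstoD(2)[OF f(2) that] eventually_ge_at_top[of n0]]]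
    by auto
  have "Lp_energy (\<lambda>x. f x - h x) \<le> e" if e: "0 < e" for e
  proof -
    define e' where "e' = e / (2 * 2 powr p)"
    have e': "0 < e'" using e by (simp add: e'_def)
    obtain n0 where n0: "1 / real (Suc n0) < e'" using e' nat_approx_posE by blast
    obtain n where n: "n \<ge> n0" "energy_norm p m E (\<lambda>x. g n x - f x) < e' powr (1 / p)" using close[of "e' powr (1 / p)" n0] e' by auto
    have gf: "Lp_energy (\<lambda>x. g n x - f x) < e'"
      using energy_norm_less_imp(2)[OF _ n(2)] gF f(1) F_diff e' p_pos by (simp add: powr_powr)
    have gh: "Lp_energy (\<lambda>x. g n x - h x) < e'"
      using g(1)[of n] T_mono[OF n(1)] n0 unfolding T_def by auto
    have "Lp_energy (\<lambda>x. f x - h x) = Lp_energy (\<lambda>x. (g n x - h x) + (-1) * (g n x - f x))" by simp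
    also have "\<dots> \<le> 2 powr p * (Lp_energy (\<lambda>x. g n x - h x) + Lp_energy (\<lambda>x. (-1) * (g n x - f x)))"
      using gF h f(1) by (intro Lp_energy_triangle F_scale F_diff)
    also have "\<dots> \<le> 2 powr p * (e' + e')"
      unfolding Lp_energy_scale using gf gh by (intro mult_left_mono) auto
    finally have "Lp_energy (\<lambda>x. f x - h x) \<le> 2 powr p * (e' + e')" .
    then show ?thesis by (simp add: e'_def)
  qed
  then have "Lp_energy (\<lambda>x. f x - h x) = 0"
    using Lp_energy_nonneg[of "\<lambda>x. f x - h x"] by (meson dense_ge eq_iff)
  then have "AE x in m. \<bar>f x - h x\<bar> powr p = 0"
    unfolding Lp_energy_def
    using integral_nonneg_eq_0_iff_AE[OF F_integrable[OF F_diff[OF f(1) h]]] by simp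
  then have fh: "AE x in m. f x = h x" by eventually_elim simp
  obtain n where n: "energy_norm p m E (\<lambda>x. g n x - f x) < \<epsilon>" using close[OF \<open>0 < \<epsilon>\<close>] by blast
  have "E (\<lambda>x. g n x - h x) = E (\<lambda>x. g n x - f x)"
  proof -
    have "(\<lambda>x. g n x - h x) \<in> borel_measurable m"
      using F_measurable[OF F_diff[OF gF h]] by (simp add: borel_measurable_m)
    moreover have "AE x in m. g n x - h x = g n x - f x" using fh by eventually_elim simp
    ultimately show ?thesis using AE_invariant[OF F_diff[OF gF f(1)]] by blast
  qed
  moreover have "Lp_energy (\<lambda>x. g n x - h x) = Lp_energy (\<lambda>x. g n x - f x)"
    unfolding Lp_energy_def using fh F_measurable[OF gF] F_measurable[OF h] F_measurable[OF f(1)]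
    by (intro integral_cong_AE) (auto simp: borel_measurable_m)
  ultimately have "energy_norm p m E (\<lambda>x. g n x - h x) < \<epsilon>" using n by (simp add: energy_norm_eq)
  then show ?thesis using g(1)[of n] unfolding T_def by blast
qed

end

section \<open>Calculus of mutual energies\<close>

lemma nonneg_derivative_of_right_minimum:
  fixes q :: "real \<Rightarrow> real"
  assumes q: "(q has_real_derivative D) (at 0)" and le: "\<And>t. 0 < t \<Longrightarrow> t < 1 \<Longrightarrow> q 0 \<le> q t"
  shows "0 \<le> D"
proof (rule ccontr)
  assume "\<not> 0 \<le> D"
  then obtain d where d: "0 < d" "\<And>h. 0 < h \<Longrightarrow> h < d \<Longrightarrow> q (0 + h) < q 0"
    using has_real_derivative_neg_dec_right[of q D 0 UNIV] q by auto
  define t where "t = min (d / 2) (1 / 2)"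
  have "0 < t" "t < d" "t < 1" using d(1) by (auto simp: t_def)
  then show False using d(2)[of t] le[of t] by simp
qed

context p_energy_measure
begin

lemma sets_\<Gamma> [simp]: "f \<in> F \<Longrightarrow> sets (\<Gamma> f) = sets borel"
  using \<Gamma>_radon unfolding radon_measure_def by blast

lemma space_\<Gamma> [simp]: "f \<in> F \<Longrightarrow> space (\<Gamma> f) = UNIV"
  using sets_eq_imp_space_eq[OF sets_\<Gamma>] by simp

lemma finite_\<Gamma>: "f \<in> F \<Longrightarrow> finite_measure (\<Gamma> f)"
  using \<Gamma>_total by (intro finite_measureI) simp

lemma measure_\<Gamma>_UNIV: "f \<in> F \<Longrightarrow> measure (\<Gamma> f) UNIV = E f"
  using \<Gamma>_total E_nonneg by (simp add: measure_def)

lemma \<Gamma>_union: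
  "f \<in> F \<Longrightarrow> A \<in> sets borel \<Longrightarrow> B \<in> sets borel \<Longrightarrow> A \<inter> B = {} \<Longrightarrow>
    measure (\<Gamma> f) (A \<union> B) = measure (\<Gamma> f) A + measure (\<Gamma> f) B"
  using finite_measure.finite_measure_Union[OF finite_\<Gamma>] by simp

lemma \<Gamma>_mono:
  "f \<in> F \<Longrightarrow> B \<in> sets borel \<Longrightarrow> A \<subseteq> B \<Longrightarrow> measure (\<Gamma> f) A \<le> measure (\<Gamma> f) B"
  using finite_measure.finite_measure_mono[OF finite_\<Gamma>] by simp

lemma \<Gamma>_functional: "A \<in> sets borel \<Longrightarrow> homogeneous_functional p F (\<lambda>f. measure (\<Gamma> f) A)"
  by unfold_locales (use p_gt_1 \<Gamma>_seminorm F_scale F_add in auto)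

lemmas \<Gamma>_homogeneous = homogeneous_functional.homogeneous[OF \<Gamma>_functional]
lemmas \<Gamma>_convex = homogeneous_functional.convex[OF \<Gamma>_functional]
lemmas \<Gamma>_quasi_triangle = homogeneous_functional.quasi_triangle[OF \<Gamma>_functional]

lemma \<Gamma>_zero: "A \<in> sets borel \<Longrightarrow> measure (\<Gamma> (\<lambda>_. 0)) A = 0"
  using \<Gamma>_homogeneous[OF _ F_zero, of A 0] p_pos by simp

lemma \<Gamma>_constant:
  assumes "f \<in> core" "A \<in> sets borel" "\<forall>x\<in>A. f x = c"
  shows "measure (\<Gamma> f) A = 0"
  using \<Gamma>_local[OF assms(1) core_zero assms(2), of c] assms(3) \<Gamma>_zero[OF assms(2)] by simp

lemma core_perturbation: "f \<in> core \<Longrightarrow> g \<in> core \<Longrightarrow> (\<lambda>x. f x + t * g x) \<in> core"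
  using core_add core_scale by blast

abbreviation mutual :: "('a \<Rightarrow> real) \<Rightarrow> ('a \<Rightarrow> real) \<Rightarrow> 'a set \<Rightarrow> real" where
  "mutual \<equiv> mutual_energy p \<Gamma>"

lemma mutual_derivative:
  assumes "f \<in> core" "g \<in> core" "A \<in> sets borel"
  shows "((\<lambda>t. measure (\<Gamma> (\<lambda>x. f x + t * g x)) A) has_real_derivative p * mutual f g A) (at 0)"
  using \<Gamma>_differentiable[OF assms] p_pos
  by (simp add: DERIV_deriv_iff_field_differentiable mutual_energy_def)

lemma mutual_eqI:
  assumes "f \<in> core" "g \<in> core" "A \<in> sets borel"
    and "((\<lambda>t. measure (\<Gamma> (\<lambda>x. f x + t * g x)) A) has_real_derivative p * D) (at 0)"
  shows "mutual f g A = D"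
  using DERIV_unique[OF mutual_derivative[OF assms(1-3)] assms(4)] p_pos by simp

lemma mutual_homogeneous_direction:
  assumes "f \<in> core" "g \<in> core" "A \<in> sets borel"
    and "\<And>t. measure (\<Gamma> (\<lambda>x. f x + t * g x)) A = \<bar>1 + t\<bar> powr p * c"
  shows "mutual f g A = c"
proof (rule mutual_eqI[OF assms(1-3)])
  have "((\<lambda>t. (1 + t) powr p * c) has_real_derivative p * c) (at 0)"
    by (auto intro!: derivative_eq_intros)
  then show "((\<lambda>t. measure (\<Gamma> (\<lambda>x. f x + t * g x)) A) has_real_derivative p * c) (at 0)"
    by (rule has_field_derivative_transform_within_open[of _ _ _ "{-1<..<1}"]) (auto simp: assms(4))
qed

lemma mutual_self:
  assumes f: "f \<in> core" and A: "A \<in> sets borel"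
  shows "mutual f f A = measure (\<Gamma> f) A"
proof (rule mutual_homogeneous_direction[OF f f A])
  have "(\<lambda>x. f x + t * f x) = (\<lambda>x. (1 + t) * f x)" for t by (auto simp: algebra_simps)
  then show "measure (\<Gamma> (\<lambda>x. f x + t * f x)) A = \<bar>1 + t\<bar> powr p * measure (\<Gamma> f) A" for t
    using \<Gamma>_homogeneous[OF A] f by simp
qed

lemma mutual_zero_direction:
  assumes "f \<in> core" "g \<in> core" "A \<in> sets borel" "\<forall>x\<in>A. g x = c"
  shows "mutual f g A = 0"
proof (rule mutual_eqI[OF assms(1-3)])
  have "measure (\<Gamma> (\<lambda>x. f x + t * g x)) A = measure (\<Gamma> f) A" for t
    using \<Gamma>_local[OF core_perturbation[OF assms(1,2)] assms(1,3), of t "t * c"] assms(4) by simp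
  then show "((\<lambda>t. measure (\<Gamma> (\<lambda>x. f x + t * g x)) A) has_real_derivative p * 0) (at 0)" by simp
qed

lemma mutual_union:
  assumes fg: "f \<in> core" "g \<in> core" and AB: "A \<in> sets borel" "B \<in> sets borel" "A \<inter> B = {}"
  shows "mutual f g (A \<union> B) = mutual f g A + mutual f g B"
proof (rule mutual_eqI[OF fg])
  show "A \<union> B \<in> sets borel" using AB by simp
  have "measure (\<Gamma> (\<lambda>x. f x + t * g x)) (A \<union> B)
      = measure (\<Gamma> (\<lambda>x. f x + t * g x)) A + measure (\<Gamma> (\<lambda>x. f x + t * g x)) B" for t
    using core_perturbation[OF fg] AB by (intro \<Gamma>_union) auto
  then show "((\<lambda>t. measure (\<Gamma> (\<lambda>x. f x + t * g x)) (A \<union> B)) has_real_derivative p * (mutual f g A + mutual f g B)) (at 0)"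
    using DERIV_add[OF mutual_derivative[OF fg AB(1)] mutual_derivative[OF fg AB(2)]]
    by (simp add: distrib_left)
qed

lemma mutual_scale:
  assumes fg: "f \<in> core" "g \<in> core" and A: "A \<in> sets borel"
  shows "mutual f (\<lambda>x. c * g x) A = c * mutual f g A"
proof (rule mutual_eqI[OF fg(1) core_scale[OF fg(2)] A])
  have "((\<lambda>t. measure (\<Gamma> (\<lambda>x. f x + (c * t) * g x)) A) has_real_derivative (p * mutual f g A) * c) (at 0)"
    by (rule DERIV_chain2[where f="\<lambda>t. measure (\<Gamma> (\<lambda>x. f x + t * g x)) A"])
       (use mutual_derivative[OF fg A] in \<open>auto intro!: derivative_eq_intros\<close>)
  then show "((\<lambda>t. measure (\<Gamma> (\<lambda>x. f x + t * (c * g x))) A) has_real_derivative p * (c * mutual f g A)) (at 0)"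
    by (simp add: ac_simps)
qed

text \<open>
  A convex function that is differentiable in every direction has a linear derivative: the convex
  combination of the values in the directions \<open>2 g\<close> and \<open>2 h\<close> minus the value in the direction
  \<open>g + h\<close> is minimal at the origin.
\<close>

lemma mutual_add:
  assumes f: "f \<in> core" and g: "g \<in> core" and h: "h \<in> core" and A: "A \<in> sets borel"
  shows "mutual f (\<lambda>x. g x + h x) A = mutual f g A + mutual f h A"
proof -
  define q where "q u t = measure (\<Gamma> (\<lambda>x. f x + t * u x)) A" for u t
  have dq: "(q u has_real_derivative p * mutual f u A) (at 0)" if "u \<in> core" for u
    unfolding q_def using mutual_derivative[OF f that A] .
  define \<Delta> where "\<Delta> t = (q (\<lambda>x. 2 * g x) t + q (\<lambda>x. 2 * h x) t) / 2 - q (\<lambda>x. g x + h x) t" for t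
  have d\<Delta>: "(\<Delta> has_real_derivative
      (p * mutual f (\<lambda>x. 2 * g x) A + p * mutual f (\<lambda>x. 2 * h x) A) / 2 - p * mutual f (\<lambda>x. g x + h x) A) (at 0)"
    unfolding \<Delta>_def[abs_def]
    by (intro DERIV_diff DERIV_cdivide DERIV_add dq core_scale core_add g h)
  have "\<Delta> 0 \<le> \<Delta> t" for t
  proof -
    have "q (\<lambda>x. g x + h x) t = measure (\<Gamma> (\<lambda>x. (1 - 1/2) * (f x + t * (2 * g x)) + 1/2 * (f x + t * (2 * h x)))) A"
      unfolding q_def by (intro arg_cong[where f="\<lambda>u. measure (\<Gamma> u) A"] ext) (simp add: field_simps)
    also have "\<dots> \<le> (1 - 1/2) * q (\<lambda>x. 2 * g x) t + 1/2 * q (\<lambda>x. 2 * h x) t"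
      unfolding q_def using core_perturbation[OF f core_scale[OF g]] core_perturbation[OF f core_scale[OF h]]
      by (intro \<Gamma>_convex[OF A]) auto
    finally have "0 \<le> \<Delta> t" by (simp add: \<Delta>_def)
    moreover have "\<Delta> 0 = 0" by (simp add: \<Delta>_def q_def)
    ultimately show ?thesis by simp
  qed
  then have "(p * mutual f (\<lambda>x. 2 * g x) A + p * mutual f (\<lambda>x. 2 * h x) A) / 2 - p * mutual f (\<lambda>x. g x + h x) A = 0"
    using DERIV_local_min[OF d\<Delta> zero_less_one] by blast
  then have "p * mutual f (\<lambda>x. g x + h x) A = p * (mutual f g A + mutual f h A)"
    unfolding mutual_scale[OF f g A] mutual_scale[OF f h A] by (simp add: algebra_simps)
  then show ?thesis using p_pos by simp
qed

lemma mutual_sum: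
  assumes f: "f \<in> core" and A: "A \<in> sets borel"
  shows "finite I \<Longrightarrow> (\<And>i. i \<in> I \<Longrightarrow> h i \<in> core) \<Longrightarrow>
    mutual f (\<lambda>x. \<Sum>i\<in>I. h i x) A = (\<Sum>i\<in>I. mutual f (h i) A)"
proof (induction rule: finite_induct)
  case empty
  then show ?case using mutual_zero_direction[OF f core_zero A, of 0] by simp
next
  case (insert i I)
  then show ?case using mutual_add[OF f, of "h i" "\<lambda>x. \<Sum>i\<in>I. h i x"] core_sum[of I h] A by simp
qed

text \<open>
  By convexity the derivative at the origin is at most the increment between \<open>f\<close> and \<open>f + g\<close>.
\<close>

lemma mutual_le:
  assumes f: "f \<in> core" and g: "g \<in> core" and A: "A \<in> sets borel"
  shows "mutual f g A \<le> 2 powr p * (measure (\<Gamma> f) A + measure (\<Gamma> g) A)"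
proof -
  define q where "q t = measure (\<Gamma> (\<lambda>x. f x + t * g x)) A" for t
  have dq: "(q has_real_derivative p * mutual f g A) (at 0)"
    unfolding q_def using mutual_derivative[OF f g A] .
  define \<Delta> where "\<Delta> t = t * q 1 - t * q 0 + q 0 - q t" for t
  have "(\<Delta> has_real_derivative q 1 - q 0 - p * mutual f g A) (at 0)"
    unfolding \<Delta>_def[abs_def] using dq by (auto intro!: derivative_eq_intros)
  moreover have "\<Delta> 0 \<le> \<Delta> t" if "0 < t" "t < 1" for t
  proof -
    have "q t = measure (\<Gamma> (\<lambda>x. (1 - t) * f x + t * (f x + 1 * g x))) A"
      unfolding q_def by (intro arg_cong[where f="\<lambda>u. measure (\<Gamma> u) A"] ext) (simp add: algebra_simps)
    also have "\<dots> \<le> (1 - t) * measure (\<Gamma> f) A + t * q 1"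
      unfolding q_def using core_add[OF f g] f that by (intro \<Gamma>_convex[OF A]) auto
    also have "measure (\<Gamma> f) A = q 0" by (simp add: q_def)
    finally show ?thesis by (simp add: \<Delta>_def algebra_simps)
  qed
  ultimately have "0 \<le> q 1 - q 0 - p * mutual f g A" by (rule nonneg_derivative_of_right_minimum)
  moreover have "0 \<le> q 0" by (simp add: q_def)
  moreover have "q 1 \<le> 2 powr p * (measure (\<Gamma> f) A + measure (\<Gamma> g) A)"
    unfolding q_def using \<Gamma>_quasi_triangle[OF A] f g by simp
  ultimately have le: "p * mutual f g A \<le> 2 powr p * (measure (\<Gamma> f) A + measure (\<Gamma> g) A)" by simp
  have "0 \<le> 2 powr p * (measure (\<Gamma> f) A + measure (\<Gamma> g) A)" by simp
  then show ?thesis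
    using le p_gt_1 mult_right_mono[of 1 p "mutual f g A"] by (cases "mutual f g A \<le> 0") linarith+
qed

text \<open>
  This stands for the Hoelder inequality: applied to \<open>k * g\<close> and \<open>- k * g\<close>, the previous bound becomes a
  form of Young's inequality with a free parameter. In contrast to the Hoelder form it is additive in
  the measures and so controls total variations directly.
\<close>

lemma abs_mutual_le:
  assumes f: "f \<in> core" and g: "g \<in> core" and A: "A \<in> sets borel" and k: "0 < k"
  shows "\<bar>mutual f g A\<bar> \<le> 2 powr p / k * measure (\<Gamma> f) A + 2 powr p * k powr (p - 1) * measure (\<Gamma> g) A"
proof -
  have "c * mutual f g A \<le> 2 powr p * measure (\<Gamma> f) A + 2 powr p * (k powr p * measure (\<Gamma> g) A)" if "\<bar>c\<bar> = k" for c
    using mutual_le[OF f core_scale[OF g] A, of c] mutual_scale[OF f g A, of c] \<Gamma>_homogeneous[OF A, of g c] g that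
    by (simp add: distrib_left)
  from this[of k] this[of "-k"] have "k * \<bar>mutual f g A\<bar> \<le> 2 powr p * measure (\<Gamma> f) A + 2 powr p * (k powr p * measure (\<Gamma> g) A)"
    using k by (auto simp: abs_if)
  then have "\<bar>mutual f g A\<bar> \<le> (2 powr p * measure (\<Gamma> f) A + 2 powr p * (k powr p * measure (\<Gamma> g) A)) / k"
    using k by (simp add: field_simps)
  also have "\<dots> = 2 powr p / k * measure (\<Gamma> f) A + 2 powr p * k powr (p - 1) * measure (\<Gamma> g) A"
    using k by (simp add: add_divide_distrib powr_diff)
  finally show ?thesis .
qed

lemma abs_integral_mutual_le:
  assumes f: "f \<in> core" and g: "g \<in> core" and A: "A \<in> sets borel" and k: "0 < k"
    and u: "u \<in> core" "\<And>x. x \<in> A \<Longrightarrow> \<bar>u x\<bar> \<le> a"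
  shows "\<bar>signed_integral (mutual f g) A u\<bar>
    \<le> a * (2 powr p / k * measure (\<Gamma> f) A + 2 powr p * k powr (p - 1) * measure (\<Gamma> g) A)"
proof (rule abs_signed_integral_le[OF mutual_energy_signed_measure[OF f g] A])
  show "u \<in> borel_measurable borel" using u(1) Cc_measurable by blast
  show "finite_measure (\<Gamma> f)" "finite_measure (\<Gamma> g)" using finite_\<Gamma> f g by auto
  show "\<bar>mutual f g B\<bar> \<le> 2 powr p / k * measure (\<Gamma> f) B + 2 powr p * k powr (p - 1) * measure (\<Gamma> g) B"
    if "B \<in> sets borel" for B by (rule abs_mutual_le[OF f g that k])
qed (use u(2) f g k in auto)

definition product_const :: real where
  "product_const = 2 * 2 powr p * (4 * 2 powr p) powr (p - 1)"

lemma product_const_pos: "0 < product_const"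
  by (simp add: product_const_def)

text \<open>
  The algebra inequality holds locally: expand \<open>\<Gamma> (u v) = \<Gamma> (u v; u v)\<close> by the Leibniz rule and
  absorb the copies of \<open>\<Gamma> (u v)\<close> that Young's inequality produces.
\<close>

lemma \<Gamma>_product_le:
  assumes u: "u \<in> core" and v: "v \<in> core" and A: "A \<in> sets borel"
    and ab: "0 < a" "0 < b" "\<And>x. x \<in> A \<Longrightarrow> \<bar>u x\<bar> \<le> a" "\<And>x. x \<in> A \<Longrightarrow> \<bar>v x\<bar> \<le> b"
  shows "measure (\<Gamma> (\<lambda>x. u x * v x)) A
    \<le> product_const * (a powr p * measure (\<Gamma> v) A + b powr p * measure (\<Gamma> u) A)"
proof -
  define w where "w = (\<lambda>x. u x * v x)"
  have w: "w \<in> core" unfolding w_def by (rule core_mult(1)[OF u v])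
  define \<gamma> where "\<gamma> g = measure (\<Gamma> g) A" for g
  have half: "\<bar>signed_integral (mutual w g) A h\<bar> \<le> 1/4 * \<gamma> w + product_const / 2 * (c powr p * \<gamma> g)"
    if g: "g \<in> core" and h: "h \<in> core" "\<And>x. x \<in> A \<Longrightarrow> \<bar>h x\<bar> \<le> c" and c: "0 < c" for g h c
  proof -
    (* With this k, Young's inequality has the coefficient 1 / 4 in front of the energy of w. *)
    define k where "k = 4 * 2 powr p * c"
    have "\<bar>signed_integral (mutual w g) A h\<bar>
        \<le> c * (2 powr p / k * \<gamma> w + 2 powr p * k powr (p - 1) * \<gamma> g)"
      unfolding \<gamma>_def using c by (intro abs_integral_mutual_le[OF w g A _ h]) (auto simp: k_def)
    also have "\<dots> = 1/4 * \<gamma> w + product_const / 2 * (c * c powr (p - 1) * \<gamma> g)"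
      using c by (simp add: k_def product_const_def powr_mult field_simps)
    also have "c * c powr (p - 1) = c powr p" using c by (simp add: powr_diff)
    finally show ?thesis .
  qed
  have "\<gamma> w = mutual w (\<lambda>x. u x * v x) A" using mutual_self[OF w A] by (simp add: \<gamma>_def w_def)
  also have "\<dots> = signed_integral (mutual w v) A u + signed_integral (mutual w u) A v"
    by (rule leibniz_rule[OF w u v A])
  also have "\<dots> \<le> (1/4 * \<gamma> w + product_const / 2 * (a powr p * \<gamma> v)) + (1/4 * \<gamma> w + product_const / 2 * (b powr p * \<gamma> u))"
    using half[OF v u ab(3,1)] half[OF u v ab(4,2)] by linarith
  finally show ?thesis by (simp add: \<gamma>_def w_def algebra_simps)
qed

end

section \<open>Truncated test functions\<close>

definition clamp_sym :: "real \<Rightarrow> real \<Rightarrow> real" where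
  "clamp_sym t y = max (- t) (min t y)"

lemma abs_clamp_sym_le: "0 \<le> t \<Longrightarrow> \<bar>clamp_sym t y\<bar> \<le> t"
  by (auto simp: clamp_sym_def)

lemma clamp_sym_lipschitz: "\<bar>clamp_sym t y - clamp_sym t z\<bar> \<le> \<bar>y - z\<bar>"
  by (auto simp: clamp_sym_def max_def min_def)

context p_energy_measure
begin

text \<open>
  Constants do not belong to the domain, so the truncation of \<open>f - c\<close> is normalised to vanish
  where \<open>f\<close> does.
\<close>

definition truncation :: "real \<Rightarrow> real \<Rightarrow> ('a \<Rightarrow> real) \<Rightarrow> 'a \<Rightarrow> real" where
  "truncation t c f x = clamp_sym t (f x - c) - clamp_sym t (- c)"

lemma truncation_core:
  assumes "f \<in> core" shows "truncation t c f \<in> core"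
proof -
  have "(\<lambda>x. clamp_sym t (f x - c) - clamp_sym t (- c)) \<in> core"
  proof (rule core_compose(1)[OF assms, of "\<lambda>y. clamp_sym t (y - c) - clamp_sym t (- c)"])
    show "\<bar>clamp_sym t (y - c) - clamp_sym t (- c) - (clamp_sym t (z - c) - clamp_sym t (- c))\<bar> \<le> \<bar>y - z\<bar>" for y z
      using clamp_sym_lipschitz[of t "y - c" "z - c"] by simp
  qed simp
  then show ?thesis by (simp add: truncation_def[abs_def])
qed

lemma abs_truncation_le: "0 \<le> t \<Longrightarrow> \<bar>truncation t c f x\<bar> \<le> 2 * t"
  unfolding truncation_def using abs_clamp_sym_le[of t "f x - c"] abs_clamp_sym_le[of t "- c"] by linarith

lemma core_sublevel_borel: "f \<in> core \<Longrightarrow> {x. \<bar>f x - c\<bar> < t} \<in> sets borel"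
proof -
  assume "f \<in> core"
  then have "continuous_on UNIV f" by (auto elim: CcE)
  then have "open {x. \<bar>f x - c\<bar> < t}" by (intro open_Collect_less continuous_intros)
  then show ?thesis by simp
qed

text \<open>
  Up to constants, the truncation equals \<open>f\<close> on \<open>{\<bar>f - c\<bar> < t}\<close> and is constant on the two remaining
  pieces. Locality evaluates the energies on each piece.
\<close>

lemma truncation_split:
  assumes f: "f \<in> core" and t: "0 < t" and B: "B \<in> sets borel"
  shows "mutual f (truncation t c f) B = measure (\<Gamma> f) (B \<inter> {x. \<bar>f x - c\<bar> < t})"
    and "measure (\<Gamma> (truncation t c f)) B = measure (\<Gamma> f) (B \<inter> {x. \<bar>f x - c\<bar> < t})"
proof -
  define v where "v = truncation t c f"
  have v: "v \<in> core" unfolding v_def using truncation_core[OF f] .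
  have fm: "f \<in> borel_measurable borel" using f F_measurable by blast
  define A1 where "A1 = B \<inter> {x. \<bar>f x - c\<bar> < t}"
  define A2 where "A2 = B \<inter> {x. t \<le> f x - c}"
  define A3 where "A3 = B \<inter> {x. f x - c \<le> - t}"
  have borel: "A1 \<in> sets borel" "A2 \<in> sets borel" "A3 \<in> sets borel"
    unfolding A1_def A2_def A3_def using B fm core_sublevel_borel[OF f] by measurable
  have B_eq: "B = A1 \<union> (A2 \<union> A3)" unfolding A1_def A2_def A3_def by auto
  have disj: "A1 \<inter> (A2 \<union> A3) = {}" "A2 \<inter> A3 = {}" unfolding A1_def A2_def A3_def using t by auto
  have v1: "\<forall>x\<in>A1. v x = f x - c - clamp_sym t (- c)"
    and v2: "\<forall>x\<in>A2. v x = t - clamp_sym t (- c)"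
    and v3: "\<forall>x\<in>A3. v x = - t - clamp_sym t (- c)"
    unfolding A1_def A2_def A3_def v_def truncation_def using t by (auto simp: clamp_sym_def[of t "f _ - c"])
  have "mutual f v A1 = measure (\<Gamma> f) A1"
  proof (rule mutual_homogeneous_direction[OF f v borel(1)])
    fix s
    have "measure (\<Gamma> (\<lambda>x. f x + s * v x)) A1 = measure (\<Gamma> (\<lambda>x. (1 + s) * f x)) A1"
    proof (intro \<Gamma>_local[OF core_perturbation[OF f v] core_scale[OF f] borel(1)] ballI)
      fix x assume "x \<in> A1"
      then have "v x = f x - c - clamp_sym t (- c)" using v1 by blast
      then show "f x + s * v x - (1 + s) * f x = s * (- c - clamp_sym t (- c))"
        by (simp only:) (simp add: algebra_simps)
    qed
    then show "measure (\<Gamma> (\<lambda>x. f x + s * v x)) A1 = \<bar>1 + s\<bar> powr p * measure (\<Gamma> f) A1"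
      using \<Gamma>_homogeneous[OF borel(1)] f by simp
  qed
  moreover have "mutual f v A2 = 0" "mutual f v A3 = 0"
    using mutual_zero_direction[OF f v borel(2) v2] mutual_zero_direction[OF f v borel(3) v3] by auto
  ultimately have "mutual f v (A1 \<union> (A2 \<union> A3)) = measure (\<Gamma> f) A1"
    using mutual_union[OF f v borel(1), of "A2 \<union> A3"] mutual_union[OF f v borel(2,3)] disj borel by simp
  then show "mutual f (truncation t c f) B = measure (\<Gamma> f) (B \<inter> {x. \<bar>f x - c\<bar> < t})"
    unfolding B_eq[symmetric] by (simp only: v_def A1_def)
  have "measure (\<Gamma> v) A1 = measure (\<Gamma> f) A1"
    using v1 by (intro \<Gamma>_local[OF v f borel(1), where c="- c - clamp_sym t (- c)"]) auto
  moreover have "measure (\<Gamma> v) A2 = 0" "measure (\<Gamma> v) A3 = 0"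
    using \<Gamma>_constant[OF v borel(2) v2] \<Gamma>_constant[OF v borel(3) v3] by auto
  ultimately have "measure (\<Gamma> v) (A1 \<union> (A2 \<union> A3)) = measure (\<Gamma> f) A1"
    using \<Gamma>_union[of v A1 "A2 \<union> A3"] \<Gamma>_union[of v A2 A3] v disj borel by simp
  then show "measure (\<Gamma> (truncation t c f)) B = measure (\<Gamma> f) (B \<inter> {x. \<bar>f x - c\<bar> < t})"
    unfolding B_eq[symmetric] by (simp only: v_def A1_def)
qed

definition test_function :: "real \<Rightarrow> real \<Rightarrow> ('a \<Rightarrow> real) \<Rightarrow> ('a \<Rightarrow> real) \<Rightarrow> 'a \<Rightarrow> real" where
  "test_function t c f \<phi> x = \<phi> x * clamp_sym t (f x - c)"

lemma test_function_eq:
  "test_function t c f \<phi> = (\<lambda>x. \<phi> x * truncation t c f x + clamp_sym t (- c) * \<phi> x)"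
  by (rule ext) (simp add: test_function_def truncation_def right_diff_distrib mult.commute)

lemma test_function_core:
  assumes "f \<in> core" "\<phi> \<in> core"
  shows "test_function t c f \<phi> \<in> core"
  unfolding test_function_eq
  using core_add[OF core_mult(1)[OF assms(2) truncation_core[OF assms(1)]] core_scale[OF assms(2)]] .

lemma signed_integral_truncation:
  assumes f: "f \<in> core" and t: "0 < t" and V: "V \<in> sets borel"
    and \<phi>: "\<phi> \<in> borel_measurable borel" "\<And>x. \<bar>\<phi> x\<bar> \<le> b"
  shows "signed_integral (mutual f (truncation t c f)) V \<phi> = (LINT x:V \<inter> {x. \<bar>f x - c\<bar> < t}|\<Gamma> f. \<phi> x)"
proof -
  define A where "A = {x. \<bar>f x - c\<bar> < t}"
  have A: "A \<in> sets borel" unfolding A_def by (rule core_sublevel_borel[OF f])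
  have fF: "f \<in> F" using f by simp
  have sets\<Gamma>: "sets (\<Gamma> f) = sets borel" and "emeasure (\<Gamma> f) A < \<infinity>"
    using fF finite_measure.emeasure_finite[OF finite_\<Gamma>[OF fF], of A] by (auto simp: less_top[symmetric])
  note d = density_indicator[OF this(1) A this(2)]
  define P where "P = density (\<Gamma> f) (indicator A)"
  define N where "N = null_measure (\<Gamma> f)"
  have setsP: "sets P = sets borel" "sets N = sets borel" using sets\<Gamma> by (auto simp: P_def N_def)
  have measP: "measure P B = measure (\<Gamma> f) (B \<inter> A)" if "B \<in> sets borel" for B
    using d(2)[OF that] by (simp add: P_def measure_def Int_commute)
  have "finite_measure P" unfolding P_def by (rule d(1))
  moreover have "finite_measure N" unfolding N_def by (intro finite_measureI) simp
  ultimately have dec: "signed_decomposition (mutual f (truncation t c f)) P N"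
    unfolding signed_decomposition_def using setsP truncation_split(1)[OF f t] measP
    by (simp add: A_def N_def measure_def)
  have "signed_integral (mutual f (truncation t c f)) V \<phi> = (LINT x:V|P. \<phi> x) - (LINT x:V|N. \<phi> x)"
    by (rule signed_integral_eq[OF dec V \<phi>])
  also have "(LINT x:V|N. \<phi> x) = 0"
    unfolding N_def set_lebesgue_integral_def by (simp add: integral_null_measure)
  also have "(LINT x:V|P. \<phi> x) = (\<integral>x. indicator V x * \<phi> x \<partial>P)"
    by (simp add: set_lebesgue_integral_def)
  also have "\<dots> = (LINT x:A|\<Gamma> f. indicator V x * \<phi> x)"
    unfolding P_def using V \<phi>(1) by (intro d(3)) simp
  also have "\<dots> = (LINT x:V \<inter> A|\<Gamma> f. \<phi> x)"
    unfolding set_lebesgue_integral_def by (intro Bochner_Integration.integral_cong) (auto simp: indicator_def)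
  finally show ?thesis by (simp add: A_def)
qed

text \<open>
  The Leibniz rule splits the mutual energy into the energy of \<open>f\<close> weighted by \<open>\<phi>\<close>, which is the gain, and
  terms containing the mutual energy of \<open>f\<close> and \<open>\<phi>\<close>. In the latter, the factor \<open>3 * t\<close> is the bound \<open>2 * t\<close>
  for the normalised truncation plus the bound \<open>t\<close> for its normalising constant.
\<close>

lemma mutual_test_function_ge:
  assumes f: "f \<in> core" and \<phi>: "\<phi> \<in> core" "\<And>x. 0 \<le> \<phi> x" "\<And>x. \<phi> x \<le> 1"
    and V: "V \<in> sets borel" "\<And>x. x \<notin> V \<Longrightarrow> \<phi> x = 0"
    and t: "0 < t" and k: "0 < k"
  shows "mutual f (test_function t c f \<phi>) UNIV \<ge> (LINT x:V \<inter> {x. \<bar>f x - c\<bar> < t}|\<Gamma> f. \<phi> x)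
    - 3 * t * (2 powr p / k * measure (\<Gamma> f) V + 2 powr p * k powr (p - 1) * measure (\<Gamma> \<phi>) V)"
proof -
  define v where "v = truncation t c f"
  define h where "h = test_function t c f \<phi>"
  define R where "R = 2 powr p / k * measure (\<Gamma> f) V + 2 powr p * k powr (p - 1) * measure (\<Gamma> \<phi>) V"
  have v: "v \<in> core" unfolding v_def using truncation_core[OF f] .
  have h: "h \<in> core" unfolding h_def using test_function_core[OF f \<phi>(1)] .
  have "mutual f h UNIV = mutual f h V + mutual f h (- V)"
    using mutual_union[OF f h V(1), of "- V"] V(1) by (simp add: Compl_partition)
  also have "mutual f h (- V) = 0"
    using V by (intro mutual_zero_direction[OF f h, where c=0]) (auto simp: h_def test_function_def)
  also have "mutual f h V = mutual f (\<lambda>x. \<phi> x * v x) V + clamp_sym t (- c) * mutual f \<phi> V"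
    unfolding h_def test_function_eq v_def[symmetric]
    using mutual_add[OF f core_mult(1)[OF \<phi>(1) v] core_scale[OF \<phi>(1)] V(1)] mutual_scale[OF f \<phi>(1) V(1)] by simp
  also have "mutual f (\<lambda>x. \<phi> x * v x) V = signed_integral (mutual f v) V \<phi> + signed_integral (mutual f \<phi>) V v"
    by (rule leibniz_rule[OF f \<phi>(1) v V(1)])
  also have "signed_integral (mutual f v) V \<phi> = (LINT x:V \<inter> {x. \<bar>f x - c\<bar> < t}|\<Gamma> f. \<phi> x)"
    unfolding v_def using \<phi> Cc_measurable by (intro signed_integral_truncation[OF f t V(1), where b=1]) auto
  finally have eq: "mutual f h UNIV = (LINT x:V \<inter> {x. \<bar>f x - c\<bar> < t}|\<Gamma> f. \<phi> x)
      + signed_integral (mutual f \<phi>) V v + clamp_sym t (- c) * mutual f \<phi> V" by simp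
  have "\<bar>signed_integral (mutual f \<phi>) V v\<bar> \<le> 2 * t * R"
    unfolding R_def v_def[symmetric] using abs_truncation_le[of t c f] t
    by (intro abs_integral_mutual_le[OF f \<phi>(1) V(1) k v]) (auto simp: v_def)
  moreover have "\<bar>clamp_sym t (- c) * mutual f \<phi> V\<bar> \<le> t * R"
    unfolding abs_mult R_def using abs_clamp_sym_le[of t "- c"] abs_mutual_le[OF f \<phi>(1) V(1) k] t
    by (intro mult_mono) auto
  ultimately have "mutual f h UNIV \<ge> (LINT x:V \<inter> {x. \<bar>f x - c\<bar> < t}|\<Gamma> f. \<phi> x) - 3 * t * R"
    using eq by linarith
  then show ?thesis unfolding h_def R_def .
qed

lemma \<Gamma>_test_function_le:
  assumes f: "f \<in> core" and \<phi>: "\<phi> \<in> core" "\<And>x. 0 \<le> \<phi> x" "\<And>x. \<phi> x \<le> 1"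
    and V: "V \<in> sets borel" and t: "0 < t"
  shows "measure (\<Gamma> (test_function t c f \<phi>)) V
    \<le> 2 powr p * (product_const * 2 powr p + 1) * (measure (\<Gamma> f) V + t powr p * measure (\<Gamma> \<phi>) V)"
proof -
  define v where "v = truncation t c f"
  have v: "v \<in> core" unfolding v_def using truncation_core[OF f] .
  have vf: "measure (\<Gamma> v) V \<le> measure (\<Gamma> f) V"
    unfolding v_def truncation_split(2)[OF f t V] using f V by (intro \<Gamma>_mono) auto
  have "measure (\<Gamma> (\<lambda>x. \<phi> x * v x)) V \<le> product_const * (1 powr p * measure (\<Gamma> v) V + (2 * t) powr p * measure (\<Gamma> \<phi>) V)"
    using \<phi> t abs_truncation_le[of t c f] by (intro \<Gamma>_product_le[OF \<phi>(1) v V]) (auto simp: v_def)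
  also have "\<dots> \<le> product_const * (2 powr p * measure (\<Gamma> f) V + 2 powr p * (t powr p * measure (\<Gamma> \<phi>) V))"
  proof -
    have "measure (\<Gamma> f) V \<le> 2 powr p * measure (\<Gamma> f) V"
      using ge_one_powr_ge_zero[of 2 p] p_pos by (simp add: mult_le_cancel_right1)
    then show ?thesis using vf product_const_pos t by (intro mult_left_mono) (auto simp: powr_mult)
  qed
  finally have 1: "measure (\<Gamma> (\<lambda>x. \<phi> x * v x)) V \<le> product_const * 2 powr p * (measure (\<Gamma> f) V + t powr p * measure (\<Gamma> \<phi>) V)"
    by (simp add: algebra_simps)
  have 2: "measure (\<Gamma> (\<lambda>x. clamp_sym t (- c) * \<phi> x)) V \<le> t powr p * measure (\<Gamma> \<phi>) V"
    using \<Gamma>_homogeneous[OF V, of \<phi> "clamp_sym t (- c)"] \<phi>(1) abs_clamp_sym_le[of t "- c"] t p_pos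
    by (auto intro!: mult_right_mono powr_mono2)
  have "measure (\<Gamma> (test_function t c f \<phi>)) V
      \<le> 2 powr p * (measure (\<Gamma> (\<lambda>x. \<phi> x * v x)) V + measure (\<Gamma> (\<lambda>x. clamp_sym t (- c) * \<phi> x)) V)"
    unfolding test_function_eq v_def[symmetric]
    using \<Gamma>_quasi_triangle[OF V] core_mult(1)[OF \<phi>(1) v] core_scale[OF \<phi>(1)] by blast
  also have "\<dots> \<le> 2 powr p * (product_const * 2 powr p * (measure (\<Gamma> f) V + t powr p * measure (\<Gamma> \<phi>) V)
      + (measure (\<Gamma> f) V + t powr p * measure (\<Gamma> \<phi>) V))"
    using 1 2 measure_nonneg[of "\<Gamma> f" V] by (intro mult_left_mono add_mono) (linarith | simp)+
  finally show ?thesis by (simp add: algebra_simps)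
qed

end

section \<open>Continuous cutoff functions of small energy\<close>

context p_energy
begin

lemma core_clamp:
  assumes "f \<in> core"
  shows "(\<lambda>x. max 0 (min 1 (f x))) \<in> core" "E (\<lambda>x. max 0 (min 1 (f x))) \<le> E f"
proof -
  have "\<bar>max 0 (min 1 t) - max 0 (min 1 s)\<bar> \<le> \<bar>t - s\<bar>" for s t :: real
    by (auto simp: max_def min_def)
  note this[rule_format]
  then show "(\<lambda>x. max 0 (min 1 (f x))) \<in> core" "E (\<lambda>x. max 0 (min 1 (f x))) \<le> E f"
    using core_compose[OF assms, of "\<lambda>t. max 0 (min 1 t)"] by simp_all
qed

lemma quasi_continuous_core:
  assumes "f \<in> core"
  shows "quasi_continuous_modification p m F E f f"
proof -
  have "cap1 p m F E {} \<le> ennreal (energy_one p m E (\<lambda>_. 0))"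
    unfolding cap1_def using F_zero by (intro INF_lower) auto
  also have "energy_one p m E (\<lambda>_. 0) = 0" using E_zero p_pos by (simp add: energy_one_def)
  finally have "cap1 p m F E {} = 0" by simp
  then have "quasi_continuous p m F E f"
    unfolding quasi_continuous_def using assms by (intro allI impI exI[of _ "{}"]) (auto elim: CcE)
  then show ?thesis
    unfolding quasi_continuous_modification_def using assms Cc_measurable by auto
qed

text \<open>
  Members of the domain that are supported inside an open set are limits of elements of the core
  vanishing outside that set: multiplying approximations by a bump function keeps the energies
  bounded, and convex combinations then converge.
\<close>

lemma core_approximation_supported:
  assumes \<phi>: "\<phi> \<in> F" "AE x in m. 0 \<le> \<phi> x \<and> \<phi> x \<le> 1"
    and V: "open V" "bounded V" "supp m \<phi> \<subseteq> V" and "0 < \<epsilon>"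
  shows "\<exists>g\<in>core. (\<forall>x. x \<notin> V \<longrightarrow> g x = 0) \<and> energy_norm p m E (\<lambda>x. g x - \<phi> x) < \<epsilon>"
proof -
  define K where "K = supp m \<phi>"
  have K: "compact K"
    unfolding K_def using V bounded_subset closed_measure_support unfolding supp_def
    by (intro closed_bounded_compact) auto
  obtain \<zeta> where \<zeta>: "\<zeta> \<in> core" "\<And>x. 0 \<le> \<zeta> x \<and> \<zeta> x \<le> 1" "\<And>x. x \<in> K \<Longrightarrow> \<zeta> x = 1" "\<And>x. x \<notin> V \<Longrightarrow> \<zeta> x = 0"
    using bump_function[OF K V(1) _ V(2)] V(3) unfolding K_def by blast
  define S where "S = {g \<in> core. \<forall>x. x \<notin> V \<longrightarrow> g x = 0}"
  (* The algebra inequality bounds the energies of all products by M. *)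
  define M where "M = ((2 powr p * (E \<phi> + 1)) powr (1 / p) + E \<zeta> powr (1 / p)) powr p"
  have "\<exists>g\<in>S. energy_norm p m E (\<lambda>x. g x - \<phi> x) < \<epsilon>"
  proof (rule strong_approximation[OF _ _ \<phi>(1) _ \<open>0 < \<epsilon>\<close>])
    show "S \<subseteq> F" unfolding S_def by blast
    show "(\<lambda>x. 1/2 * f x + 1/2 * g x) \<in> S" if "f \<in> S" "g \<in> S" for f g
      using that core_add[OF core_scale core_scale, of f g "1/2" "1/2"] unfolding S_def by simp
    show "\<exists>g\<in>S. E g \<le> M \<and> Lp_energy (\<lambda>x. g x - \<phi> x) < e" if e: "0 < e" for e
    proof -
      define e' where "e' = min 1 (e powr (1 / p))"
      have e': "0 < e'" "e' powr p \<le> 1" "e' powr p \<le> e"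
      proof -
        show "0 < e'" using e by (simp add: e'_def)
        then show "e' powr p \<le> 1" using p_pos powr_mono2[of p e' 1] by (simp add: e'_def)
        have "e' powr p \<le> (e powr (1 / p)) powr p" using e p_pos \<open>0 < e'\<close> by (intro powr_mono2) (auto simp: e'_def)
        then show "e' powr p \<le> e" using e p_pos by (simp add: powr_powr)
      qed
      obtain g where g: "g \<in> core" "energy_norm p m E (\<lambda>x. \<phi> x - g x) < e'"
        using regular_F[OF \<phi>(1) e'(1)] by blast
      have g': "E (\<lambda>x. \<phi> x - g x) < 1" "Lp_energy (\<lambda>x. \<phi> x - g x) < e"
        using energy_norm_less_imp[OF F_diff[OF \<phi>(1)] g(2)] g(1) e' by auto
      define c where "c = (\<lambda>x. max 0 (min 1 (g x)))"
      have c: "c \<in> core" "E c \<le> E g"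
        unfolding c_def by (rule core_clamp[OF g(1)])+
      define k where "k = (\<lambda>x. \<zeta> x * c x)"
      have k: "k \<in> core" unfolding k_def by (rule core_mult(1)[OF \<zeta>(1) c(1)])
      have "k \<in> S" unfolding S_def using k \<zeta>(4) by (simp add: k_def)
      moreover have "E k \<le> M"
      proof -
        have "E g = E (\<lambda>x. \<phi> x + (-1) * (\<phi> x - g x))" by simp
        also have "\<dots> \<le> 2 powr p * (E \<phi> + E (\<lambda>x. (-1) * (\<phi> x - g x)))"
          using \<phi>(1) g(1) by (intro E.quasi_triangle F_scale F_diff) auto
        also have "E (\<lambda>x. (-1) * (\<phi> x - g x)) = E (\<lambda>x. \<phi> x - g x)"
          using E.homogeneous[OF F_diff[OF \<phi>(1)], of g "-1"] g(1) by simp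
        also have "2 powr p * (E \<phi> + E (\<lambda>x. \<phi> x - g x)) \<le> 2 powr p * (E \<phi> + 1)"
          using g'(1) by (intro mult_left_mono) auto
        finally have "E g \<le> 2 powr p * (E \<phi> + 1)" .
        then have Ec: "E c \<le> 2 powr p * (E \<phi> + 1)" using c(2) by simp
        have "E k powr (1 / p) \<le> E \<zeta> powr (1 / p) + E c powr (1 / p)"
          unfolding k_def using \<zeta>(2) by (intro core_mult(2)[OF \<zeta>(1) c(1)]) (auto simp: c_def)
        also have "\<dots> \<le> (2 powr p * (E \<phi> + 1)) powr (1 / p) + E \<zeta> powr (1 / p)"
          using powr_mono2[OF _ _ Ec, of "1 / p"] E_nonneg c(1) p_pos by simp
        finally have "(E k powr (1 / p)) powr p \<le> M" unfolding M_def using p_pos by (intro powr_mono2) auto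
        then show ?thesis using E.root_powr k by simp
      qed
      moreover have "Lp_energy (\<lambda>x. k x - \<phi> x) \<le> Lp_energy (\<lambda>x. \<phi> x - g x)"
        unfolding Lp_energy_def
      proof (rule integral_mono_AE)
        show "integrable m (\<lambda>x. \<bar>k x - \<phi> x\<bar> powr p)" "integrable m (\<lambda>x. \<bar>\<phi> x - g x\<bar> powr p)"
          using k g(1) \<phi>(1) by (auto intro!: F_integrable F_diff)
        have "AE x in m. x \<notin> K \<longrightarrow> \<phi> x = 0"
          unfolding K_def by (rule AE_zero_outside_supp[OF F_measurable[OF \<phi>(1)]])
        with \<phi>(2) show "AE x in m. \<bar>k x - \<phi> x\<bar> powr p \<le> \<bar>\<phi> x - g x\<bar> powr p"
        proof eventually_elim
          case (elim x)
          have "\<bar>k x - \<phi> x\<bar> \<le> \<bar>c x - \<phi> x\<bar>"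
          proof (cases "x \<in> K")
            case True then show ?thesis using \<zeta>(3) by (simp add: k_def)
          next
            case False
            then have "\<phi> x = 0" using elim by simp
            then show ?thesis using \<zeta>(2)[of x] by (simp add: k_def c_def abs_mult mult_left_le_one_le)
          qed
          also have "\<dots> \<le> \<bar>\<phi> x - g x\<bar>" using elim by (auto simp: c_def)
          finally show ?case using p_pos by (intro powr_mono2) auto
        qed
      qed
      ultimately show ?thesis using g'(2) by (intro bexI[of _ k]) auto
    qed
  qed
  then show ?thesis unfolding S_def by blast
qed

end

context p_energy_measure
begin

text \<open>
  For a function that is constant on the larger ball, the cutoff Sobolev inequality bounds the energy
  of the cutoff function there, hence a relative capacity.
\<close>

lemma cutoff_energy_bound:
  assumes CS: "cutoff_sobolev p m F E \<Gamma> \<Psi>" and \<Psi>: "\<And>r. 0 < r \<Longrightarrow> 0 < \<Psi> r"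
  obtains C A where "0 < C" "1 < A"
    "\<And>x r. 0 < r \<Longrightarrow> \<exists>\<phi>. cutoff_function m F (ball x r) (ball x (A * r)) \<phi> \<and>
      measure (\<Gamma> \<phi>) (ball x (A * r)) \<le> C / \<Psi> r * vol x (A * r)"
proof -
  obtain C1 C2 A where C: "0 < C1" "0 < C2" "1 < A"
    and cs: "\<forall>x. \<forall>r>0. \<exists>\<phi>. cutoff_function m F (ball x r) (ball x (A * r)) \<phi> \<and>
        (\<forall>f\<in>F. \<forall>u. quasi_continuous_modification p m F E f u \<longrightarrow>
           (\<integral>\<^sup>+y\<in>ball x (A * r). ennreal (\<bar>u y\<bar> powr p) \<partial>\<Gamma> \<phi>)
             \<le> ennreal (C1 * measure (\<Gamma> f) (ball x (A * r))
                 + C2 / \<Psi> r * (LINT y:ball x (A * r)|m. \<bar>f y\<bar> powr p)))"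
    using CS unfolding cutoff_sobolev_def by blast
  show thesis
  proof (rule that[OF C(2,3)])
    fix x :: 'a and r :: real assume r: "0 < r"
    define V where "V = ball x (A * r)"
    obtain \<phi> where \<phi>: "cutoff_function m F (ball x r) V \<phi>"
      and le: "\<And>f u. f \<in> F \<Longrightarrow> quasi_continuous_modification p m F E f u \<Longrightarrow>
           (\<integral>\<^sup>+y\<in>V. ennreal (\<bar>u y\<bar> powr p) \<partial>\<Gamma> \<phi>)
             \<le> ennreal (C1 * measure (\<Gamma> f) V + C2 / \<Psi> r * (LINT y:V|m. \<bar>f y\<bar> powr p))"
      using cs r unfolding V_def by blast
    have \<phi>F: "\<phi> \<in> F" using \<phi> unfolding cutoff_function_def by blast
    have "closure V \<subseteq> ball x (A * r + 1)"
    proof -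
      have "closure V \<subseteq> cball x (A * r)"
        unfolding V_def by (intro closure_minimal) auto
      then show ?thesis by auto
    qed
    moreover have "compact (closure V)" unfolding V_def by (rule relatively_compact_balls)
    ultimately obtain e where e: "e \<in> core" "\<forall>y\<in>closure V. e y = 1"
      using bump_function[of "closure V" "ball x (A * r + 1)"] by auto
    then have e1: "\<forall>y\<in>V. e y = 1" using closure_subset by blast
    have "ennreal (measure (\<Gamma> \<phi>) V) = emeasure (\<Gamma> \<phi>) V"
      using finite_measure.emeasure_eq_measure[OF finite_\<Gamma>[OF \<phi>F]] by simp
    also have "\<dots> = (\<integral>\<^sup>+y. indicator V y \<partial>\<Gamma> \<phi>)" using \<phi>F by (simp add: V_def)
    also have "\<dots> = (\<integral>\<^sup>+y\<in>V. ennreal (\<bar>e y\<bar> powr p) \<partial>\<Gamma> \<phi>)"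
      using e1 by (intro nn_integral_cong) (auto simp: indicator_def)
    also have "\<dots> \<le> ennreal (C1 * measure (\<Gamma> e) V + C2 / \<Psi> r * (LINT y:V|m. \<bar>e y\<bar> powr p))"
      using e(1) by (intro le quasi_continuous_core) auto
    also have "measure (\<Gamma> e) V = 0" by (rule \<Gamma>_constant[OF e(1) _ e1]) (simp add: V_def)
    also have "(LINT y:V|m. \<bar>e y\<bar> powr p) = (LINT y|m. indicator V y)"
      unfolding set_lebesgue_integral_def using e1 by (intro Bochner_Integration.integral_cong) (auto simp: indicator_def)
    also have "\<dots> = measure m V" by (simp add: V_def)
    finally have "ennreal (measure (\<Gamma> \<phi>) V) \<le> ennreal (C2 / \<Psi> r * measure m V)" by simp
    then have "measure (\<Gamma> \<phi>) V \<le> C2 / \<Psi> r * measure m V"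
      using C(2) \<Psi>[OF r] by (subst (asm) ennreal_le_iff) auto
    then show "\<exists>\<phi>. cutoff_function m F (ball x r) (ball x (A * r)) \<phi> \<and>
        measure (\<Gamma> \<phi>) (ball x (A * r)) \<le> C2 / \<Psi> r * vol x (A * r)"
      using \<phi> unfolding V_def by blast
  qed
qed

text \<open>
  Cutoff functions are only members of the domain, while the calculus of mutual energies concerns the
  core. Replacing a cutoff function by an approximation in the core keeps the energy bound up to a
  factor. The value \<open>1\<close> on the smaller ball is lost, but the mean over this ball stays at least
  \<open>1 / 2\<close>, which suffices.
\<close>

lemma core_cutoff:
  assumes CS: "cutoff_sobolev p m F E \<Gamma> \<Psi>" and \<Psi>: "\<And>r. 0 < r \<Longrightarrow> 0 < \<Psi> r"
  obtains C A where "0 < C" "1 < A"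
    "\<And>x r. 0 < r \<Longrightarrow> \<exists>\<phi>\<in>core. (\<forall>y. 0 \<le> \<phi> y \<and> \<phi> y \<le> 1) \<and> (\<forall>y. y \<notin> ball x (A * r) \<longrightarrow> \<phi> y = 0) \<and>
      measure (\<Gamma> \<phi>) (ball x (A * r)) \<le> C / \<Psi> r * vol x (A * r) \<and>
      vol x r / 2 \<le> (LINT y:ball x r|m. \<phi> y)"
proof -
  obtain C A where C: "0 < C" "1 < A"
    and cut: "\<And>x r. 0 < r \<Longrightarrow> \<exists>\<phi>. cutoff_function m F (ball x r) (ball x (A * r)) \<phi> \<and>
      measure (\<Gamma> \<phi>) (ball x (A * r)) \<le> C / \<Psi> r * vol x (A * r)"
    using cutoff_energy_bound[OF CS \<Psi>] by blast
  define C' where "C' = 2 powr p * (C + C)"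
  show thesis
  proof (rule that[of C' A])
    show "0 < C'" "1 < A" using C by (auto simp: C'_def)
    fix x :: 'a and r :: real assume r: "0 < r"
    define B V where "B = ball x r" and "V = ball x (A * r)"
    have BV: "B \<subseteq> V" using r C(2) by (auto simp: B_def V_def less_le_trans mult_le_cancel_right1)
    obtain \<phi> where cf: "cutoff_function m F B V \<phi>" and \<Gamma>\<phi>: "measure (\<Gamma> \<phi>) V \<le> C / \<Psi> r * measure m V"
      using cut[OF r, of x] unfolding B_def V_def by blast
    have \<phi>: "\<phi> \<in> F" "AE y in m. 0 \<le> \<phi> y \<and> \<phi> y \<le> 1" "supp m \<phi> \<subseteq> V"
      using cf unfolding cutoff_function_def by auto
    obtain W where W: "closure B \<subseteq> W" "AE y in m. y \<in> W \<longrightarrow> \<phi> y = 1"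
      using cf unfolding cutoff_function_def by blast
    have \<phi>B: "AE y in m. y \<in> B \<longrightarrow> \<phi> y = 1" using W(2)
      by eventually_elim (use W(1) closure_subset[of B] in auto)
    have V0: "0 < A * r" using r C by simp
    have mB: "0 < measure m B" and mV: "0 < measure m V"
      unfolding B_def V_def using measure_ball_pos r V0 by auto
    define s where "s = min (C / \<Psi> r * measure m V) (measure m B / (4 * 4 powr p))"
    have s: "0 < s" unfolding s_def using C \<Psi>[OF r] mB mV by simp
    obtain g where g: "g \<in> core" "\<forall>y. y \<notin> V \<longrightarrow> g y = 0" "energy_norm p m E (\<lambda>y. g y - \<phi> y) < s powr (1 / p)"
      using core_approximation_supported[OF \<phi>(1,2) _ _ \<phi>(3), of "s powr (1 / p)"] s unfolding V_def by auto
    have gs: "E (\<lambda>y. g y - \<phi> y) < s" "Lp_energy (\<lambda>y. g y - \<phi> y) < s"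
      using energy_norm_less_imp[OF F_diff g(3)] g(1) \<phi>(1) s p_pos by (auto simp: powr_powr)
    (* Clamping does not increase the total energy, so all of it has to be compared with the part of
       the energy of g in V; there is none outside, because g vanishes there. *)
    define h where "h = (\<lambda>y. max 0 (min 1 (g y)))"
    have h: "h \<in> core" "E h \<le> E g" unfolding h_def by (rule core_clamp[OF g(1)])+
    have h01: "0 \<le> h y" "h y \<le> 1" for y by (auto simp: h_def)
    have habs: "\<bar>h y\<bar> \<le> 1" "\<bar>1 - h y\<bar> \<le> 1" for y using h01[of y] by auto
    have borelV: "V \<in> sets borel" "B \<in> sets borel" by (auto simp: V_def B_def)
    have "measure (\<Gamma> h) V \<le> E h"
      using \<Gamma>_mono[of h UNIV V] measure_\<Gamma>_UNIV[of h] h(1) by simp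
    also have "\<dots> \<le> E g" by (rule h(2))
    also have "E g = measure (\<Gamma> g) (V \<union> - V)" using measure_\<Gamma>_UNIV[of g] g(1) by (simp add: Compl_partition)
    also have "\<dots> = measure (\<Gamma> g) V + measure (\<Gamma> g) (- V)" using borelV g(1) by (intro \<Gamma>_union) auto
    also have "measure (\<Gamma> g) (- V) = 0" using borelV g(2) by (intro \<Gamma>_constant[OF g(1), where c=0]) auto
    also have "measure (\<Gamma> g) V = measure (\<Gamma> (\<lambda>y. \<phi> y + (g y - \<phi> y))) V" by simp
    also have "\<dots> \<le> 2 powr p * (measure (\<Gamma> \<phi>) V + measure (\<Gamma> (\<lambda>y. g y - \<phi> y)) V)"
      using g(1) \<phi>(1) by (intro \<Gamma>_quasi_triangle[OF borelV(1)] F_diff) auto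
    also have "\<dots> \<le> 2 powr p * (C / \<Psi> r * measure m V + C / \<Psi> r * measure m V)"
    proof (intro mult_left_mono add_mono \<Gamma>\<phi>)
      have gF: "(\<lambda>y. g y - \<phi> y) \<in> F" using g(1) \<phi>(1) F_diff by auto
      have "measure (\<Gamma> (\<lambda>y. g y - \<phi> y)) V \<le> E (\<lambda>y. g y - \<phi> y)"
        using \<Gamma>_mono[OF gF, of UNIV V] measure_\<Gamma>_UNIV[OF gF] by simp
      also have "\<dots> \<le> C / \<Psi> r * measure m V" using gs(1) by (simp add: s_def)
      finally show "measure (\<Gamma> (\<lambda>y. g y - \<phi> y)) V \<le> C / \<Psi> r * measure m V" .
    qed simp
    also have "\<dots> = C' / \<Psi> r * measure m V" by (simp add: C'_def field_simps)
    finally have \<Gamma>h: "measure (\<Gamma> h) V \<le> C' / \<Psi> r * measure m V" by simp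
    have intB: "integrable m (\<lambda>y. indicator B y * u y)" if "u \<in> borel_measurable borel" "\<And>y. \<bar>u y\<bar> \<le> 1"
      for u :: "'a \<Rightarrow> real"
    proof (rule Bochner_Integration.integrable_bound[where f="indicator B :: 'a \<Rightarrow> real"])
      show "integrable m (indicator B :: 'a \<Rightarrow> real)"
        using emeasure_bounded_finite[of B] borelV by (simp add: B_def)
      show "(\<lambda>y. indicator B y * u y) \<in> borel_measurable m" using that(1) borelV by (simp add: borel_measurable_m)
      show "AE y in m. norm (indicator B y * u y) \<le> norm (indicator B y :: real)"
        using that(2) by (intro AE_I2) (auto simp: indicator_def)
    qed
    have hm: "h \<in> borel_measurable borel" using h(1) Cc_measurable by blast
    have "measure m B - (LINT y:B|m. h y) = (LINT y|m. indicator B y * (1 - h y))"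
    proof -
      have "(LINT y|m. indicator B y * (1 - h y)) = (LINT y|m. indicator B y * 1 - indicator B y * h y)"
        by (simp add: right_diff_distrib)
      also have "\<dots> = (LINT y|m. indicator B y * 1) - (LINT y|m. indicator B y * h y)"
        using hm habs by (intro Bochner_Integration.integral_diff intB) auto
      finally show ?thesis using borelV by (simp add: set_lebesgue_integral_def)
    qed
    also have "\<dots> \<le> (LINT y|m. indicator B y * (1 / 4) + 4 powr p * \<bar>g y - \<phi> y\<bar> powr p)"
    proof (rule integral_mono_AE)
      show "integrable m (\<lambda>y. indicator B y * (1 - h y))" using hm habs by (intro intB) auto
      have i: "integrable m (\<lambda>y. \<bar>g y - \<phi> y\<bar> powr p)" using g(1) \<phi>(1) by (intro F_integrable F_diff) auto
      show "integrable m (\<lambda>y. indicator B y * (1 / 4) + 4 powr p * \<bar>g y - \<phi> y\<bar> powr p)"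
        using i by (intro Bochner_Integration.integrable_add intB integrable_mult_right) auto
      show "AE y in m. indicator B y * (1 - h y) \<le> indicator B y * (1 / 4) + 4 powr p * \<bar>g y - \<phi> y\<bar> powr p"
        using \<phi>B
      proof eventually_elim
        (* Chebyshev's inequality in pointwise form, with threshold 1 / 4. *)
        case (elim y)
        show ?case
        proof (cases "y \<in> B \<and> 1 / 4 < 1 - h y")
          case True
          then have "1 / 4 \<le> \<bar>g y - \<phi> y\<bar>" using elim by (auto simp: h_def)
          then have "1 \<le> (4 * \<bar>g y - \<phi> y\<bar>) powr p" using p_pos by (intro ge_one_powr_ge_zero) auto
          then have "1 \<le> 4 powr p * \<bar>g y - \<phi> y\<bar> powr p" by (simp add: powr_mult)
          then show ?thesis using True h01(1)[of y] by (simp add: add_increasing)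
        qed (auto simp: indicator_def intro: add_increasing2)
      qed
    qed
    also have "\<dots> = measure m B / 4 + 4 powr p * Lp_energy (\<lambda>y. g y - \<phi> y)"
    proof -
      have i: "integrable m (\<lambda>y. \<bar>g y - \<phi> y\<bar> powr p)" using g(1) \<phi>(1) by (intro F_integrable F_diff) auto
      show ?thesis unfolding Lp_energy_def
        using i borelV intB[of "\<lambda>_. 1 / 4"] by (subst Bochner_Integration.integral_add) auto
    qed
    also have "\<dots> \<le> measure m B / 4 + measure m B / 4"
    proof -
      have "Lp_energy (\<lambda>y. g y - \<phi> y) \<le> measure m B / (4 * 4 powr p)" using gs(2) by (simp add: s_def)
      then have "4 powr p * Lp_energy (\<lambda>y. g y - \<phi> y) \<le> 4 powr p * (measure m B / (4 * 4 powr p))"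
        by (intro mult_left_mono) auto
      then show ?thesis by simp
    qed
    finally have "measure m B / 2 \<le> (LINT y:B|m. h y)" by simp
    moreover have "\<forall>y. y \<notin> V \<longrightarrow> h y = 0" using g(2) by (simp add: h_def)
    ultimately show "\<exists>\<phi>\<in>core. (\<forall>y. 0 \<le> \<phi> y \<and> \<phi> y \<le> 1) \<and> (\<forall>y. y \<notin> ball x (A * r) \<longrightarrow> \<phi> y = 0) \<and>
      measure (\<Gamma> \<phi>) (ball x (A * r)) \<le> C' / \<Psi> r * vol x (A * r) \<and>
      vol x r / 2 \<le> (LINT y:ball x r|m. \<phi> y)"
      using h(1) h01 \<Gamma>h unfolding B_def V_def by (intro bexI[of _ h]) auto
  qed
qed

end

section \<open>Coverings in doubling spaces\<close>

context metric_measure_space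
begin

text \<open>
  The cardinality of a separated subset is bounded by the size of a finite cover with balls of half the
  radius, and a separated subset of maximal cardinality covers.
\<close>

lemma separated_net:
  assumes S: "bounded (S :: 'a set)" and s: "0 < s"
  shows "\<exists>Z. finite Z \<and> Z \<subseteq> S \<and> (\<forall>y\<in>Z. \<forall>z\<in>Z. y \<noteq> z \<longrightarrow> s \<le> dist y z) \<and> S \<subseteq> (\<Union>z\<in>Z. ball z s)"
proof -
  have "compact (closure S)" using S by (intro closed_bounded_compact) auto
  then obtain C where C: "finite C" "closure S \<subseteq> (\<Union>c\<in>C. ball c (s / 2))"
    using compact_imp_seq_compact[THEN seq_compact_imp_totally_bounded, of "closure S"] s by (metis half_gt_zero)
  define sep where "sep Z \<longleftrightarrow> finite Z \<and> Z \<subseteq> S \<and> (\<forall>y\<in>Z. \<forall>z\<in>Z. y \<noteq> z \<longrightarrow> s \<le> dist y z)" for Z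
  have card: "card Z \<le> card C" if Z: "sep Z" for Z
  proof -
    have "\<forall>z\<in>Z. \<exists>c\<in>C. z \<in> ball c (s / 2)"
    proof
      fix z assume "z \<in> Z"
      then have "z \<in> closure S" using Z closure_subset[of S] unfolding sep_def by auto
      then have "z \<in> (\<Union>c\<in>C. ball c (s / 2))" using C(2) by (rule subsetD[rotated])
      then show "\<exists>c\<in>C. z \<in> ball c (s / 2)" by blast
    qed
    then obtain \<kappa> where \<kappa>: "\<And>z. z \<in> Z \<Longrightarrow> \<kappa> z \<in> C \<and> z \<in> ball (\<kappa> z) (s / 2)" by metis
    have "inj_on \<kappa> Z"
    proof (rule inj_onI, rule ccontr)
      fix y z assume yz: "y \<in> Z" "z \<in> Z" "\<kappa> y = \<kappa> z" "y \<noteq> z"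
      have "dist (\<kappa> y) y < s / 2" "dist (\<kappa> y) z < s / 2" using \<kappa>[OF yz(1)] \<kappa>[OF yz(2)] yz(3) by auto
      then have "dist y z < s" using dist_triangle[of y z "\<kappa> y"] by (simp add: dist_commute)
      then show False using Z yz unfolding sep_def by force
    qed
    then show ?thesis using \<kappa> C(1) by (intro card_inj_on_le) auto
  qed
  have "sep {}" by (simp add: sep_def)
  then obtain Z where Z: "sep Z" and max: "\<And>Y. sep Y \<Longrightarrow> card Y \<le> card Z"
    using ex_has_greatest_nat[of sep "{}" card "Suc (card C)"] card by (auto simp: le_imp_less_Suc)
  have "S \<subseteq> (\<Union>z\<in>Z. ball z s)"
  proof (rule ccontr)
    assume "\<not> ?thesis"
    then obtain x where x: "x \<in> S" "x \<notin> (\<Union>z\<in>Z. ball z s)" by blast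
    then have x2: "\<And>z. z \<in> Z \<Longrightarrow> s \<le> dist z x" by (simp add: not_less)
    then have "x \<notin> Z" using s by fastforce
    moreover have "sep (insert x Z)"
      using Z x(1) x2 unfolding sep_def by (auto simp: dist_commute)
    ultimately show False using max[of "insert x Z"] Z unfolding sep_def by simp
  qed
  then show ?thesis using Z unfolding sep_def by (intro exI[of _ Z]) simp
qed

lemma separated_balls_disjoint:
  assumes "\<forall>y\<in>Z. \<forall>z\<in>Z. y \<noteq> z \<longrightarrow> 2 * s \<le> dist y (z :: 'a)"
  shows "disjoint_family_on (\<lambda>z. ball z s) Z"
  unfolding disjoint_family_on_def
proof (intro ballI impI)
  fix y z assume yz: "y \<in> Z" "z \<in> Z" "y \<noteq> z"
  show "ball y s \<inter> ball z s = {}"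
  proof (rule ccontr)
    assume "ball y s \<inter> ball z s \<noteq> {}"
    then obtain w where "dist y w < s" "dist z w < s" by auto
    then have "dist y z < 2 * s" using dist_triangle2[of y z w] by simp
    then show False using assms yz by force
  qed
qed

lemma ball_growth:
  assumes "volume_doubling m"
  obtains K where "\<And>M. 1 \<le> K M" "\<And>M x r. 0 < r \<Longrightarrow> vol x (M * r) \<le> K M * vol x r"
proof -
  obtain C where C: "0 < C" "\<And>x r. 0 < r \<Longrightarrow> vol x (2 * r) \<le> C * vol x r"
    using assms unfolding volume_doubling_def by blast
  have pow: "vol x (2 ^ n * r) \<le> C ^ n * vol x r" if "0 < r" for n x r
  proof (induction n)
    case (Suc n)
    have "vol x (2 ^ Suc n * r) \<le> C * vol x (2 ^ n * r)"
      using C(2)[of "2 ^ n * r" x] that by (simp add: mult.assoc)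
    also have "\<dots> \<le> C * (C ^ n * vol x r)" using Suc C(1) by (intro mult_left_mono) auto
    finally show ?case by (simp add: mult.assoc)
  qed simp
  have "\<exists>k\<ge>1. \<forall>x r. 0 < r \<longrightarrow> vol x (M * r) \<le> k * vol x r" for M
  proof -
    obtain n where n: "M < 2 ^ n" using real_arch_pow[of 2 M] by auto
    have "vol x (M * r) \<le> max 1 (C ^ n) * vol x r" if "0 < r" for x r
    proof -
      have "vol x (M * r) \<le> vol x (2 ^ n * r)"
        using n that by (intro measure_mono_bounded subset_ball) auto
      also have "\<dots> \<le> C ^ n * vol x r" by (rule pow[OF that])
      also have "\<dots> \<le> max 1 (C ^ n) * vol x r" by (intro mult_right_mono) auto
      finally show ?thesis .
    qed
    then show ?thesis by (intro exI[of _ "max 1 (C ^ n)"]) auto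
  qed
  then obtain K where "\<And>M. 1 \<le> K M \<and> (\<forall>x r. 0 < r \<longrightarrow> vol x (M * r) \<le> K M * vol x r)"
    by metis
  then show thesis using that by blast
qed

lemma measure_disjoint_union:
  assumes "finite Z" "disjoint_family_on V Z" "\<And>z. z \<in> Z \<Longrightarrow> V z \<in> sets borel" "\<And>z. z \<in> Z \<Longrightarrow> bounded (V z)"
  shows "(\<Sum>z\<in>Z. measure m (V z)) = measure m (\<Union>z\<in>Z. V z)"
proof (rule measure_finite_Union[symmetric, OF assms(1) _ assms(2)])
  show "V ` Z \<subseteq> sets m" using assms(3) by auto
  show "emeasure m (V z) \<noteq> \<infinity>" if "z \<in> Z" for z
    using emeasure_bounded_finite[OF assms(4)[OF that]] by simp
qed

text \<open>
  A replacement for density points that is uniform in the scale. The centres of balls in which too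
  much of \<open>\<mu> + m\<close> lies outside \<open>K\<close> are covered by finitely many balls, whose total mass is controlled by
  that of a thin neighbourhood of \<open>K\<close> with \<open>K\<close> removed. This mass tends to zero with the radius, so at
  small scales most of \<open>K\<close> is covered by balls around good centres.
\<close>

lemma good_centres:
  fixes \<mu> :: "'a measure"
  assumes \<mu>: "finite_measure \<mu>" "sets \<mu> = sets borel"
    and C: "0 < C" "\<And>x r. 0 < r \<Longrightarrow> vol x (2 * r) \<le> C * vol x r"
    and K: "compact K" "0 < measure m K" and \<epsilon>: "0 < \<epsilon>"
  obtains \<rho>\<^sub>0 where "0 < \<rho>\<^sub>0"
    "\<And>\<rho>. 0 < \<rho> \<Longrightarrow> \<rho> < \<rho>\<^sub>0 \<Longrightarrow> \<exists>Z. finite Z \<and> Z \<subseteq> K \<and> disjoint_family_on (\<lambda>z. ball z \<rho>) Z \<and>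
      (\<forall>z\<in>Z. measure \<mu> (ball z \<rho> - K) + measure m (ball z \<rho> - K) \<le> \<epsilon> * measure m (ball z \<rho>)) \<and>
      measure m K / (2 * C) \<le> (\<Sum>z\<in>Z. measure m (ball z \<rho>))"
proof -
  (* N \<rho> decreases to the empty set as \<rho> tends to zero, because K is closed. *)
  define N where "N \<rho> = (\<Union>x\<in>K. ball x \<rho>) - K" for \<rho>
  define w where "w A = measure \<mu> A + measure m A" for A
  have K': "closed K" "bounded K" "K \<in> sets borel"
    using compact_imp_closed[OF K(1)] compact_imp_bounded[OF K(1)] by auto
  have N_borel: "N \<rho> \<in> sets borel" for \<rho>
    unfolding N_def by (rule sets.Diff[OF borel_open K'(3)]) auto
  have N_bdd: "bounded (N \<rho>)" for \<rho>
  proof -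
    obtain a e where "K \<subseteq> ball a e" using K'(2) bounded_subset_ballD by blast
    then have "N \<rho> \<subseteq> ball a (e + \<rho>)"
      unfolding N_def by (auto simp: subset_iff) (metis add_less_cancel_left add_strict_mono dist_triangle order_le_less_trans)
    then show ?thesis using bounded_subset bounded_ball by blast
  qed
  have N_mono: "N \<rho> \<subseteq> N \<rho>'" if "\<rho> \<le> \<rho>'" for \<rho> \<rho>' unfolding N_def using that by fastforce
  have N_empty: "(\<Inter>n. N (1 / real (Suc n))) = {}"
  proof (rule ccontr)
    assume "\<not> ?thesis"
    then obtain y where y: "\<And>n. y \<in> N (1 / real (Suc n))" by blast
    have "y \<notin> K" using y[of 0] by (simp add: N_def)
    moreover have "y \<in> closure K"
      unfolding closure_approachable
    proof (intro allI impI)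
      fix e :: real assume "0 < e"
      then obtain n where "1 / real (Suc n) < e" using nat_approx_posE by blast
      moreover obtain x where "x \<in> K" "dist x y < 1 / real (Suc n)" using y[of n] by (auto simp: N_def)
      ultimately show "\<exists>x\<in>K. dist x y < e" by (meson less_trans)
    qed
    ultimately show False using K'(1) by simp
  qed
  have dec: "decseq (\<lambda>n. N (1 / real (Suc n)))"
    unfolding decseq_def by (intro allI impI N_mono divide_left_mono) auto
  have "(\<lambda>n. measure \<mu> (N (1 / real (Suc n)))) \<longlonglongrightarrow> measure \<mu> (\<Inter>n. N (1 / real (Suc n)))"
    using N_borel \<mu> dec by (intro finite_measure.finite_Lim_measure_decseq) auto
  moreover have "(\<lambda>n. measure m (N (1 / real (Suc n)))) \<longlonglongrightarrow> measure m (\<Inter>n. N (1 / real (Suc n)))"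
    using N_borel emeasure_bounded_finite[OF N_bdd] dec by (intro Lim_measure_decseq) (auto simp: less_top[symmetric])
  ultimately have "(\<lambda>n. w (N (1 / real (Suc n)))) \<longlonglongrightarrow> 0"
    unfolding w_def N_empty using tendsto_add by fastforce
  moreover have "0 < \<epsilon> * measure m K / (2 * C)" using \<epsilon> K C by simp
  ultimately have "\<forall>\<^sub>F n in sequentially. w (N (1 / real (Suc n))) < \<epsilon> * measure m K / (2 * C)"
    by (rule order_tendstoD(2))
  then obtain n where n: "w (N (1 / real (Suc n))) < \<epsilon> * measure m K / (2 * C)"
    using eventually_happens by force
  show thesis
  proof (rule that[of "1 / real (Suc n)"])
    show "0 < 1 / real (Suc n)" by simp
    fix \<rho> :: real assume \<rho>: "0 < \<rho>" "\<rho> < 1 / real (Suc n)"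
    define good where "good = {x\<in>K. w (ball x \<rho> - K) \<le> \<epsilon> * measure m (ball x \<rho>)}"
    define bad where "bad = {x\<in>K. \<epsilon> * measure m (ball x \<rho>) < w (ball x \<rho> - K)}"
    have sub: "good \<subseteq> K" "bad \<subseteq> K" "K \<subseteq> good \<union> bad" unfolding good_def bad_def by auto
    have bdd: "bounded good" "bounded bad" using sub K'(2) bounded_subset by blast+
    have "0 < 2 * \<rho>" using \<rho> by simp
    obtain Z where Z: "finite Z" "Z \<subseteq> good" "\<forall>y\<in>Z. \<forall>z\<in>Z. y \<noteq> z \<longrightarrow> 2 * \<rho> \<le> dist y z"
      "good \<subseteq> (\<Union>z\<in>Z. ball z (2 * \<rho>))"
      using separated_net[OF bdd(1) \<open>0 < 2 * \<rho>\<close>] by (elim exE conjE) blast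
    obtain Y where Y: "finite Y" "Y \<subseteq> bad" "\<forall>y\<in>Y. \<forall>z\<in>Y. y \<noteq> z \<longrightarrow> 2 * \<rho> \<le> dist y z"
      "bad \<subseteq> (\<Union>z\<in>Y. ball z (2 * \<rho>))"
      using separated_net[OF bdd(2) \<open>0 < 2 * \<rho>\<close>] by (elim exE conjE) blast
    have disjZ: "disjoint_family_on (\<lambda>z. ball z \<rho>) Z" by (rule separated_balls_disjoint[OF Z(3)])
    have disjY: "disjoint_family_on (\<lambda>z. ball z \<rho>) Y" by (rule separated_balls_disjoint[OF Y(3)])
    have union_borel: "(\<Union>z\<in>I. ball z (2 * \<rho>)) \<in> sets borel" for I :: "'a set"
      by (intro borel_open open_UN) auto
    have cover: "measure m (\<Union>z\<in>I. ball z (2 * \<rho>)) \<le> C * (\<Sum>z\<in>I. measure m (ball z \<rho>))" if "finite I" for I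
    proof -
      have "measure m (\<Union>z\<in>I. ball z (2 * \<rho>)) \<le> (\<Sum>z\<in>I. vol z (2 * \<rho>))"
        using that by (intro measure_UNION_le) auto
      also have "\<dots> \<le> (\<Sum>z\<in>I. C * measure m (ball z \<rho>))" using C(2) \<rho>(1) by (intro sum_mono) auto
      finally show ?thesis by (simp add: sum_distrib_left)
    qed
    have "\<epsilon> * (\<Sum>z\<in>Y. measure m (ball z \<rho>)) \<le> (\<Sum>z\<in>Y. w (ball z \<rho> - K))"
      unfolding sum_distrib_left using Y(2) by (intro sum_mono) (auto simp: bad_def)
    also have "\<dots> = w (\<Union>z\<in>Y. ball z \<rho> - K)"
    proof -
      have d: "disjoint_family_on (\<lambda>z. ball z \<rho> - K) Y"
        using disjY unfolding disjoint_family_on_def by blast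
      have "bounded (ball z \<rho> - K)" for z using bounded_subset bounded_ball by blast
      then have "(\<Sum>z\<in>Y. measure m (ball z \<rho> - K)) = measure m (\<Union>z\<in>Y. ball z \<rho> - K)"
        using K' by (intro measure_disjoint_union[OF Y(1) d]) auto
      moreover have "(\<Sum>z\<in>Y. measure \<mu> (ball z \<rho> - K)) = measure \<mu> (\<Union>z\<in>Y. ball z \<rho> - K)"
        using finite_measure.finite_measure_finite_Union[OF \<mu>(1) Y(1) _ d] \<mu>(2) K' by (simp add: image_subset_iff)
      ultimately show ?thesis by (simp add: w_def sum.distrib)
    qed
    also have "\<dots> \<le> w (N (1 / real (Suc n)))"
    proof -
      have "Y \<subseteq> K" using Y(2) sub(2) by simp
      then have "(\<Union>z\<in>Y. ball z \<rho> - K) \<subseteq> N \<rho>" unfolding N_def by auto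
      also have "N \<rho> \<subseteq> N (1 / real (Suc n))" using \<rho>(2) by (intro N_mono) simp
      finally have s: "(\<Union>z\<in>Y. ball z \<rho> - K) \<subseteq> N (1 / real (Suc n))" .
      have b: "(\<Union>z\<in>Y. ball z \<rho> - K) \<in> sets borel"
        using Y(1) K'(3) by (intro sets.finite_UN sets.Diff) auto
      show ?thesis
        unfolding w_def using finite_measure.finite_measure_mono[OF \<mu>(1) s] N_borel N_bdd \<mu>(2) b
        by (intro add_mono measure_mono_bounded[OF s]) auto
    qed
    also note n
    finally have "C * (\<Sum>z\<in>Y. measure m (ball z \<rho>)) \<le> measure m K / 2"
      using \<epsilon> C(1) by (simp add: field_simps)
    moreover have "measure m K \<le> measure m ((\<Union>z\<in>Z. ball z (2 * \<rho>)) \<union> (\<Union>z\<in>Y. ball z (2 * \<rho>)))"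
    proof (rule measure_mono_bounded)
      show "K \<subseteq> (\<Union>z\<in>Z. ball z (2 * \<rho>)) \<union> (\<Union>z\<in>Y. ball z (2 * \<rho>))"
        using sub(3) Z(4) Y(4) by blast
      show "(\<Union>z\<in>Z. ball z (2 * \<rho>)) \<union> (\<Union>z\<in>Y. ball z (2 * \<rho>)) \<in> sets borel"
        by (intro sets.Un union_borel)
    qed (use K' Z(1) Y(1) in auto)
    moreover have "\<dots> \<le> measure m (\<Union>z\<in>Z. ball z (2 * \<rho>)) + measure m (\<Union>z\<in>Y. ball z (2 * \<rho>))"
      using union_borel by (intro measure_Un_le) auto
    ultimately have "measure m K / 2 \<le> C * (\<Sum>z\<in>Z. measure m (ball z \<rho>))"
      using cover[OF Z(1)] cover[OF Y(1)] by linarith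
    then have "measure m K / (2 * C) \<le> (\<Sum>z\<in>Z. measure m (ball z \<rho>))"
      using C(1) by (simp add: field_simps)
    then show "\<exists>Z. finite Z \<and> Z \<subseteq> K \<and> disjoint_family_on (\<lambda>z. ball z \<rho>) Z \<and>
      (\<forall>z\<in>Z. measure \<mu> (ball z \<rho> - K) + measure m (ball z \<rho> - K) \<le> \<epsilon> * measure m (ball z \<rho>)) \<and>
      measure m K / (2 * C) \<le> (\<Sum>z\<in>Z. measure m (ball z \<rho>))"
      using Z sub(1) disjZ unfolding good_def w_def by (intro exI[of _ Z]) auto
  qed
qed

end

section \<open>Oscillation of functions of bounded energy density\<close>

lemma (in metric_measure_space) bounded_set_integrable:
  fixes u :: "'a \<Rightarrow> real"
  assumes "bounded B" "B \<in> sets borel" "u \<in> borel_measurable borel" "\<And>x. \<bar>u x\<bar> \<le> k"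
  shows "set_integrable m B u"
  unfolding set_integrable_def
proof (rule Bochner_Integration.integrable_bound[where f="\<lambda>x. k * indicator B x"])
  show "integrable m (\<lambda>x. k * indicator B x)"
    using emeasure_bounded_finite[OF assms(1)] assms(2) by simp
  show "(\<lambda>x. indicator B x *\<^sub>R u x) \<in> borel_measurable m" using assms(2,3) by (simp add: borel_measurable_m)
  show "AE x in m. norm (indicator B x *\<^sub>R u x) \<le> norm (k * indicator B x)"
    using assms(4) by (intro AE_I2) (auto simp: indicator_def intro: order_trans[OF _ abs_ge_self])
qed

context p_energy
begin

definition deviation :: "('a \<Rightarrow> real) \<Rightarrow> real \<Rightarrow> 'a set \<Rightarrow> real" where
  "deviation f c B = (LINT y:B|m. \<bar>f y - c\<bar> powr p)"

lemma deviation_integrable: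
  assumes f: "f \<in> core" and B: "bounded B" "B \<in> sets borel"
  shows "set_integrable m B (\<lambda>y. \<bar>f y - c\<bar> powr p)"
proof -
  obtain b where b: "0 \<le> b" "\<And>x. \<bar>f x\<bar> \<le> b" using f Cc_bounded by (metis IntE)
  have fm: "f \<in> borel_measurable borel" using f Cc_measurable by blast
  have "\<bar>f x - c\<bar> powr p \<le> (b + \<bar>c\<bar>) powr p" for x
    using b(2)[of x] p_pos by (intro powr_mono2) auto
  then show ?thesis using fm by (intro bounded_set_integrable[OF B, where k="(b + \<bar>c\<bar>) powr p"]) auto
qed

lemma deviation_mono:
  assumes f: "f \<in> core" and B: "A \<subseteq> B" "bounded B" "A \<in> sets borel" "B \<in> sets borel"
  shows "deviation f c A \<le> deviation f c B"
proof -
  have A: "bounded A" using B bounded_subset by blast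
  show ?thesis
    unfolding deviation_def set_lebesgue_integral_def
    using deviation_integrable[OF f A B(3), of c] deviation_integrable[OF f B(2,4), of c] B(1)
    unfolding set_integrable_def by (intro integral_mono) (auto simp: indicator_def)
qed

lemma deviation_cover:
  assumes f: "f \<in> core" and Z: "finite Z" "\<And>z. z \<in> Z \<Longrightarrow> bounded (V z)" "\<And>z. z \<in> Z \<Longrightarrow> V z \<in> sets borel"
    and A: "A \<subseteq> (\<Union>z\<in>Z. V z)" "A \<in> sets borel" "bounded A"
  shows "deviation f c A \<le> (\<Sum>z\<in>Z. deviation f c (V z))"
proof -
  have i: "integrable m (\<lambda>y. indicator (V z) y *\<^sub>R \<bar>f y - c\<bar> powr p)" if "z \<in> Z" for z
    using deviation_integrable[OF f Z(2,3)[OF that]] unfolding set_integrable_def .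
  have "deviation f c A \<le> (LINT y|m. (\<Sum>z\<in>Z. indicator (V z) y *\<^sub>R \<bar>f y - c\<bar> powr p))"
    unfolding deviation_def set_lebesgue_integral_def
  proof (rule integral_mono)
    show "integrable m (\<lambda>y. indicator A y *\<^sub>R \<bar>f y - c\<bar> powr p)"
      using deviation_integrable[OF f A(3,2)] unfolding set_integrable_def .
    show "integrable m (\<lambda>y. \<Sum>z\<in>Z. indicator (V z) y *\<^sub>R \<bar>f y - c\<bar> powr p)"
      using i by (intro Bochner_Integration.integrable_sum) auto
    fix y
    show "indicator A y *\<^sub>R \<bar>f y - c\<bar> powr p \<le> (\<Sum>z\<in>Z. indicator (V z) y *\<^sub>R \<bar>f y - c\<bar> powr p)"
    proof (cases "y \<in> A")
      case True
      then obtain z where z: "z \<in> Z" "y \<in> V z" using A(1) by blast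
      have "indicator (V z) y *\<^sub>R \<bar>f y - c\<bar> powr p \<le> (\<Sum>z\<in>Z. indicator (V z) y *\<^sub>R \<bar>f y - c\<bar> powr p)"
        using z(1) Z(1) by (intro member_le_sum) (auto simp: indicator_def)
      then show ?thesis using True z by simp
    qed (simp add: sum_nonneg)
  qed
  also have "\<dots> = (\<Sum>z\<in>Z. deviation f c (V z))"
    unfolding deviation_def set_lebesgue_integral_def using i by (intro Bochner_Integration.integral_sum) auto
  finally show ?thesis .
qed

lemma const_integral_eq:
  assumes "bounded B" "B \<in> sets borel"
  shows "(LINT y:B|m. k) = k * measure m B"
  using assms(2) unfolding set_lebesgue_integral_def by (simp add: mult.commute)

lemma const_set_integrable:
  assumes "bounded B" "B \<in> sets borel"
  shows "set_integrable m B (\<lambda>_. k :: real)"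
  by (rule bounded_set_integrable[OF assms, where k="\<bar>k\<bar>"]) auto

lemma abs_diff_powr_le: "\<bar>a - c\<bar> powr p \<le> 2 powr p * (\<bar>b - a\<bar> powr p + \<bar>b - c\<bar> powr p)"
proof -
  have "\<bar>a - c\<bar> powr p \<le> (\<bar>b - a\<bar> + \<bar>b - c\<bar>) powr p" using p_pos by (intro powr_mono2) auto
  also have "\<dots> \<le> 2 powr p * (\<bar>b - a\<bar> powr p + \<bar>b - c\<bar> powr p)"
    using p_pos by (intro powr_add_le_two_powr) auto
  finally show ?thesis .
qed

lemma deviation_change_constant:
  assumes f: "f \<in> core" and B: "bounded B" "B \<in> sets borel"
  shows "deviation f c B \<le> 2 powr p * (deviation f a B + \<bar>a - c\<bar> powr p * measure m B)"
proof -
  have "deviation f c B \<le> (LINT y:B|m. 2 powr p * (\<bar>f y - a\<bar> powr p + \<bar>a - c\<bar> powr p))"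
    unfolding deviation_def
  proof (rule set_integral_mono)
    show "set_integrable m B (\<lambda>y. 2 powr p * (\<bar>f y - a\<bar> powr p + \<bar>a - c\<bar> powr p))"
      by (intro set_integrable_mult_right set_integral_add(1) deviation_integrable[OF f B] const_set_integrable[OF B])
    show "\<bar>f y - c\<bar> powr p \<le> 2 powr p * (\<bar>f y - a\<bar> powr p + \<bar>a - c\<bar> powr p)" for y
      using abs_diff_powr_le[of "f y" c a] by (simp add: abs_minus_commute)
  qed (rule deviation_integrable[OF f B])
  also have "\<dots> = 2 powr p * (deviation f a B + \<bar>a - c\<bar> powr p * measure m B)"
    unfolding deviation_def set_integral_mult_right
      set_integral_add(2)[OF deviation_integrable[OF f B] const_set_integrable[OF B]] const_integral_eq[OF B] ..
  finally show ?thesis .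
qed

lemma constants_close:
  assumes f: "f \<in> core" and B: "bounded B" "B \<in> sets borel"
  shows "\<bar>a - c\<bar> powr p * measure m B \<le> 2 powr p * (deviation f a B + deviation f c B)"
proof -
  have "\<bar>a - c\<bar> powr p * measure m B = (LINT y:B|m. \<bar>a - c\<bar> powr p)" using const_integral_eq[OF B] by simp
  also have "\<dots> \<le> (LINT y:B|m. 2 powr p * (\<bar>f y - a\<bar> powr p + \<bar>f y - c\<bar> powr p))"
  proof (rule set_integral_mono)
    show "set_integrable m B (\<lambda>y. 2 powr p * (\<bar>f y - a\<bar> powr p + \<bar>f y - c\<bar> powr p))"
      by (intro set_integrable_mult_right set_integral_add(1) deviation_integrable[OF f B])
    show "set_integrable m B (\<lambda>y. \<bar>a - c\<bar> powr p)" by (rule const_set_integrable[OF B])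
  qed (rule abs_diff_powr_le)
  also have "\<dots> = 2 powr p * (deviation f a B + deviation f c B)"
    unfolding deviation_def set_integral_mult_right
      set_integral_add(2)[OF deviation_integrable[OF f B] deviation_integrable[OF f B]] ..
  finally show ?thesis .
qed

end

lemma ediam_UNIV_ge: "ereal (dist (a :: 'a :: metric_space) b) \<le> ediam (UNIV :: 'a set)"
  unfolding ediam_def by (rule SUP_upper2[of "(a, b)"]) auto

context p_energy_measure
begin

text \<open>
  If the energy density of \<open>f\<close> is bounded at scale \<open>r / l\<close>, then neighbouring averages at
  this scale differ by at most a multiple of \<open>\<Psi> (r / l) powr (1 / p)\<close>, and chains of length
  comparable with \<open>l\<close> connect the points of a ball of radius comparable with \<open>r\<close>.
\<close>

lemma poincare_oscillation:
  assumes VD: "volume_doubling m" and PI: "poincare_inequality p m F \<Gamma> \<Psi>" and A: "1 \<le> A"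
    and \<Psi>: "\<And>r. 0 < r \<Longrightarrow> 0 < \<Psi> r" and two: "\<exists>a b :: 'a. a \<noteq> b"
  obtains Co R Ap r\<^sub>0 where "0 < Co" "A \<le> R" "1 \<le> Ap" "0 < r\<^sub>0"
    "\<forall>f x r l H. f \<in> core \<and> 0 < r \<and> r < r\<^sub>0 \<and> 1 \<le> l \<and> 0 \<le> H \<and>
      (\<forall>z. ball z (Ap * (r / l)) \<subseteq> ball x (R * r) \<longrightarrow>
        measure (\<Gamma> f) (ball z (Ap * (r / l))) \<le> H * vol z (Ap * (r / l))) \<longrightarrow>
      (\<exists>c. deviation f c (ball x (A * r)) \<le> Co * H * (l powr p * \<Psi> (r / l)) * vol x (A * r))"
proof -
  obtain C1 Ap where C1: "0 < C1" "1 \<le> Ap"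
    and pi: "\<forall>x. \<forall>r>0. ereal r < ediam (UNIV :: 'a set) / ereal Ap \<longrightarrow>
        (\<forall>f\<in>F. (LINT y:ball x r|m. \<bar>f y - set_average m (ball x r) f\<bar> powr p)
                  \<le> C1 * \<Psi> r * measure (\<Gamma> f) (ball x (Ap * r)))"
    using PI unfolding poincare_inequality_def by blast
  obtain Cd where Cd: "0 < Cd" "\<forall>(x::'a) y. \<forall>n\<ge>1. \<exists>z::nat \<Rightarrow> 'a. z 0 = x \<and> z n = y \<and>
        (\<forall>k\<in>{1..n}. dist (z k) (z (k - 1)) \<le> Cd * dist x y / real n)"
    using chain_condition unfolding chain_condition_def by blast
  obtain K where K1: "\<And>M. 1 \<le> K M"
    and K: "\<And>M x r. 0 < r \<Longrightarrow> vol x (M * r) \<le> K M * vol x r"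
    using ball_growth[OF VD] by metis
  obtain a b :: 'a where ab: "a \<noteq> b" using two by blast
  define r\<^sub>0 where "r\<^sub>0 = dist a b / Ap"
  define N where "N = 2 * Cd * A + 1"
  define R where "R = N + Ap + A"
  define Co where "Co = 2 powr p * (1 + 2 * 2 powr p * K 4) * N powr p * (K 2 * K 2) * (C1 * K Ap)"
  have N1: "1 \<le> N" using Cd(1) A by (simp add: N_def)
  show thesis
  proof (rule that[of Co R Ap r\<^sub>0])
    have Kpos: "0 < K M" for M using K1[of M] by linarith
    show "0 < Co" unfolding Co_def using C1 N1 Kpos[of 4] Kpos[of 2] Kpos[of Ap]
      by (intro mult_pos_pos add_pos_pos) auto
    show "A \<le> R" "1 \<le> Ap" "0 < r\<^sub>0" using N1 C1 ab by (auto simp: R_def r\<^sub>0_def)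
  next
    show "\<forall>f x r l H. f \<in> core \<and> 0 < r \<and> r < r\<^sub>0 \<and> 1 \<le> l \<and> 0 \<le> H \<and>
      (\<forall>z. ball z (Ap * (r / l)) \<subseteq> ball x (R * r) \<longrightarrow>
        measure (\<Gamma> f) (ball z (Ap * (r / l))) \<le> H * vol z (Ap * (r / l))) \<longrightarrow>
      (\<exists>c. deviation f c (ball x (A * r)) \<le> Co * H * (l powr p * \<Psi> (r / l)) * vol x (A * r))"
    proof (intro allI impI, elim conjE)
    fix f :: "'a \<Rightarrow> real" and x :: 'a and r l H :: real
    assume f: "f \<in> core" and r: "0 < r" "r < r\<^sub>0" and l: "1 \<le> l" and H: "0 \<le> H"
      and dens: "\<forall>z. ball z (Ap * (r / l)) \<subseteq> ball x (R * r) \<longrightarrow>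
        measure (\<Gamma> f) (ball z (Ap * (r / l))) \<le> H * vol z (Ap * (r / l))"
    define s where "s = r / l"
    have s: "0 < s" "s \<le> r" "l * s = r" using r(1) l by (auto simp: s_def field_simps mult_left_le)
    have Kpos: "0 < K M" for M using K1[of M] by linarith
    (* Averages over balls of radius s = r / l; G bounds their mean deviations. *)
    define av where "av z = set_average m (ball z s) f" for z
    define G where "G = C1 * K Ap * H * \<Psi> s"
    have G: "0 \<le> G" unfolding G_def using C1 Kpos[of Ap] H \<Psi>[OF s(1)] by simp
    have small: "ereal s < ediam (UNIV :: 'a set) / ereal Ap"
    proof -
      have "s < dist a b / Ap" using s r unfolding r\<^sub>0_def by simp
      then have "ereal s < ereal (dist a b) / ereal Ap" using C1(2) by simp
      also have "\<dots> \<le> ediam (UNIV :: 'a set) / ereal Ap"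
        using C1(2) by (intro ereal_divide_right_mono ediam_UNIV_ge) simp
      finally show ?thesis .
    qed
    have local_dev: "deviation f (av z) (ball z s) \<le> G * vol z s"
      if "ball z (Ap * s) \<subseteq> ball x (R * r)" for z
    proof -
      have "deviation f (av z) (ball z s) \<le> C1 * \<Psi> s * measure (\<Gamma> f) (ball z (Ap * s))"
        unfolding deviation_def av_def using pi small s(1) f by blast
      also have "\<dots> \<le> C1 * \<Psi> s * (H * (K Ap * vol z s))"
      proof (intro mult_left_mono)
        have "measure (\<Gamma> f) (ball z (Ap * s)) \<le> H * vol z (Ap * s)"
          using dens that unfolding s_def by blast
        also have "\<dots> \<le> H * (K Ap * vol z s)" using K[OF s(1)] H by (intro mult_left_mono)
        finally show "measure (\<Gamma> f) (ball z (Ap * s)) \<le> H * (K Ap * vol z s)" .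
      qed (use C1 \<Psi>[OF s(1)] in auto)
      finally show ?thesis by (simp add: G_def ac_simps)
    qed
    define D where "D = 2 * 2 powr p * K 4 * G"
    have D: "0 \<le> D" unfolding D_def using Kpos[of 4] G by simp
    have step: "\<bar>av y - av z\<bar> \<le> D powr (1 / p)"
      if y: "ball y (Ap * s) \<subseteq> ball x (R * r)" and z: "ball z (Ap * s) \<subseteq> ball x (R * r)"
        and yz: "dist y z \<le> s / 2" for y z
    proof -
      define B where "B = ball z (s / 2)"
      have By: "B \<subseteq> ball y s"
      proof
        fix w assume "w \<in> B"
        then have "dist z w < s / 2" by (simp add: B_def)
        then show "w \<in> ball y s" using dist_triangle[of y w z] yz by simp
      qed
      have Bz: "B \<subseteq> ball z s" unfolding B_def using s(1) by (intro subset_ball) simp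
      have yB: "ball y s \<subseteq> ball z (4 * (s / 2))"
      proof
        fix w assume "w \<in> ball y s"
        then have "dist y w < s" by simp
        then show "w \<in> ball z (4 * (s / 2))" using dist_triangle[of z w y] yz s(1) by (simp add: dist_commute)
      qed
      have zB: "ball z s \<subseteq> ball z (4 * (s / 2))" using s(1) by (intro subset_ball) simp
      have growth: "vol y s \<le> K 4 * measure m B" "vol z s \<le> K 4 * measure m B"
        unfolding B_def using s(1)
        by (intro order_trans[OF measure_mono_bounded[OF yB] K] order_trans[OF measure_mono_bounded[OF zB] K]; simp)+
      have mB: "0 < measure m B" unfolding B_def using s(1) by (intro measure_ball_pos) simp
      have "\<bar>av y - av z\<bar> powr p * measure m B \<le> 2 powr p * (deviation f (av y) B + deviation f (av z) B)"
        by (rule constants_close[OF f]) (auto simp: B_def)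
      also have "\<dots> \<le> 2 powr p * (G * (K 4 * measure m B) + G * (K 4 * measure m B))"
      proof (intro mult_left_mono add_mono)
        have "deviation f (av y) B \<le> deviation f (av y) (ball y s)"
          using By by (intro deviation_mono[OF f]) (auto simp: B_def)
        also have "\<dots> \<le> G * vol y s" by (rule local_dev[OF y])
        also have "\<dots> \<le> G * (K 4 * measure m B)" using growth(1) G by (rule mult_left_mono)
        finally show "deviation f (av y) B \<le> G * (K 4 * measure m B)" .
        have "deviation f (av z) B \<le> deviation f (av z) (ball z s)"
          using Bz by (intro deviation_mono[OF f]) (auto simp: B_def)
        also have "\<dots> \<le> G * vol z s" by (rule local_dev[OF z])
        also have "\<dots> \<le> G * (K 4 * measure m B)" using growth(2) G by (rule mult_left_mono)
        finally show "deviation f (av z) B \<le> G * (K 4 * measure m B)" .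
      qed simp
      also have "\<dots> = D * measure m B" by (simp add: D_def algebra_simps)
      finally have "\<bar>av y - av z\<bar> powr p \<le> D" using mB by simp
      then have "(\<bar>av y - av z\<bar> powr p) powr (1 / p) \<le> D powr (1 / p)" using p_pos by (intro powr_mono2) auto
      then show ?thesis using p_pos by (simp add: powr_powr)
    qed
    (* With n links, the steps of a chain inside the ball of radius A * r are at most s / 2. *)
    define n where "n = nat \<lceil>2 * Cd * A * l\<rceil>"
    have n: "2 * Cd * A * l \<le> real n" "real n \<le> N * l" "1 \<le> n"
    proof -
      have pos: "0 < 2 * Cd * A * l" using Cd(1) A l by simp
      show le: "2 * Cd * A * l \<le> real n" unfolding n_def by linarith
      have "real n \<le> 2 * Cd * A * l + 1" unfolding n_def using pos by linarith
      also have "\<dots> \<le> N * l" using l by (simp add: N_def algebra_simps)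
      finally show "real n \<le> N * l" .
      show "1 \<le> n" using le pos by (cases n) auto
    qed
    have avg: "\<bar>av x - av z\<bar> \<le> real n * D powr (1 / p) \<and> ball z (Ap * s) \<subseteq> ball x (R * r)"
      if z: "z \<in> ball x (A * r)" for z
    proof -
      obtain w where w: "w 0 = x" "w n = z"
        and wk: "\<And>k. k \<in> {1..n} \<Longrightarrow> dist (w k) (w (k - 1)) \<le> Cd * dist x z / real n"
        using Cd(2) n(3) by blast
      have len: "Cd * dist x z / real n \<le> s / 2"
      proof -
        have "Cd * dist x z \<le> Cd * (A * r)" using z Cd(1) by (intro mult_left_mono) auto
        also have "\<dots> = (2 * Cd * A * l) * (s / 2)" using s(3) by (simp add: field_simps)
        also have "\<dots> \<le> real n * (s / 2)" using n(1) s(1) by (intro mult_right_mono) auto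
        finally show ?thesis using n(3) by (simp add: field_simps)
      qed
      have hop: "dist (w (Suc k)) (w k) \<le> s / 2" if "Suc k \<le> n" for k
        using order_trans[OF wk[of "Suc k"] len] that by simp
      have near: "dist x (w k) \<le> real k * (s / 2)" if "k \<le> n" for k
        using that
      proof (induction k)
        case (Suc k)
        then have "dist (w (Suc k)) (w k) \<le> s / 2" by (intro hop)
        then show ?case using Suc dist_triangle[of x "w (Suc k)" "w k"] by (simp add: dist_commute algebra_simps)
      qed (simp add: w)
      have inside: "ball (w k) (Ap * s) \<subseteq> ball x (R * r)" if "k \<le> n" for k
      proof
        fix y assume "y \<in> ball (w k) (Ap * s)"
        then have "dist (w k) y < Ap * s" by simp
        then have "dist x y < real k * (s / 2) + Ap * s"
          using near[OF that] dist_triangle[of x y "w k"] by linarith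
        also have "\<dots> \<le> (N * l) * (s / 2) + Ap * r"
          using that n(2) s C1(2) by (intro add_mono mult_right_mono mult_left_mono) auto
        also have "\<dots> = N / 2 * r + Ap * r" using s(3) by (simp add: field_simps)
        also have "\<dots> \<le> R * r" using r N1 A by (simp add: R_def algebra_simps)
        finally show "y \<in> ball x (R * r)" by simp
      qed
      have "\<bar>av x - av (w k)\<bar> \<le> real k * D powr (1 / p)" if "k \<le> n" for k
        using that
      proof (induction k)
        case (Suc k)
        have "dist (w k) (w (Suc k)) \<le> s / 2" using hop[of k] Suc.prems by (simp add: dist_commute)
        then have "\<bar>av (w k) - av (w (Suc k))\<bar> \<le> D powr (1 / p)"
          using Suc by (intro step inside) auto
        then show ?case using Suc by (simp add: algebra_simps)
      qed (simp add: w)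
      from this[of n] inside[of n] show ?thesis by (simp add: w)
    qed
    define V where "V = ball x (A * r)"
    have Vb: "bounded V" "V \<in> sets borel" by (auto simp: V_def)
    obtain Z where Z: "finite Z" "Z \<subseteq> V" "\<forall>y\<in>Z. \<forall>z\<in>Z. y \<noteq> z \<longrightarrow> s \<le> dist y z" "V \<subseteq> (\<Union>z\<in>Z. ball z s)"
      using separated_net[OF Vb(1) s(1)] by (elim exE conjE) blast
    have each: "deviation f (av x) (ball z s) \<le> 2 powr p * (1 + 2 * 2 powr p * K 4) * (N powr p * l powr p) * G * vol z s"
      if "z \<in> Z" for z
    proof -
      have zV: "z \<in> ball x (A * r)" using that Z(2) by (auto simp: V_def)
      have "\<bar>av z - av x\<bar> powr p \<le> (N * l * D powr (1 / p)) powr p"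
      proof (intro powr_mono2)
        have "real n * D powr (1 / p) \<le> N * l * D powr (1 / p)" using n(2) by (intro mult_right_mono) auto
        then show "\<bar>av z - av x\<bar> \<le> N * l * D powr (1 / p)" using avg[OF zV] by (simp add: abs_minus_commute)
      qed (use p_pos in auto)
      also have "\<dots> = N powr p * l powr p * D" using D p_pos by (simp add: powr_mult powr_powr)
      finally have d: "\<bar>av z - av x\<bar> powr p \<le> N powr p * l powr p * D" .
      have "1 * 1 \<le> N powr p * l powr p"
        using N1 l p_pos by (intro mult_mono ge_one_powr_ge_zero) auto
      then have GN: "G \<le> N powr p * l powr p * G" using G by (simp add: mult_le_cancel_right1)
      have "deviation f (av x) (ball z s)
          \<le> 2 powr p * (deviation f (av z) (ball z s) + \<bar>av z - av x\<bar> powr p * vol z s)"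
        by (rule deviation_change_constant[OF f]) auto
      also have "\<dots> \<le> 2 powr p * (G * vol z s + N powr p * l powr p * D * vol z s)"
        using local_dev avg[OF zV] d by (intro mult_left_mono add_mono mult_right_mono) auto
      also have "\<dots> = 2 powr p * ((G + N powr p * l powr p * D) * vol z s)"
        by (simp add: algebra_simps)
      also have "\<dots> \<le> 2 powr p * ((N powr p * l powr p * G + N powr p * l powr p * D) * vol z s)"
        using GN by (intro mult_left_mono mult_right_mono) auto
      also have "\<dots> = 2 powr p * (1 + 2 * 2 powr p * K 4) * (N powr p * l powr p) * G * vol z s"
        by (simp add: D_def algebra_simps)
      finally show ?thesis .
    qed
    have "(\<Sum>z\<in>Z. vol z s) \<le> K 2 * K 2 * measure m V"
    proof -
      have d: "disjoint_family_on (\<lambda>z. ball z (s / 2)) Z" using Z(3) by (intro separated_balls_disjoint) simp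
      have "(\<Sum>z\<in>Z. vol z s) \<le> (\<Sum>z\<in>Z. K 2 * vol z (s / 2))"
        using K[of "s / 2" _ 2] s(1) by (intro sum_mono) simp
      also have "\<dots> = K 2 * (\<Sum>z\<in>Z. vol z (s / 2))" by (simp add: sum_distrib_left)
      also have "(\<Sum>z\<in>Z. vol z (s / 2)) = measure m (\<Union>z\<in>Z. ball z (s / 2))"
        by (intro measure_disjoint_union[OF Z(1) d]) auto
      also have "K 2 * \<dots> \<le> K 2 * vol x (2 * (A * r))"
      proof (intro mult_left_mono measure_mono_bounded)
        show "(\<Union>z\<in>Z. ball z (s / 2)) \<subseteq> ball x (2 * (A * r))"
        proof
          fix y assume "y \<in> (\<Union>z\<in>Z. ball z (s / 2))"
          then obtain z where z: "z \<in> Z" "dist z y < s / 2" by auto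
          then have "dist x z < A * r" using Z(2) by (auto simp: V_def)
          moreover have "r \<le> A * r" using r(1) A by (simp add: mult_le_cancel_right1)
          ultimately have "dist x y < 2 * (A * r)" using z(2) s(1,2) dist_triangle[of x y z] by linarith
          then show "y \<in> ball x (2 * (A * r))" by simp
        qed
        show "(\<Union>z\<in>Z. ball z (s / 2)) \<in> sets borel" by (intro borel_open open_UN) auto
      qed (use Kpos[of 2] in auto)
      also have "\<dots> \<le> K 2 * (K 2 * measure m V)"
        unfolding V_def using Kpos[of 2] r A by (intro mult_left_mono K) auto
      finally show ?thesis by simp
    qed
    note total = this
    have "deviation f (av x) V \<le> (\<Sum>z\<in>Z. deviation f (av x) (ball z s))"
      using Z(1,4) Vb by (intro deviation_cover[OF f]) auto
    also have "\<dots> \<le> (\<Sum>z\<in>Z. 2 powr p * (1 + 2 * 2 powr p * K 4) * (N powr p * l powr p) * G * vol z s)"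
      by (rule sum_mono) (rule each)
    also have "\<dots> = 2 powr p * (1 + 2 * 2 powr p * K 4) * (N powr p * l powr p) * G * (\<Sum>z\<in>Z. vol z s)"
      by (simp add: sum_distrib_left)
    also have "\<dots> \<le> 2 powr p * (1 + 2 * 2 powr p * K 4) * (N powr p * l powr p) * G * (K 2 * K 2 * measure m V)"
      using total G Kpos[of 4] by (intro mult_left_mono) auto
    also have "\<dots> = Co * H * (l powr p * \<Psi> s) * measure m V"
      by (simp add: Co_def G_def)
    finally show "\<exists>c. deviation f c (ball x (A * r)) \<le> Co * H * (l powr p * \<Psi> (r / l)) * vol x (A * r)"
      unfolding V_def s_def by blast
    qed
  qed
qed

end

section \<open>Comparable measures\<close>

context metric_measure_space
begin

lemma set_integral_le_of_measure_le:
  fixes \<mu> :: "'a measure"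
  assumes \<mu>: "finite_measure \<mu>" "sets \<mu> = sets borel" and a: "0 \<le> a"
    and S: "S \<in> sets borel" "bounded S"
    and le: "\<And>B. B \<in> sets borel \<Longrightarrow> B \<subseteq> S \<Longrightarrow> a * measure m B \<le> measure \<mu> B"
    and u: "u \<in> borel_measurable borel" "\<And>x. 0 \<le> u x" "\<And>x. u x \<le> k"
  shows "a * (LINT x:S|m. u x) \<le> (LINT x:S|\<mu>. u x)"
proof -
  note dm = density_indicator[OF sets_m S(1) emeasure_bounded_finite[OF S(2)]]
  have "emeasure \<mu> S < \<infinity>" using finite_measure.emeasure_finite[OF \<mu>(1)] by (simp add: less_top[symmetric])
  note d\<mu> = density_indicator[OF \<mu>(2) S(1) this]
  have "(\<Sum>(c, M)\<leftarrow>[(a, density m (indicator S))]. c * (\<integral>x. u x \<partial>M))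
      \<le> (\<Sum>(c, M)\<leftarrow>[(1, density \<mu> (indicator S))]. c * (\<integral>x. u x \<partial>M))"
  proof (rule integral_mono_combination[where S=borel and k=k])
    fix B :: "'a set" assume B: "B \<in> sets borel"
    have "measure (density m (indicator S)) B = measure m (S \<inter> B)"
      "measure (density \<mu> (indicator S)) B = measure \<mu> (S \<inter> B)"
      using dm(2)[OF B] d\<mu>(2)[OF B] by (simp_all add: measure_def)
    then show "(\<Sum>(c, M)\<leftarrow>[(a, density m (indicator S))]. c * measure M B)
        \<le> (\<Sum>(c, M)\<leftarrow>[(1, density \<mu> (indicator S))]. c * measure M B)"
      using le[of "S \<inter> B"] B S(1) by simp
  qed (use dm(1) d\<mu>(1) a \<mu>(2) u in auto)
  then show ?thesis using dm(3)[OF u(1)] d\<mu>(3)[OF u(1)] by simp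
qed

text \<open>
  Hahn decompositions of \<open>\<mu>\<close> against the multiples \<open>m / n\<close> and \<open>n m\<close> split \<open>K\<close> into an \<open>m\<close>-null
  set, a \<open>\<mu>\<close>-null set, and countably many pieces on which the two measures are comparable.
\<close>

lemma comparable_on_compact:
  fixes \<mu> :: "'a measure"
  assumes \<mu>: "finite_measure \<mu>" "sets \<mu> = sets borel" and K: "compact K" "emeasure \<mu> (- K) = 0"
    and ns: "\<not> mutually_singular \<mu> m"
  obtains K\<^sub>0 a D where "compact K\<^sub>0" "0 < measure m K\<^sub>0" "0 < a" "0 \<le> D"
    "\<And>B. B \<in> sets borel \<Longrightarrow> B \<subseteq> K\<^sub>0 \<Longrightarrow> a * measure m B \<le> measure \<mu> B \<and> measure \<mu> B \<le> D * measure m B"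
proof -
  have Kb: "K \<in> sets borel" "bounded K" using compact_imp_closed[OF K(1)] compact_imp_bounded[OF K(1)] by auto
  have fin\<mu>: "emeasure \<mu> X \<noteq> top" for X using finite_measure.emeasure_finite[OF \<mu>(1)] by simp
  have finm: "emeasure m X \<noteq> top" if "X \<subseteq> K" for X
    using emeasure_bounded_finite[OF bounded_subset[OF Kb(2) that]] by simp
  have scale: "emeasure (scale_measure c m) X = c * emeasure m X" for c X by simp
  have "\<exists>Y\<in>sets borel. Y \<subseteq> K \<and> (\<forall>X\<in>sets borel. X \<subseteq> Y \<longrightarrow> ennreal c * emeasure m X \<le> emeasure \<mu> X) \<and>
      (\<forall>X\<in>sets borel. X \<subseteq> K \<longrightarrow> X \<inter> Y = {} \<longrightarrow> emeasure \<mu> X \<le> ennreal c * emeasure m X)" for c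
    using unsigned_Hahn_decomposition[of "scale_measure (ennreal c) m" \<mu> K] \<mu>(2) Kb fin\<mu> finm[of K]
    by (simp add: scale ennreal_mult_eq_top_iff)
  then obtain Y where Y: "\<And>c. Y c \<in> sets borel" "\<And>c. Y c \<subseteq> K"
    and Y1: "\<And>c X. X \<in> sets borel \<Longrightarrow> X \<subseteq> Y c \<Longrightarrow> ennreal c * emeasure m X \<le> emeasure \<mu> X"
    and Y2: "\<And>c X. X \<in> sets borel \<Longrightarrow> X \<subseteq> K \<Longrightarrow> X \<inter> Y c = {} \<Longrightarrow> emeasure \<mu> X \<le> ennreal c * emeasure m X"
    by metis
  (* On lo n the measure \<mu> is at least m / (n + 1), off hi n it is at most (n + 1) m. *)
  define lo where "lo n = Y (1 / real (Suc n))" for n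
  define hi where "hi n = Y (real (Suc n))" for n
  define P where "P n k = lo n \<inter> (K - hi k)" for n k
  have borel: "lo n \<in> sets borel" "hi n \<in> sets borel" "P n k \<in> sets borel" for n k
    using Y(1) Kb by (auto simp: lo_def hi_def P_def)
  define N where "N = (\<Inter>n. hi n)"
  have "N \<in> sets borel" using borel(2) by (simp add: N_def)
  moreover have "N \<subseteq> hi 0" unfolding N_def by blast
  then have "N \<subseteq> K" using Y(2)[of "real (Suc 0)"] unfolding hi_def by (rule subset_trans)
  ultimately have N: "N \<in> sets borel" "N \<subseteq> K" by auto
  have N0: "emeasure m N = 0"
  proof (rule ccontr)
    assume "\<not> ?thesis"
    then have pos: "0 < measure m N"
      using emeasure_bounded_eq[OF bounded_subset[OF Kb(2) N(2)]] by (auto simp: zero_less_measure_iff)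
    obtain n where n: "measure \<mu> N / measure m N < real (Suc n)"
    proof -
      obtain n0 where "measure \<mu> N / measure m N < real n0" using reals_Archimedean2 by blast
      then show thesis using that[of n0] by simp
    qed
    have "ennreal (real (Suc n)) * emeasure m N \<le> emeasure \<mu> N"
      using N by (intro Y1) (auto simp: N_def hi_def)
    then have "ennreal (real (Suc n) * measure m N) \<le> ennreal (measure \<mu> N)"
      using emeasure_bounded_eq[OF bounded_subset[OF Kb(2) N(2)]] finite_measure.emeasure_eq_measure[OF \<mu>(1)]
      by (simp add: ennreal_mult)
    then have "real (Suc n) * measure m N \<le> measure \<mu> N" by simp
    then show False using n pos by (simp add: field_simps)
  qed
  define L where "L = K - (\<Union>n. lo n)"
  have L: "L \<in> sets borel" "L \<subseteq> K" using borel Kb by (auto simp: L_def)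
  have L0: "emeasure \<mu> L = 0"
  proof -
    have le: "measure \<mu> L \<le> 1 / real (Suc n) * measure m L" for n
    proof -
      have "emeasure \<mu> L \<le> ennreal (1 / real (Suc n)) * emeasure m L"
        using L by (intro Y2) (auto simp: L_def lo_def)
      then have "ennreal (measure \<mu> L) \<le> ennreal (1 / real (Suc n) * measure m L)"
        unfolding emeasure_bounded_eq[OF bounded_subset[OF Kb(2) L(2)]] finite_measure.emeasure_eq_measure[OF \<mu>(1)]
        by (subst ennreal_mult) auto
      then show ?thesis by (subst (asm) ennreal_le_iff) auto
    qed
    have "(\<lambda>n. 1 / real (Suc n) * measure m L) \<longlonglongrightarrow> 0 * measure m L"
      using LIMSEQ_inverse_real_of_nat by (intro tendsto_mult tendsto_const) (simp add: inverse_eq_divide)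
    then have "measure \<mu> L \<le> 0 * measure m L"
      using le by (intro LIMSEQ_le_const) auto
    then show ?thesis using finite_measure.emeasure_eq_measure[OF \<mu>(1)] by (simp add: measure_le_0_iff)
  qed
  have "\<exists>n k. emeasure m (P n k) \<noteq> 0"
  proof (rule ccontr)
    assume "\<not> ?thesis"
    then have "P n k \<in> null_sets m" for n k using borel by (auto simp: null_sets_def)
    then have U: "(\<Union>n. \<Union>k. P n k) \<in> null_sets m" by (intro null_sets_UN') auto
    define Q where "Q = (\<Union>n. \<Union>k. P n k) \<union> N"
    have "N \<in> null_sets m" using N0 N by (auto simp: null_sets_def)
    then have "Q \<in> null_sets m" unfolding Q_def using U by (intro null_sets.Un)
    then have Q: "Q \<in> sets borel" "emeasure m Q = 0" by (auto simp: null_sets_def)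
    have "- Q \<subseteq> - K \<union> L" unfolding Q_def P_def N_def L_def by blast
    then have "emeasure \<mu> (- Q) \<le> emeasure \<mu> (- K) + emeasure \<mu> L"
      using \<mu>(2) Kb L by (intro order_trans[OF emeasure_mono emeasure_subadditive]) auto
    then have "emeasure \<mu> (- Q) = 0" using K(2) L0 by simp
    then have "mutually_singular \<mu> m"
      unfolding mutually_singular_def using Q \<mu>(2) by (intro bexI[of _ "- Q"]) auto
    then show False using ns by simp
  qed
  then obtain n k where nk: "emeasure m (P n k) \<noteq> 0" by blast
  note dK = density_indicator[OF sets_m Kb(1) emeasure_bounded_finite[OF Kb(2)]]
  have "0 < emeasure m (P n k)" using nk by (simp add: zero_less_iff_neq_zero)
  also have "emeasure m (P n k) = emeasure (density m (indicator K)) (P n k)"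
    unfolding dK(2)[OF borel(3)] by (intro arg_cong[where f="emeasure m"]) (auto simp: P_def)
  also have "\<dots> = (SUP C\<in>{C. C \<subseteq> P n k \<and> compact C}. emeasure (density m (indicator K)) C)"
    using finite_measure.emeasure_finite[OF dK(1)] borel by (intro inner_regular) auto
  finally obtain K\<^sub>0 where K0: "K\<^sub>0 \<subseteq> P n k" "compact K\<^sub>0" "0 < emeasure (density m (indicator K)) K\<^sub>0"
    by (auto simp: less_SUP_iff)
  have K0b: "K\<^sub>0 \<in> sets borel" "bounded K\<^sub>0" using compact_imp_closed[OF K0(2)] compact_imp_bounded[OF K0(2)] by auto
  have "K \<inter> K\<^sub>0 = K\<^sub>0" using K0(1) by (auto simp: P_def)
  then have "0 < emeasure m K\<^sub>0" using K0(3) dK(2)[OF K0b(1)] by simp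
  then have m0: "0 < measure m K\<^sub>0" using emeasure_bounded_eq[OF K0b(2)] by (auto simp: zero_less_measure_iff)
  show thesis
  proof (rule that[OF K0(2) m0, of "1 / real (Suc n)" "real (Suc k)"])
    fix B :: "'a set" assume B: "B \<in> sets borel" "B \<subseteq> K\<^sub>0"
    have em: "emeasure m B = ennreal (measure m B)" "emeasure \<mu> B = ennreal (measure \<mu> B)"
      using emeasure_bounded_eq[OF bounded_subset[OF K0b(2) B(2)]] finite_measure.emeasure_eq_measure[OF \<mu>(1)] by auto
    have "ennreal (1 / real (Suc n)) * emeasure m B \<le> emeasure \<mu> B"
      using B K0(1) by (intro Y1) (auto simp: P_def lo_def)
    then have "ennreal (1 / real (Suc n) * measure m B) \<le> ennreal (measure \<mu> B)"
      unfolding em by (subst ennreal_mult) auto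
    moreover have "emeasure \<mu> B \<le> ennreal (real (Suc k)) * emeasure m B"
      using B K0(1) by (intro Y2) (auto simp: P_def hi_def)
    then have "ennreal (measure \<mu> B) \<le> ennreal (real (Suc k) * measure m B)"
      unfolding em by (subst ennreal_mult) auto
    ultimately show "1 / real (Suc n) * measure m B \<le> measure \<mu> B \<and> measure \<mu> B \<le> real (Suc k) * measure m B"
      by (simp only: ennreal_le_iff[OF measure_nonneg] ennreal_le_iff[OF mult_nonneg_nonneg[OF of_nat_0_le_iff measure_nonneg]] simp_thms)
  qed auto
qed

end

context p_energy_measure
begin

section \<open>Singularity for the core\<close>

text \<open>
  The lower bound for the first variation in terms of quantities that can be estimated: what is lost of the
  mean of \<open>\<phi>\<close> lies outside of \<open>K\<close> or where \<open>f\<close> is far from \<open>c\<close>, and the measure of the latter set is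
  bounded by Chebyshev's inequality.
\<close>

lemma test_function_on_good_ball:
  assumes f: "f \<in> core" and \<phi>: "\<phi> \<in> core" "\<And>x. 0 \<le> \<phi> x" "\<And>x. \<phi> x \<le> 1"
    and V: "V \<in> sets borel" "bounded V" "\<And>x. x \<notin> V \<Longrightarrow> \<phi> x = 0"
    and K: "K \<in> sets borel" and a: "0 \<le> a"
    and le: "\<And>B. B \<in> sets borel \<Longrightarrow> B \<subseteq> K \<Longrightarrow> a * measure m B \<le> measure (\<Gamma> f) B"
    and t: "0 < t" and k: "0 < k"
  shows "mutual f (test_function t c f \<phi>) UNIV
    \<ge> a * ((LINT y:V|m. \<phi> y) - measure m (V - K) - deviation f c V / t powr p)
      - 3 * t * (2 powr p / k * measure (\<Gamma> f) V + 2 powr p * k powr (p - 1) * measure (\<Gamma> \<phi>) V)"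
proof -
  define G where "G = {x. \<bar>f x - c\<bar> < t}"
  have G: "G \<in> sets borel" unfolding G_def by (rule core_sublevel_borel[OF f])
  (* On S the measure \<Gamma> f dominates a m, and the truncation has derivative one. *)
  define S where "S = V \<inter> G \<inter> K"
  have S: "S \<in> sets borel" "bounded S" "S \<subseteq> K" unfolding S_def using V G K by (auto intro: bounded_subset)
  have \<phi>m: "\<phi> \<in> borel_measurable borel" using \<phi>(1) Cc_measurable by blast
  have abs\<phi>: "\<bar>\<phi> x\<bar> \<le> 1" for x using \<phi>(2,3)[of x] by simp
  have fF: "f \<in> F" using f by simp
  have VK: "V - K \<in> sets borel" "bounded (V - K)" using V K by (auto intro: bounded_subset)
  have iV: "integrable m (\<lambda>y. indicator V y *\<^sub>R \<phi> y)" and iS: "integrable m (\<lambda>y. indicator S y *\<^sub>R \<phi> y)"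
    and iVK: "integrable m (\<lambda>y. indicator (V - K) y *\<^sub>R (1 :: real))"
    using bounded_set_integrable[OF V(2,1) \<phi>m abs\<phi>] bounded_set_integrable[OF S(2,1) \<phi>m abs\<phi>]
      const_set_integrable[OF VK(2,1), of 1] unfolding set_integrable_def by auto
  have idev: "integrable m (\<lambda>y. indicator V y *\<^sub>R \<bar>f y - c\<bar> powr p)"
    using deviation_integrable[OF f V(2,1)] unfolding set_integrable_def .
  have "(LINT y:V|m. \<phi> y) \<le> (LINT y|m. indicator S y *\<^sub>R \<phi> y + indicator (V - K) y *\<^sub>R 1
      + indicator V y *\<^sub>R \<bar>f y - c\<bar> powr p / t powr p)"
    unfolding set_lebesgue_integral_def
  proof (rule integral_mono[OF iV])
    show "integrable m (\<lambda>y. indicator S y *\<^sub>R \<phi> y + indicator (V - K) y *\<^sub>R 1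
      + indicator V y *\<^sub>R \<bar>f y - c\<bar> powr p / t powr p)"
      by (intro Bochner_Integration.integrable_add integrable_divide iS iVK idev)
    fix y
    show "indicator V y *\<^sub>R \<phi> y \<le> indicator S y *\<^sub>R \<phi> y + indicator (V - K) y *\<^sub>R 1
      + indicator V y *\<^sub>R \<bar>f y - c\<bar> powr p / t powr p"
    proof (cases "y \<in> V \<and> y \<in> K \<and> y \<notin> G")
      case True
      then have "t powr p \<le> \<bar>f y - c\<bar> powr p" using t p_pos by (intro powr_mono2) (auto simp: G_def)
      then have "1 \<le> \<bar>f y - c\<bar> powr p / t powr p" using t by simp
      then show ?thesis using True \<phi>(3)[of y] by (simp add: S_def)
    next
      case False
      moreover have "0 \<le> \<bar>f y - c\<bar> powr p / t powr p" by simp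
      ultimately show ?thesis using \<phi>(2,3)[of y] by (auto simp: S_def indicator_def intro: add_increasing2)
    qed
  qed
  also have "\<dots> = (LINT y:S|m. \<phi> y) + measure m (V - K) + deviation f c V / t powr p"
    using iS iVK idev VK unfolding deviation_def set_lebesgue_integral_def by simp
  finally have 1: "(LINT y:V|m. \<phi> y) - measure m (V - K) - deviation f c V / t powr p \<le> (LINT y:S|m. \<phi> y)"
    by simp
  have "a * ((LINT y:V|m. \<phi> y) - measure m (V - K) - deviation f c V / t powr p) \<le> a * (LINT y:S|m. \<phi> y)"
    using 1 a by (rule mult_left_mono)
  also have "\<dots> \<le> (LINT y:S|\<Gamma> f. \<phi> y)"
    using S le \<phi>(2,3) by (intro set_integral_le_of_measure_le[OF finite_\<Gamma>[OF fF] sets_\<Gamma>[OF fF] a S(1,2) _ \<phi>m]) auto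
  also have "\<dots> \<le> (LINT y:V \<inter> G|\<Gamma> f. \<phi> y)"
  proof -
    have "set_integrable (\<Gamma> f) S \<phi>" "set_integrable (\<Gamma> f) (V \<inter> G) \<phi>"
      using set_integrable_bounded[OF finite_\<Gamma>[OF fF] sets_\<Gamma>[OF fF] _ \<phi>m, where k=1] S(1) V(1) G abs\<phi> by auto
    then show ?thesis
      unfolding set_integrable_def set_lebesgue_integral_def using \<phi>(2)
      by (intro integral_mono) (auto simp: S_def indicator_def)
  qed
  finally show ?thesis
    using mutual_test_function_ge[OF f \<phi> V(1,3) t k, of c] unfolding G_def by linarith
qed

lemma energy_disjoint_sum:
  assumes Z: "finite Z" "disjoint_family_on V Z" "\<And>z. z \<in> Z \<Longrightarrow> V z \<in> sets borel"
    and h: "\<And>z. z \<in> Z \<Longrightarrow> h z \<in> core" "\<And>z y. z \<in> Z \<Longrightarrow> y \<notin> V z \<Longrightarrow> h z y = 0"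
  shows "E (\<lambda>y. \<Sum>z\<in>Z. h z y) = (\<Sum>z\<in>Z. measure (\<Gamma> (h z)) (V z))"
proof -
  define g where "g = (\<lambda>y. \<Sum>z\<in>Z. h z y)"
  have g: "g \<in> core" unfolding g_def using Z(1) h(1) by (rule core_sum)
  define U where "U = (\<Union>z\<in>Z. V z)"
  have U: "U \<in> sets borel" unfolding U_def using Z by auto
  have "E g = measure (\<Gamma> g) (U \<union> - U)" using measure_\<Gamma>_UNIV[of g] g by (simp add: Compl_partition)
  also have "\<dots> = measure (\<Gamma> g) U + measure (\<Gamma> g) (- U)" using g U by (intro \<Gamma>_union) auto
  also have "measure (\<Gamma> g) (- U) = 0"
  proof (rule \<Gamma>_constant[OF g, where c=0])
    show "- U \<in> sets borel" using U by (rule borel_comp)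
  qed (use h(2) in \<open>auto simp: g_def U_def\<close>)
  also have "measure (\<Gamma> g) U = (\<Sum>z\<in>Z. measure (\<Gamma> g) (V z))"
    unfolding U_def using Z g finite_measure.finite_measure_finite_Union[OF finite_\<Gamma>, of g Z V]
    by (simp add: image_subset_iff)
  also have "\<dots> = (\<Sum>z\<in>Z. measure (\<Gamma> (h z)) (V z))"
  proof (rule sum.cong[OF refl])
    fix z assume z: "z \<in> Z"
    have "g y = h z y" if "y \<in> V z" for y
      unfolding g_def by (rule sum_disjoint_supports[OF Z(1,2) z that h(2)])
    then show "measure (\<Gamma> g) (V z) = measure (\<Gamma> (h z)) (V z)"
      using Z(3)[OF z] by (intro \<Gamma>_local[OF g h(1)[OF z], where c=0]) auto
  qed
  finally show ?thesis by (simp add: g_def)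
qed

text \<open>
  The first variation of the energy of \<open>f\<close> is continuous in the direction, so by
  strong approximation it cannot stay away from zero along directions of bounded energy that tend
  to zero in \<open>L\<^sup>p\<close>.
\<close>

lemma no_persistent_first_variation:
  assumes f: "f \<in> core" and \<eta>: "0 < \<eta>"
    and h: "\<And>e. 0 < e \<Longrightarrow> \<exists>h\<in>core. \<eta> \<le> mutual f h UNIV \<and> E h \<le> M \<and> Lp_energy h < e"
  shows False
proof -
  define S where "S = {g \<in> core. \<eta> \<le> mutual f g UNIV}"
  define k where "k = 3 * 2 powr p * (E f + 1) / \<eta>"
  have Ef: "0 \<le> E f" using f E_nonneg by simp
  have k: "0 < k" using Ef \<eta> by (simp add: k_def)
  (* With these k and e, both terms of Young's inequality are at most \<eta> / 3. *)
  define e where "e = \<eta> / (3 * 2 powr p * k powr (p - 1))"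
  have e: "0 < e" using \<eta> k by (simp add: e_def)
  have "\<exists>g\<in>S. energy_norm p m E (\<lambda>x. g x - (\<lambda>_. 0) x) < e powr (1 / p)"
  proof (rule strong_approximation[OF _ _ F_zero])
    show "S \<subseteq> F" unfolding S_def by blast
    have borel_UNIV: "UNIV \<in> sets (borel :: 'a measure)" by simp
    show "(\<lambda>x. 1/2 * u x + 1/2 * v x) \<in> S" if "u \<in> S" "v \<in> S" for u v
    proof -
      have uv: "u \<in> core" "v \<in> core" "\<eta> \<le> mutual f u UNIV" "\<eta> \<le> mutual f v UNIV"
        using that unfolding S_def by auto
      have "mutual f (\<lambda>x. 1/2 * u x + 1/2 * v x) UNIV = 1/2 * mutual f u UNIV + 1/2 * mutual f v UNIV"
        unfolding mutual_add[OF f core_scale[OF uv(1)] core_scale[OF uv(2)] borel_UNIV]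
          mutual_scale[OF f uv(1) borel_UNIV] mutual_scale[OF f uv(2) borel_UNIV] ..
      then show ?thesis
        unfolding S_def using uv(3,4) core_add[OF core_scale[OF uv(1), of "1/2"] core_scale[OF uv(2), of "1/2"]]
        by simp
    qed
    show "\<exists>g\<in>S. E g \<le> M \<and> Lp_energy (\<lambda>x. g x - (\<lambda>_. 0) x) < e'" if "0 < e'" for e'
      using h[OF that] unfolding S_def by auto
    show "0 < e powr (1 / p)" using e by simp
  qed
  then obtain g where g: "g \<in> core" "\<eta> \<le> mutual f g UNIV" "energy_norm p m E g < e powr (1 / p)"
    unfolding S_def by auto
  have "E g < e" using energy_norm_less_imp(1)[OF _ g(3)] g(1) e p_pos by (simp add: powr_powr)
  then have "2 powr p * k powr (p - 1) * E g \<le> 2 powr p * k powr (p - 1) * e" by (intro mult_left_mono) auto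
  also have "\<dots> = \<eta> / 3" using k by (simp add: e_def)
  finally have 1: "2 powr p * k powr (p - 1) * E g \<le> \<eta> / 3" .
  have "2 powr p / k * E f \<le> 2 powr p / k * (E f + 1)" using k by (intro mult_left_mono) auto
  also have "\<dots> = \<eta> / 3"
  proof -
    have "2 powr p / (3 * 2 powr p * w / \<eta>) * w = \<eta> / 3" if "0 < w" for w
      using that \<eta> by (simp add: field_simps)
    from this[of "E f + 1"] show ?thesis using Ef by (simp add: k_def)
  qed
  finally have 2: "2 powr p / k * E f \<le> \<eta> / 3" .
  have "\<bar>mutual f g UNIV\<bar> \<le> 2 powr p / k * E f + 2 powr p * k powr (p - 1) * E g"
    using abs_mutual_le[OF f g(1) _ k, of UNIV] measure_\<Gamma>_UNIV f g(1) by simp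
  then show False using 1 2 g(2) \<eta> by linarith
qed

end

context p_energy_measure
begin

lemma singular_of_constant:
  assumes "f \<in> core" "\<forall>x. f x = c"
  shows "mutually_singular (\<Gamma> f) m"
proof -
  have "measure (\<Gamma> f) UNIV = 0" using \<Gamma>_constant[OF assms(1), of UNIV c] assms(2) by simp
  then have "emeasure (\<Gamma> f) UNIV = 0"
    using finite_measure.emeasure_eq_measure[OF finite_\<Gamma>] assms(1) by simp
  then show ?thesis
    unfolding mutually_singular_def using assms(1) by (intro bexI[of _ UNIV]) auto
qed

text \<open>
  The order of the choices matters: \<open>\<delta>\<close> makes the terms containing cutoff energies small, then \<open>l\<close> makes
  the oscillation small compared with \<open>\<delta>\<close>, then \<open>\<epsilon>\<close> limits the mass outside of the compact set even on
  balls of radius \<open>r / l\<close>, and finally \<open>r\<close> tends to zero with all these fixed.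
\<close>

lemma singular_core:
  assumes f: "f \<in> core" and VD: "volume_doubling m"
    and PI: "poincare_inequality p m F \<Gamma> \<Psi>" and CS: "cutoff_sobolev p m F E \<Gamma> \<Psi>"
    and \<Psi>: "\<And>r. 0 < r \<Longrightarrow> 0 < \<Psi> r" and \<Psi>0: "(\<Psi> \<longlongrightarrow> 0) (at_right 0)"
    and ratio: "\<And>\<epsilon>. 0 < \<epsilon> \<Longrightarrow> \<exists>l\<ge>1. \<exists>\<^sub>F r in at_right 0. l powr p * \<Psi> (r / l) / \<Psi> r < \<epsilon>"
  shows "mutually_singular (\<Gamma> f) m"
proof (rule ccontr)
  assume ns: "\<not> mutually_singular (\<Gamma> f) m"
  have fF: "f \<in> F" using f by simp
  (* In a one-point space the Poincare inequality is void, since no radius is admissible. *)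
  have two: "\<exists>a b :: 'a. a \<noteq> b"
  proof (rule ccontr)
    assume "\<not> ?thesis"
    then have "\<forall>x. f x = f undefined" by metis
    then show False using singular_of_constant[OF f] ns by blast
  qed
  define \<mu> where "\<mu> = \<Gamma> f"
  have \<mu>: "finite_measure \<mu>" "sets \<mu> = sets borel" unfolding \<mu>_def using finite_\<Gamma> fF by auto
  obtain L where "continuous_on UNIV f" and L: "compact L" "\<And>x. x \<notin> L \<Longrightarrow> f x = 0" using f CcE by blast
  have "measure \<mu> (- L) = 0"
    unfolding \<mu>_def using L compact_imp_closed[OF L(1)] by (intro \<Gamma>_constant[OF f, where c=0]) auto
  then have "emeasure \<mu> (- L) = 0" using finite_measure.emeasure_eq_measure[OF \<mu>(1)] by simp
  then obtain K\<^sub>0 a D where K0: "compact K\<^sub>0" "0 < measure m K\<^sub>0" and aD: "0 < a" "0 \<le> D"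
    and comp: "\<And>B. B \<in> sets borel \<Longrightarrow> B \<subseteq> K\<^sub>0 \<Longrightarrow> a * measure m B \<le> measure \<mu> B \<and> measure \<mu> B \<le> D * measure m B"
    using comparable_on_compact[OF \<mu> L(1)] ns unfolding \<mu>_def by metis
  have K0b: "K\<^sub>0 \<in> sets borel" "bounded K\<^sub>0" using compact_imp_closed[OF K0(1)] compact_imp_bounded[OF K0(1)] by auto
  obtain C A where C: "0 < C" and A: "1 < A"
    and cut: "\<And>x r. 0 < r \<Longrightarrow> \<exists>\<phi>\<in>core. (\<forall>y. 0 \<le> \<phi> y \<and> \<phi> y \<le> 1) \<and> (\<forall>y. y \<notin> ball x (A * r) \<longrightarrow> \<phi> y = 0) \<and>
      measure (\<Gamma> \<phi>) (ball x (A * r)) \<le> C / \<Psi> r * vol x (A * r) \<and>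
      vol x r / 2 \<le> (LINT y:ball x r|m. \<phi> y)"
    using core_cutoff[OF CS \<Psi>] by metis
  obtain Co R Ap r\<^sub>0 where Co: "0 < Co" "A \<le> R" "1 \<le> Ap" "0 < r\<^sub>0"
    and osc: "\<forall>f x r l H. f \<in> core \<and> 0 < r \<and> r < r\<^sub>0 \<and> 1 \<le> l \<and> 0 \<le> H \<and>
      (\<forall>z. ball z (Ap * (r / l)) \<subseteq> ball x (R * r) \<longrightarrow>
        measure (\<Gamma> f) (ball z (Ap * (r / l))) \<le> H * vol z (Ap * (r / l))) \<longrightarrow>
      (\<exists>c. deviation f c (ball x (A * r)) \<le> Co * H * (l powr p * \<Psi> (r / l)) * vol x (A * r))"
    by (rule poincare_oscillation[OF VD PI less_imp_le[OF A] \<Psi> two]) blast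
  obtain K where K1: "\<And>M. 1 \<le> K M"
    and K: "\<And>M x r. 0 < r \<Longrightarrow> vol x (M * r) \<le> K M * vol x r"
    using ball_growth[OF VD] by metis
  have Kpos: "0 < K M" for M using K1[of M] by linarith
  (* H bounds the energy density of f at the relevant scales, and \<delta> * \<Psi> r powr (1 / p) will be the
     truncation height. *)
  define H where "H = D + 1"
  have H: "0 < H" using aD by (simp add: H_def)
  define \<delta> where "\<delta> = a / (K A * 16 * 3 * 2 powr p * (H + C))"
  have \<delta>: "0 < \<delta>" using aD Kpos[of A] H C by (simp add: \<delta>_def)
  define \<rho> where "\<rho> = \<delta> powr p / (Co * H * 16 * K A)"
  have \<rho>: "0 < \<rho>" using \<delta> Co H Kpos[of A] by (simp add: \<rho>_def)
  obtain l where l: "1 \<le> l" "\<exists>\<^sub>F r in at_right 0. l powr p * \<Psi> (r / l) / \<Psi> r < \<rho>"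
    using ratio[OF \<rho>] by blast
  (* A ball of radius Ap * r / l, enlarged by the factor M, contains the ball of radius R * r in which
     its centre lies. *)
  define M where "M = 2 * R * l / Ap"
  define \<epsilon> where "\<epsilon> = min (1 / (16 * K A * K (R / A))) (1 / K M)"
  have \<epsilon>: "0 < \<epsilon>" "\<epsilon> * K (R / A) \<le> 1 / (16 * K A)" "\<epsilon> * K M \<le> 1"
  proof -
    show "0 < \<epsilon>" using Kpos by (simp add: \<epsilon>_def)
    have "\<epsilon> * K (R / A) \<le> 1 / (16 * K A * K (R / A)) * K (R / A)"
      using Kpos[of "R / A"] by (intro mult_right_mono) (auto simp: \<epsilon>_def)
    then show "\<epsilon> * K (R / A) \<le> 1 / (16 * K A)" using Kpos[of "R / A"] by simp
    have "\<epsilon> * K M \<le> 1 / K M * K M" using Kpos[of M] by (intro mult_right_mono) (auto simp: \<epsilon>_def)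
    then show "\<epsilon> * K M \<le> 1" using Kpos[of M] by simp
  qed
  have \<epsilon>1: "\<epsilon> * K (R / A) \<le> 1"
  proof -
    have "1 / (16 * K A) \<le> 1" using K1[of A] by simp
    then show ?thesis using \<epsilon>(2) by linarith
  qed
  obtain \<rho>\<^sub>0 where \<rho>0: "0 < \<rho>\<^sub>0"
    and centres: "\<And>s. 0 < s \<Longrightarrow> s < \<rho>\<^sub>0 \<Longrightarrow> \<exists>Z. finite Z \<and> Z \<subseteq> K\<^sub>0 \<and> disjoint_family_on (\<lambda>z. ball z s) Z \<and>
      (\<forall>z\<in>Z. measure \<mu> (ball z s - K\<^sub>0) + measure m (ball z s - K\<^sub>0) \<le> \<epsilon> * vol z s) \<and>
      measure m K\<^sub>0 / (2 * K 2) \<le> (\<Sum>z\<in>Z. vol z s)"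
    using good_centres[OF \<mu> Kpos[of 2] K K0 \<epsilon>(1)] by metis
  have R: "0 < R" using Co A by linarith
  obtain x\<^sub>0 e\<^sub>0 where K0_ball: "K\<^sub>0 \<subseteq> ball x\<^sub>0 e\<^sub>0" using bounded_subset_ballD[OF K0b(2)] by blast
  define m\<^sub>0 where "m\<^sub>0 = vol x\<^sub>0 (e\<^sub>0 + A)"
  (* \<kappa> is the gain per unit of mass of a good ball, \<eta> the gain from all good balls of one scale. *)
  define \<kappa> where "\<kappa> = a / (4 * K A)"
  define \<eta> where "\<eta> = \<kappa> / K (R / A) * (measure m K\<^sub>0 / (2 * K 2))"
  define C2 where "C2 = 2 powr p * (product_const * 2 powr p + 1)"
  have C2: "0 \<le> C2" using product_const_pos by (simp add: C2_def)
  have \<kappa>: "0 < \<kappa>" using aD Kpos[of A] by (simp add: \<kappa>_def)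
  have \<eta>: "0 < \<eta>" using \<kappa> Kpos K0(2) by (simp add: \<eta>_def)
  have "\<exists>h\<in>core. \<eta> \<le> mutual f h UNIV \<and> E h \<le> C2 * (H + \<delta> powr p * C) * m\<^sub>0 \<and> Lp_energy h < e"
    if e: "0 < e" for e
  proof -
    have "((\<lambda>r. \<delta> powr p * \<Psi> r * (m\<^sub>0 + 1)) \<longlongrightarrow> \<delta> powr p * 0 * (m\<^sub>0 + 1)) (at_right 0)"
      by (intro tendsto_mult tendsto_const \<Psi>0)
    then have "((\<lambda>r. \<delta> powr p * \<Psi> r * (m\<^sub>0 + 1)) \<longlongrightarrow> 0) (at_right 0)" by simp
    then have ev1: "\<forall>\<^sub>F r in at_right 0. \<delta> powr p * \<Psi> r * (m\<^sub>0 + 1) < e" using e by (rule order_tendstoD(2))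
    define b where "b = min 1 (min r\<^sub>0 (\<rho>\<^sub>0 / R))"
    have "0 < b" using Co \<rho>0 R by (simp add: b_def)
    then have ev2: "\<forall>\<^sub>F r in at_right 0. 0 < r \<and> r < b"
      unfolding eventually_at_right_field by (intro exI[of _ b]) auto
    obtain r where r: "0 < r" "r < b" "\<delta> powr p * \<Psi> r * (m\<^sub>0 + 1) < e" "l powr p * \<Psi> (r / l) / \<Psi> r < \<rho>"
      using frequently_ex[OF frequently_eventually_frequently[OF l(2) eventually_conj[OF ev1 ev2]]] by blast
    have r1: "r < 1" "r < r\<^sub>0" "R * r < \<rho>\<^sub>0" using r(2) R by (auto simp: b_def field_simps)
    have \<Psi>r: "0 < \<Psi> r" using \<Psi>[OF r(1)] .
    define k where "k = \<Psi> r powr (1 / p)"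
    have k: "0 < k" "k powr p = \<Psi> r" using \<Psi>r p_pos by (auto simp: k_def powr_powr)
    define t where "t = \<delta> * k"
    have t: "0 < t" "t powr p = \<delta> powr p * \<Psi> r" using \<delta> k by (auto simp: t_def powr_mult)
    obtain Z where Z: "finite Z" "Z \<subseteq> K\<^sub>0" "disjoint_family_on (\<lambda>z. ball z (R * r)) Z"
      and good: "\<And>z. z \<in> Z \<Longrightarrow> measure \<mu> (ball z (R * r) - K\<^sub>0) + measure m (ball z (R * r) - K\<^sub>0) \<le> \<epsilon> * vol z (R * r)"
      and mass: "measure m K\<^sub>0 / (2 * K 2) \<le> (\<Sum>z\<in>Z. vol z (R * r))"
      using centres[of "R * r"] R r(1) r1(3) by auto
    define V where "V z = ball z (A * r)" for z :: 'a
    have Vb: "V z \<in> sets borel" "bounded (V z)" for z by (auto simp: V_def)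
    have VR: "V z \<subseteq> ball z (R * r)" for z unfolding V_def using Co(2) r(1) by (intro subset_ball) simp
    have disj: "disjoint_family_on V Z"
      using Z(3) VR unfolding disjoint_family_on_def by (meson disjoint_iff subsetD)
    have Vpos: "0 < measure m (V z)" for z unfolding V_def using A r(1) by (intro measure_ball_pos) simp
    have mR: "vol z (R * r) \<le> K (R / A) * measure m (V z)" for z
      using K[of "A * r" z "R / A"] A r(1) by (simp add: V_def)
    (* The density of \<mu> is at most D on the compact set and is controlled outside of it by the choice
       of the centres; so it is at most H on V z and on all balls of radius Ap * r / l nearby. *)
    have \<Gamma>split: "measure \<mu> B \<le> D * measure m B + measure \<mu> (B - K\<^sub>0)" if "B \<in> sets borel" "bounded B" for B
    proof -
      have "measure \<mu> B = measure \<mu> ((B \<inter> K\<^sub>0) \<union> (B - K\<^sub>0))" by (simp add: Int_Diff_Un)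
      also have "\<dots> = measure \<mu> (B \<inter> K\<^sub>0) + measure \<mu> (B - K\<^sub>0)"
        unfolding \<mu>_def using that K0b fF by (intro \<Gamma>_union) auto
      also have "measure \<mu> (B \<inter> K\<^sub>0) \<le> D * measure m (B \<inter> K\<^sub>0)" using comp[of "B \<inter> K\<^sub>0"] that K0b by auto
      also have "\<dots> \<le> D * measure m B"
        using that K0b aD by (intro mult_left_mono measure_mono_bounded) auto
      finally show ?thesis by simp
    qed
    have outside: "measure \<mu> (B - K\<^sub>0) \<le> \<epsilon> * vol z (R * r)" "measure m (B - K\<^sub>0) \<le> \<epsilon> * vol z (R * r)"
      if "z \<in> Z" "B \<subseteq> ball z (R * r)" "B \<in> sets borel" for z B
    proof -
      have s: "B - K\<^sub>0 \<subseteq> ball z (R * r) - K\<^sub>0" using that by blast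
      have "measure \<mu> (B - K\<^sub>0) \<le> measure \<mu> (ball z (R * r) - K\<^sub>0)"
        unfolding \<mu>_def using s K0b fF by (intro \<Gamma>_mono) auto
      moreover have "measure m (B - K\<^sub>0) \<le> measure m (ball z (R * r) - K\<^sub>0)"
        using that(3) K0b bounded_subset[OF bounded_ball, of "ball z (R * r) - K\<^sub>0" z "R * r"]
        by (intro measure_mono_bounded[OF s]) auto
      moreover have "0 \<le> measure \<mu> (ball z (R * r) - K\<^sub>0)" "0 \<le> measure m (ball z (R * r) - K\<^sub>0)" by auto
      ultimately show "measure \<mu> (B - K\<^sub>0) \<le> \<epsilon> * vol z (R * r)" "measure m (B - K\<^sub>0) \<le> \<epsilon> * vol z (R * r)"
        using good[OF that(1)] by linarith+
    qed
    have dens: "measure \<mu> (ball y (Ap * (r / l))) \<le> H * vol y (Ap * (r / l))"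
      if z: "z \<in> Z" and sub: "ball y (Ap * (r / l)) \<subseteq> ball z (R * r)" for z y
    proof -
      define B where "B = ball y (Ap * (r / l))"
      have pos: "0 < Ap * (r / l)" using Co(3) r(1) l(1) by simp
      then have "y \<in> ball y (Ap * (r / l))" by simp
      then have "y \<in> ball z (R * r)" using sub by (rule subsetD[rotated])
      then have "ball z (R * r) \<subseteq> ball y (M * (Ap * (r / l)))"
      proof -
        assume y: "y \<in> ball z (R * r)"
        have M: "M * (Ap * (r / l)) = 2 * (R * r)" using Co(3) l(1) by (simp add: M_def field_simps)
        show ?thesis
        proof
          fix w assume "w \<in> ball z (R * r)"
          then show "w \<in> ball y (M * (Ap * (r / l)))"
            unfolding M using y dist_triangle[of y w z] by (simp add: dist_commute)
        qed
      qed
      then have "vol z (R * r) \<le> measure m (ball y (M * (Ap * (r / l))))"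
        by (intro measure_mono_bounded) auto
      also have "\<dots> \<le> K M * measure m B" unfolding B_def by (rule K[OF pos])
      finally have "\<epsilon> * vol z (R * r) \<le> \<epsilon> * (K M * measure m B)"
        using \<epsilon>(1) by (intro mult_left_mono) auto
      also have "\<dots> = (\<epsilon> * K M) * measure m B" by simp
      also have "\<dots> \<le> 1 * measure m B" using \<epsilon>(3) by (intro mult_right_mono) auto
      finally have "measure \<mu> (B - K\<^sub>0) \<le> measure m B"
        using outside(1)[OF z, of B] sub by (simp add: B_def)
      then show ?thesis using \<Gamma>split[of B] by (simp add: B_def H_def algebra_simps)
    qed
    have "\<exists>c \<phi>. \<phi> \<in> core \<and> (\<forall>y. 0 \<le> \<phi> y \<and> \<phi> y \<le> 1) \<and> (\<forall>y. y \<notin> V z \<longrightarrow> \<phi> y = 0) \<and>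
        measure (\<Gamma> \<phi>) (V z) \<le> C / \<Psi> r * measure m (V z) \<and>
        \<kappa> * measure m (V z) \<le> mutual f (test_function t c f \<phi>) UNIV" if z: "z \<in> Z" for z
    proof -
      define v where "v = measure m (V z)"
      have v: "0 < v" using Vpos by (simp add: v_def)
      obtain \<phi> where \<phi>: "\<phi> \<in> core" "\<And>y. 0 \<le> \<phi> y" "\<And>y. \<phi> y \<le> 1" "\<And>y. y \<notin> V z \<Longrightarrow> \<phi> y = 0"
        and \<Gamma>\<phi>: "measure (\<Gamma> \<phi>) (V z) \<le> C / \<Psi> r * v"
        and lower: "vol z r / 2 \<le> (LINT y:ball z r|m. \<phi> y)"
        using cut[OF r(1), of z] unfolding V_def v_def by blast
      obtain c where c: "deviation f c (V z) \<le> Co * H * (l powr p * \<Psi> (r / l)) * v"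
        using osc[rule_format, of f r l H z] f r(1) r1(2) l(1) H dens[OF z] unfolding V_def v_def \<mu>_def by auto
      have o: "\<epsilon> * vol z (R * r) \<le> v / (16 * K A)"
      proof -
        have "\<epsilon> * vol z (R * r) \<le> \<epsilon> * (K (R / A) * v)"
          using mR[of z] \<epsilon>(1) by (intro mult_left_mono) (auto simp: v_def)
        also have "\<dots> = (\<epsilon> * K (R / A)) * v" by simp
        also have "\<dots> \<le> 1 / (16 * K A) * v" using \<epsilon>(2) v by (intro mult_right_mono) auto
        finally show ?thesis by simp
      qed
      have mV: "measure m (V z - K\<^sub>0) \<le> v / (16 * K A)"
        using outside(2)[OF z VR Vb(1)] o by linarith
      have "v / (16 * K A) \<le> v" using K1[of A] v by (simp add: field_simps)
      then have "measure \<mu> (V z) \<le> D * v + v"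
        using \<Gamma>split[OF Vb, of z] outside(1)[OF z VR Vb(1)] o unfolding v_def by linarith
      then have \<mu>V: "measure \<mu> (V z) \<le> H * v" by (simp add: H_def algebra_simps)
      have main: "v / (2 * K A) \<le> (LINT y:V z|m. \<phi> y)"
      proof -
        have "v \<le> K A * vol z r" unfolding v_def V_def by (rule K[OF r(1)])
        then have "v / (2 * K A) \<le> vol z r / 2" using Kpos[of A] by (simp add: field_simps)
        also note lower
        also have "(LINT y:ball z r|m. \<phi> y) \<le> (LINT y:V z|m. \<phi> y)"
        proof -
          have \<phi>m: "\<phi> \<in> borel_measurable borel" "\<And>y. \<bar>\<phi> y\<bar> \<le> 1" using \<phi> Cc_measurable by auto
          have "ball z r \<subseteq> V z" unfolding V_def using A r(1) by (intro subset_ball) simp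
          then show ?thesis
            using bounded_set_integrable[OF bounded_ball _ \<phi>m, of z r] bounded_set_integrable[OF Vb(2,1) \<phi>m, of z] \<phi>(2)
            unfolding set_integrable_def set_lebesgue_integral_def
            by (intro integral_mono) (auto simp: indicator_def)
        qed
        finally show ?thesis .
      qed
      have dev: "deviation f c (V z) / t powr p \<le> v / (16 * K A)"
      proof -
        have "l powr p * \<Psi> (r / l) \<le> \<rho> * \<Psi> r" using r(4) \<Psi>r by (simp add: field_simps)
        then have "Co * H * (l powr p * \<Psi> (r / l)) * v \<le> Co * H * (\<rho> * \<Psi> r) * v"
          using Co H v by (intro mult_left_mono mult_right_mono) auto
        then have "deviation f c (V z) \<le> Co * H * (\<rho> * \<Psi> r) * v" using c by linarith
        also have "\<dots> = v / (16 * K A) * t powr p" unfolding t(2) \<rho>_def using Co H Kpos[of A] by (simp add: field_simps)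
        finally show ?thesis using t(1) by (simp add: divide_le_eq)
      qed
      have loss: "3 * t * (2 powr p / k * measure (\<Gamma> f) (V z) + 2 powr p * k powr (p - 1) * measure (\<Gamma> \<phi>) (V z))
          \<le> a * (v / (16 * K A))"
      proof -
        have kp: "k powr (p - 1) * k = \<Psi> r" using k by (simp add: powr_diff)
        have "3 * t * (2 powr p / k * measure (\<Gamma> f) (V z) + 2 powr p * k powr (p - 1) * measure (\<Gamma> \<phi>) (V z))
          = 3 * \<delta> * 2 powr p * (measure (\<Gamma> f) (V z) + (k powr (p - 1) * k) * measure (\<Gamma> \<phi>) (V z))"
          using k(1) by (simp add: t_def field_simps)
        also have "\<dots> \<le> 3 * \<delta> * 2 powr p * (H * v + C * v)"
        proof (intro mult_left_mono add_mono)
          show "measure (\<Gamma> f) (V z) \<le> H * v" using \<mu>V by (simp add: \<mu>_def)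
          have "\<Psi> r * measure (\<Gamma> \<phi>) (V z) \<le> \<Psi> r * (C / \<Psi> r * v)" using \<Gamma>\<phi> \<Psi>r by (intro mult_left_mono) auto
          then show "(k powr (p - 1) * k) * measure (\<Gamma> \<phi>) (V z) \<le> C * v" unfolding kp using \<Psi>r by simp
        qed (use \<delta> in auto)
        also have "\<dots> = (\<delta> * (K A * 16 * 3 * 2 powr p * (H + C))) * (v / (16 * K A))"
          using Kpos[of A] by (simp add: field_simps)
        also have "\<delta> * (K A * 16 * 3 * 2 powr p * (H + C)) = a"
        proof -
          have "0 < K A * 16 * 3 * 2 powr p * (H + C)" using Kpos[of A] H C by simp
          moreover have "a / X * X = a" if "0 < X" for X using that by simp
          ultimately show ?thesis unfolding \<delta>_def by blast
        qed
        finally show ?thesis .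
      qed
      have "mutual f (test_function t c f \<phi>) UNIV
        \<ge> a * ((LINT y:V z|m. \<phi> y) - measure m (V z - K\<^sub>0) - deviation f c (V z) / t powr p)
          - 3 * t * (2 powr p / k * measure (\<Gamma> f) (V z) + 2 powr p * k powr (p - 1) * measure (\<Gamma> \<phi>) (V z))"
        using comp aD unfolding \<mu>_def
        by (intro test_function_on_good_ball[OF f \<phi>(1-3) Vb \<phi>(4) K0b(1) _ _ t(1) k(1)]) auto
      moreover have "a * (v / (2 * K A) - v / (16 * K A) - v / (16 * K A))
          \<le> a * ((LINT y:V z|m. \<phi> y) - measure m (V z - K\<^sub>0) - deviation f c (V z) / t powr p)"
        using main mV dev aD by (intro mult_left_mono) linarith+
      moreover have "\<kappa> * v \<le> a * (v / (2 * K A) - v / (16 * K A) - v / (16 * K A)) - a * (v / (16 * K A))"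
        using aD v Kpos[of A] by (simp add: \<kappa>_def field_simps)
      ultimately have "\<kappa> * v \<le> mutual f (test_function t c f \<phi>) UNIV" using loss by linarith
      then show ?thesis using \<phi> \<Gamma>\<phi> unfolding v_def by (intro exI[of _ c] exI[of _ \<phi>]) auto
    qed
    then obtain c \<phi> where \<phi>: "\<And>z. z \<in> Z \<Longrightarrow> \<phi> z \<in> core" "\<And>z y. z \<in> Z \<Longrightarrow> 0 \<le> \<phi> z y \<and> \<phi> z y \<le> 1"
        "\<And>z y. z \<in> Z \<Longrightarrow> y \<notin> V z \<Longrightarrow> \<phi> z y = 0"
      and \<Gamma>\<phi>: "\<And>z. z \<in> Z \<Longrightarrow> measure (\<Gamma> (\<phi> z)) (V z) \<le> C / \<Psi> r * measure m (V z)"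
      and gain: "\<And>z. z \<in> Z \<Longrightarrow> \<kappa> * measure m (V z) \<le> mutual f (test_function t (c z) f (\<phi> z)) UNIV"
      by metis
    define h where "h z = test_function t (c z) f (\<phi> z)" for z
    have h: "h z \<in> core" if "z \<in> Z" for z unfolding h_def by (rule test_function_core[OF f \<phi>(1)[OF that]])
    have h0: "h z y = 0" if "z \<in> Z" "y \<notin> V z" for z y using \<phi>(3)[OF that] by (simp add: h_def test_function_def)
    define g where "g = (\<lambda>y. \<Sum>z\<in>Z. h z y)"
    have g: "g \<in> core" unfolding g_def using Z(1) h by (rule core_sum)
    define U where "U = (\<Union>z\<in>Z. V z)"
    have U: "U \<in> sets borel" unfolding U_def using Z(1) Vb by auto
    have U_sub: "U \<subseteq> ball x\<^sub>0 (e\<^sub>0 + A)"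
    proof
      fix y assume "y \<in> U"
      then obtain z where z: "z \<in> Z" "dist z y < A * r" by (auto simp: U_def V_def)
      have "dist x\<^sub>0 z < e\<^sub>0" using z(1) Z(2) K0_ball by auto
      moreover have "A * r < A" using r1(1) A by simp
      ultimately show "y \<in> ball x\<^sub>0 (e\<^sub>0 + A)" using z(2) dist_triangle[of x\<^sub>0 y z] by simp
    qed
    have sumV: "(\<Sum>z\<in>Z. measure m (V z)) = measure m U"
      unfolding U_def by (rule measure_disjoint_union[OF Z(1) disj Vb])
    have mU: "measure m U \<le> m\<^sub>0" unfolding m\<^sub>0_def using U U_sub by (intro measure_mono_bounded) auto
    have "\<eta> \<le> mutual f g UNIV"
    proof -
      have "\<eta> \<le> \<kappa> / K (R / A) * (\<Sum>z\<in>Z. vol z (R * r))"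
        unfolding \<eta>_def using mass \<kappa> Kpos[of "R / A"] by (intro mult_left_mono) auto
      also have "\<dots> \<le> \<kappa> / K (R / A) * (\<Sum>z\<in>Z. K (R / A) * measure m (V z))"
        using mR \<kappa> Kpos[of "R / A"] by (intro mult_left_mono sum_mono) auto
      also have "\<dots> = (\<Sum>z\<in>Z. \<kappa> * measure m (V z))"
        using Kpos[of "R / A"] by (simp add: sum_distrib_left)
      also have "\<dots> \<le> (\<Sum>z\<in>Z. mutual f (h z) UNIV)" unfolding h_def by (intro sum_mono gain)
      also have "\<dots> = mutual f g UNIV" unfolding g_def by (rule mutual_sum[OF f _ Z(1) h, symmetric]) auto
      finally show ?thesis .
    qed
    moreover have "E g \<le> C2 * (H + \<delta> powr p * C) * m\<^sub>0"
    proof -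
      have "E g = (\<Sum>z\<in>Z. measure (\<Gamma> (h z)) (V z))"
        unfolding g_def by (rule energy_disjoint_sum[OF Z(1) disj Vb(1) h h0])
      also have "\<dots> \<le> (\<Sum>z\<in>Z. C2 * (H + \<delta> powr p * C) * measure m (V z))"
      proof (rule sum_mono)
        fix z assume z: "z \<in> Z"
        have "measure (\<Gamma> (h z)) (V z) \<le> C2 * (measure (\<Gamma> f) (V z) + t powr p * measure (\<Gamma> (\<phi> z)) (V z))"
          unfolding h_def C2_def using \<phi>[OF z] by (intro \<Gamma>_test_function_le[OF f _ _ _ Vb(1) t(1)]) auto
        also have "\<dots> \<le> C2 * (H * measure m (V z) + \<delta> powr p * C * measure m (V z))"
        proof (intro mult_left_mono add_mono C2)
          have "\<epsilon> * vol z (R * r) \<le> \<epsilon> * (K (R / A) * measure m (V z))"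
            using mR[of z] \<epsilon>(1) by (intro mult_left_mono) auto
          also have "\<dots> = (\<epsilon> * K (R / A)) * measure m (V z)" by simp
          also have "\<dots> \<le> 1 * measure m (V z)" using \<epsilon>1 by (intro mult_right_mono) auto
          finally show "measure (\<Gamma> f) (V z) \<le> H * measure m (V z)"
            using \<Gamma>split[OF Vb, of z] outside(1)[OF z VR Vb(1)] unfolding \<mu>_def by (simp add: H_def algebra_simps)
          have "t powr p * measure (\<Gamma> (\<phi> z)) (V z) \<le> t powr p * (C / \<Psi> r * measure m (V z))"
            using \<Gamma>\<phi>[OF z] by (intro mult_left_mono) auto
          also have "\<dots> = \<delta> powr p * C * measure m (V z)" unfolding t(2) using \<Psi>r by simp
          finally show "t powr p * measure (\<Gamma> (\<phi> z)) (V z) \<le> \<delta> powr p * C * measure m (V z)" .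
        qed
        finally show "measure (\<Gamma> (h z)) (V z) \<le> C2 * (H + \<delta> powr p * C) * measure m (V z)"
          by (simp add: algebra_simps)
      qed
      also have "\<dots> = C2 * (H + \<delta> powr p * C) * measure m U"
        unfolding sumV[symmetric] by (simp add: sum_distrib_left)
      also have "\<dots> \<le> C2 * (H + \<delta> powr p * C) * m\<^sub>0" using mU C2 H C by (intro mult_left_mono) auto
      finally show ?thesis .
    qed
    moreover have "Lp_energy g < e"
    proof -
      have Ubd: "bounded U" using U_sub bounded_subset bounded_ball by blast
      have "Lp_energy g \<le> (LINT y:U|m. t powr p)"
        unfolding Lp_energy_def set_lebesgue_integral_def
      proof (rule integral_mono)
        show "integrable m (\<lambda>y. \<bar>g y\<bar> powr p)" using g by (intro F_integrable) auto
        show "integrable m (\<lambda>y. indicator U y *\<^sub>R t powr p)"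
          using const_set_integrable[OF Ubd U] unfolding set_integrable_def .
        fix y
        show "\<bar>g y\<bar> powr p \<le> indicator U y *\<^sub>R t powr p"
        proof (cases "y \<in> U")
          case True
          then obtain z where z: "z \<in> Z" "y \<in> V z" by (auto simp: U_def)
          have "g y = h z y" unfolding g_def by (rule sum_disjoint_supports[OF Z(1) disj z h0])
          also have "\<bar>\<dots>\<bar> \<le> 1 * t"
            unfolding h_def test_function_def abs_mult
            using \<phi>(2)[OF z(1)] abs_clamp_sym_le[of t] t(1) by (intro mult_mono) auto
          finally show ?thesis using True p_pos by (auto intro: powr_mono2)
        next
          case False
          then have "g y = 0" unfolding g_def using h0 by (intro sum.neutral) (auto simp: U_def)
          then show ?thesis using False by simp
        qed
      qed
      also have "\<dots> = t powr p * measure m U" by (rule const_integral_eq[OF Ubd U])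
      also have "\<dots> \<le> \<delta> powr p * \<Psi> r * (m\<^sub>0 + 1)" unfolding t(2) using mU \<Psi>r by (intro mult_left_mono) auto
      finally show ?thesis using r(3) by simp
    qed
    ultimately show ?thesis using g by blast
  qed
  then show False by (rule no_persistent_first_variation[OF f \<eta>])
qed

text \<open>
  If \<open>A n\<close> has full \<open>m\<close>-measure and is \<open>\<Gamma> (g n)\<close>-null, then \<open>\<Gamma> f\<close> gives the intersection of all \<open>A n\<close> a mass
  at most comparable with the energy of \<open>f - g n\<close>, for every \<open>n\<close>.
\<close>

lemma singular_of_core_singular:
  assumes core: "\<And>g. g \<in> core \<Longrightarrow> mutually_singular (\<Gamma> g) m" and f: "f \<in> F"
  shows "mutually_singular (\<Gamma> f) m"
proof -
  have "\<exists>g\<in>core. E (\<lambda>x. f x - g x) < 1 / real (Suc n)" for n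
  proof -
    obtain g where g: "g \<in> core" "energy_norm p m E (\<lambda>x. f x - g x) < (1 / real (Suc n)) powr (1 / p)"
      using regular_F[OF f, of "(1 / real (Suc n)) powr (1 / p)"] by auto
    then have "E (\<lambda>x. f x - g x) < ((1 / real (Suc n)) powr (1 / p)) powr p"
      using f by (intro energy_norm_less_imp(1) F_diff) auto
    then show ?thesis using g(1) p_pos by (auto simp: powr_powr)
  qed
  then obtain g where g: "\<And>n. g n \<in> core" "\<And>n. E (\<lambda>x. f x - g n x) < 1 / real (Suc n)" by metis
  have "\<exists>A\<in>sets borel. emeasure (\<Gamma> (g n)) A = 0 \<and> emeasure m (- A) = 0" for n
    using core[OF g(1)[of n]] g(1)[of n] unfolding mutually_singular_def by (auto simp: Compl_eq_Diff_UNIV)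
  then obtain A where A: "\<And>n. A n \<in> sets borel" "\<And>n. emeasure (\<Gamma> (g n)) (A n) = 0" "\<And>n. emeasure m (- A n) = 0"
    by metis
  define B where "B = (\<Inter>n. A n)"
  have B: "B \<in> sets borel" unfolding B_def using A(1) by auto
  have "measure (\<Gamma> f) B \<le> 2 powr p * (1 / real (Suc n))" for n
  proof -
    have gF: "g n \<in> F" using g(1) by auto
    have d: "(\<lambda>x. f x - g n x) \<in> F" by (rule F_diff[OF f gF])
    have "measure (\<Gamma> f) B = measure (\<Gamma> (\<lambda>x. g n x + (f x - g n x))) B" by simp
    also have "\<dots> \<le> 2 powr p * (measure (\<Gamma> (g n)) B + measure (\<Gamma> (\<lambda>x. f x - g n x)) B)"
      by (rule \<Gamma>_quasi_triangle[OF B gF d])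
    also have "measure (\<Gamma> (g n)) B \<le> measure (\<Gamma> (g n)) (A n)"
      using A(1) gF by (intro \<Gamma>_mono) (auto simp: B_def)
    also have "measure (\<Gamma> (g n)) (A n) = 0" using A(2) by (simp add: measure_def)
    also have "measure (\<Gamma> (\<lambda>x. f x - g n x)) B \<le> E (\<lambda>x. f x - g n x)"
      using \<Gamma>_mono[OF d, of UNIV B] measure_\<Gamma>_UNIV[OF d] by simp
    also have "\<dots> \<le> 1 / real (Suc n)" using g(2)[of n] by simp
    finally show ?thesis by simp
  qed
  moreover have "(\<lambda>n. 2 powr p * (1 / real (Suc n))) \<longlonglongrightarrow> 2 powr p * 0"
    using LIMSEQ_inverse_real_of_nat by (intro tendsto_mult tendsto_const) (simp add: inverse_eq_divide)
  ultimately have "measure (\<Gamma> f) B \<le> 2 powr p * 0" by (intro LIMSEQ_le_const) auto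
  then have "emeasure (\<Gamma> f) B = 0"
    using finite_measure.emeasure_eq_measure[OF finite_\<Gamma>[OF f]] by (simp add: measure_le_0_iff)
  moreover have "emeasure m (- B) = 0"
  proof -
    have "- A n \<in> null_sets m" for n using A by (auto simp: null_sets_def)
    then have "(\<Union>n. - A n) \<in> null_sets m" by (intro null_sets_UN') auto
    then show ?thesis by (simp add: B_def null_sets_def)
  qed
  ultimately show ?thesis
    unfolding mutually_singular_def using B f by (intro bexI[of _ B]) (auto simp: Compl_eq_Diff_UNIV)
qed

end

section \<open>Singularity on the whole domain\<close>

text \<open>
  A homeomorphism of the half-line fixes the end point. If \<open>0\<close> were attained at \<open>y > 0\<close>, small positive
  values would be attained on both sides of \<open>y\<close>.
\<close>

lemma doubling_function_pos:
  assumes "doubling_function \<Psi>"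
  shows "0 < r \<Longrightarrow> 0 < \<Psi> r" and "(\<Psi> \<longlongrightarrow> 0) (at_right 0)"
proof -
  obtain \<Phi> where \<Phi>: "homeomorphism {0..} {0..} \<Psi> \<Phi>" using assms unfolding doubling_function_def by blast
  have cont: "continuous_on {0..} \<Psi>" and img: "\<Psi> ` {0..} = {0..}"
    and inj: "inj_on \<Psi> {0..}"
    using \<Phi> unfolding homeomorphism_def by (auto intro: inj_on_inverseI)
  have nonneg: "0 \<le> \<Psi> r" if "0 \<le> r" for r using img that by auto
  have zero: "\<Psi> 0 = 0"
  proof (rule ccontr)
    assume nz: "\<Psi> 0 \<noteq> 0"
    obtain y where y: "0 \<le> y" "\<Psi> y = 0" using img by (metis atLeast_iff imageE order_refl)
    have y0: "0 < y" using y nz by (cases "y = 0") auto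
    have p0: "0 < \<Psi> 0" using nonneg[of 0] nz by simp
    have p1: "0 < \<Psi> (y + 1)"
      using nonneg[of "y + 1"] inj_onD[OF inj, of y "y + 1"] y by (auto simp: less_le)
    define v where "v = min (\<Psi> 0) (\<Psi> (y + 1)) / 2"
    have v: "0 < v" "v < \<Psi> 0" "v < \<Psi> (y + 1)" using p0 p1 by (auto simp: v_def min_def)
    obtain s where s: "0 \<le> s" "s \<le> y" "\<Psi> s = v"
      using IVT2'[of \<Psi> y v 0] y v continuous_on_subset[OF cont, of "{0..y}"] by auto
    obtain u where u: "y \<le> u" "u \<le> y + 1" "\<Psi> u = v"
      using IVT'[of \<Psi> y v "y + 1"] y v continuous_on_subset[OF cont, of "{y..y+1}"] by auto
    have "s = u" using inj_onD[OF inj, of s u] s u y by auto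
    then show False using s u y v by auto
  qed
  show "0 < \<Psi> r" if "0 < r"
    using nonneg[of r] inj_onD[OF inj, of r 0] zero that by (auto simp: less_le)
  have "(\<Psi> \<longlongrightarrow> \<Psi> 0) (at 0 within {0..})" using cont unfolding continuous_on_def by auto
  then show "(\<Psi> \<longlongrightarrow> 0) (at_right 0)" unfolding zero by (rule tendsto_within_subset) auto
qed

lemma frequently_less_of_Liminf:
  fixes u :: "'b \<Rightarrow> ereal"
  assumes "Liminf G u < c"
  shows "\<exists>\<^sub>F x in G. u x < c"
proof (rule ccontr)
  assume "\<not> ?thesis"
  then have "\<forall>\<^sub>F x in G. c \<le> u x" by (simp add: not_frequently not_less)
  then have "c \<le> Liminf G u" by (rule Liminf_bounded)
  then show False using assms by simp
qed

theorem theorem2p1: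
  fixes m :: "'a::polish_space measure"
    and p :: real
    and F :: "('a \<Rightarrow> real) set"
    and E :: "('a \<Rightarrow> real) \<Rightarrow> real"
    and \<Gamma> :: "('a \<Rightarrow> real) \<Rightarrow> 'a measure"
  assumes "p_energy_measure m p F E \<Gamma>"
  shows "(\<forall>\<Psi>. doubling_function \<Psi> \<and> volume_doubling m \<and>
              poincare_inequality p m F \<Gamma> \<Psi> \<and> cutoff_sobolev p m F E \<Gamma> \<Psi> \<and>
              Liminf at_top (\<lambda>l::real. Liminf (at_right 0)
                (\<lambda>r::real. ereal (l powr p * \<Psi> (r / l) / \<Psi> r))) = 0
            \<longrightarrow> (\<forall>f\<in>F. mutually_singular (\<Gamma> f) m))
       \<and> (\<forall>\<beta>>p. volume_doubling m \<and>
              poincare_inequality p m F \<Gamma> (\<lambda>r. r powr \<beta>) \<and>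
              cutoff_sobolev p m F E \<Gamma> (\<lambda>r. r powr \<beta>)
            \<longrightarrow> (\<forall>f\<in>F. mutually_singular (\<Gamma> f) m))"
proof -
  interpret p_energy_measure m p F E \<Gamma> by fact
  show ?thesis
  proof (intro conjI allI impI ballI; elim conjE)
    fix \<Psi> f assume \<Psi>: "doubling_function \<Psi>" and VD: "volume_doubling m"
      and PI: "poincare_inequality p m F \<Gamma> \<Psi>" and CS: "cutoff_sobolev p m F E \<Gamma> \<Psi>"
      and lim: "Liminf at_top (\<lambda>l::real. Liminf (at_right 0)
                (\<lambda>r::real. ereal (l powr p * \<Psi> (r / l) / \<Psi> r))) = 0" and f: "f \<in> F"
    have ratio: "\<exists>l\<ge>1. \<exists>\<^sub>F r in at_right 0. l powr p * \<Psi> (r / l) / \<Psi> r < \<epsilon>" if "0 < \<epsilon>" for \<epsilon>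
    proof -
      have "Liminf at_top (\<lambda>l::real. Liminf (at_right 0) (\<lambda>r::real. ereal (l powr p * \<Psi> (r / l) / \<Psi> r))) < ereal \<epsilon>"
        unfolding lim using that by simp
      from frequently_eventually_frequently[OF frequently_less_of_Liminf[OF this] eventually_ge_at_top[of 1]]
      obtain l where l: "1 \<le> l" "Liminf (at_right 0) (\<lambda>r::real. ereal (l powr p * \<Psi> (r / l) / \<Psi> r)) < ereal \<epsilon>"
        by (auto dest: frequently_ex)
      show ?thesis using frequently_less_of_Liminf[OF l(2)] l(1) by auto
    qed
    show "mutually_singular (\<Gamma> f) m"
    proof (rule singular_of_core_singular[OF _ f])
      fix g assume g: "g \<in> core"
      show "mutually_singular (\<Gamma> g) m"
        by (rule singular_core[OF g VD PI CS doubling_function_pos(1)[OF \<Psi>] doubling_function_pos(2)[OF \<Psi>] ratio])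
    qed
  next
    fix \<beta> f assume \<beta>: "p < \<beta>" and VD: "volume_doubling m"
      and PI: "poincare_inequality p m F \<Gamma> (\<lambda>r. r powr \<beta>)" and CS: "cutoff_sobolev p m F E \<Gamma> (\<lambda>r. r powr \<beta>)"
      and f: "f \<in> F"
    have pos: "0 < r powr \<beta>" if "0 < r" for r :: real using that by simp
    have "((\<lambda>r. r powr \<beta>) \<longlongrightarrow> 0 powr \<beta>) (at_right 0)"
      using \<beta> p_pos by (intro tendsto_powr2 tendsto_ident_at tendsto_const) (auto simp: eventually_at_right_field intro!: exI[of _ 1])
    then have zero: "((\<lambda>r. r powr \<beta>) \<longlongrightarrow> 0) (at_right 0)" by simp
    have ratio: "\<exists>l\<ge>1. \<exists>\<^sub>F r in at_right 0. l powr p * (r / l) powr \<beta> / r powr \<beta> < \<epsilon>" if "0 < \<epsilon>" for \<epsilon> :: real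
    proof -
      have "((\<lambda>l::real. l powr (p - \<beta>)) \<longlongrightarrow> 0) at_top"
        using \<beta> by (intro tendsto_neg_powr filterlim_ident) auto
      then have "\<forall>\<^sub>F l::real in at_top. l powr (p - \<beta>) < \<epsilon>" using that by (rule order_tendstoD(2))
      then obtain l :: real where l: "1 \<le> l" "l powr (p - \<beta>) < \<epsilon>"
        using eventually_happens[OF eventually_conj[OF eventually_ge_at_top[of 1]]] by fastforce
      have "\<forall>\<^sub>F r in at_right 0. l powr p * (r / l) powr \<beta> / r powr \<beta> < \<epsilon>"
        unfolding eventually_at_right_field
      proof (intro exI[of _ 1] conjI allI impI)
        fix r :: real assume "0 < r" "r < 1"
        then have "l powr p * (r / l) powr \<beta> / r powr \<beta> = l powr (p - \<beta>)"
          using l(1) by (simp add: powr_divide powr_diff)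
        then show "l powr p * (r / l) powr \<beta> / r powr \<beta> < \<epsilon>" using l(2) by simp
      qed simp
      then have "\<exists>\<^sub>F r in at_right 0. l powr p * (r / l) powr \<beta> / r powr \<beta> < \<epsilon>"
        by (intro eventually_frequently) auto
      then show ?thesis using l(1) by blast
    qed
    show "mutually_singular (\<Gamma> f) m"
    proof (rule singular_of_core_singular[OF _ f])
      fix g assume g: "g \<in> core"
      show "mutually_singular (\<Gamma> g) m"
        by (rule singular_core[OF g VD PI CS pos zero ratio])
    qed
  qed
qed

end
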